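(* Let $\Omega:=\,]0,+\infty[\times\mathbb{R}^2$. Then there is a vector field $b:\,]0,1[\times\Omega\to\mathbb{R}^3$ such that i) $b\in L^\infty(]0,1[\times\Omega;\mathbb{R}^3)$; ii) $\mathrm{div}\, b\equiv 0$; iii) for every open and bounded set $\Omega_*$ such that its closure satisfies $\bar\Omega_*\subseteq\Omega$, we have $b\in L^1([0,1[;BV(\Omega_*;\mathbb{R}^3))$; iv) $\mathrm{Tr}\, b\equiv-1$ on $]0,1[\times\partial\Omega$; v) the initial-boundary value problem $$\begin{cases}\partial_t u+\mathrm{div}(bu)=0&\text{in }]0,1[\times\Omega\\ u=0&\text{on }]0,1[\times\partial\Omega\\ u=0&\text{at }t=0\end{cases}$$ admits infinitely many different (distributional) solutions $u\in L^\infty(]0,1[\times\Omega)$.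
   Context: Here $\mathrm{div}$ and $\nabla$ denote the (distributional) divergence and the gradient with respect to the space variable $x\in\Omega$ only; $\mathcal{H}^2$ is two-dimensional Hausdorff measure, and $L^\infty(]0,1[\times\partial\Omega)$ is taken with respect to $\mathcal{L}^1\otimes\mathcal{H}^2$. Normal trace of $b$ (with respect to the outward normal), for $b$ bounded with $\mathrm{div}\,b\equiv0$: $\mathrm{Tr}\, b\in L^\infty(]0,1[\times\partial\Omega)$ is the unique function such that for all $\varphi\in C^\infty_c([0,1[\times\mathbb{R}^3)$ $$\int_0^1\!\!\int_{\partial\Omega}\mathrm{Tr}\,b\;\varphi\,d\mathcal{H}^{2}dt-\int_\Omega\varphi(0,x)\,dx=\int_0^1\!\!\int_\Omega(\partial_t\varphi+b\cdot\nabla\varphi)\,dxdt .$$ Traces of $bu$: if $u\in L^\infty(]0,1[\times\Omega)$ satisfies $$\int_0^1\!\!\int_\Omega u(\partial_t\eta+b\cdot\nabla\eta)\,dxdt=0\quad\forall\,\eta\in C^\infty_c(]0,1[\times\Omega),\qquad( * )$$ then there are uniquely determined functions $\mathrm{Tr}(bu)\in L^\infty(]0,1[\times\partial\Omega)$ and $u_0\in L^\infty(\Omega)$ such that for all $\varphi\in C^\infty_c([0,1[\times\mathbb{R}^3)$ $$\int_0^1\!\!\int_{\partial\Omega}\mathrm{Tr}(bu)\,\varphi\,d\mathcal{H}^{2}dt-\int_\Omega\varphi(0,\cdot)u_0\,dx=\int_0^1\!\!\int_\Omega u(\partial_t\varphi+b\cdot\nabla\varphi)\,dxdt .$$ In general,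 boundary data $\bar g$ are prescribed on $\Gamma^-:=\{\mathrm{Tr}\,b<0\}\subseteq\,]0,1[\times\partial\Omega$, and a distributional solution with initial datum $\bar u$ and boundary datum $\bar g$ is $u\in L^\infty(]0,1[\times\Omega)$ satisfying $( * )$, $u_0=\bar u$, and $\mathrm{Tr}(bu)=\bar g\,\mathrm{Tr}\,b$ on $\Gamma^-$. When $\mathrm{Tr}\,b\equiv-1$, $\Gamma^-$ is all of $]0,1[\times\partial\Omega$; so here, with $\bar u=0$, $\bar g=0$, a solution is a $u\in L^\infty(]0,1[\times\Omega)$ satisfying $( * )$, $u_0\equiv0$ and $\mathrm{Tr}(bu)\equiv0$ on $]0,1[\times\partial\Omega$. *)

theory Defs
  imports "HOL-Analysis.Analysis"
begin

section \<open>Smooth functions and test functions\<close>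

primrec Ck :: "nat \<Rightarrow> ('a::real_normed_vector \<Rightarrow> 'b::real_normed_vector) \<Rightarrow> bool" where
  "Ck 0 f \<longleftrightarrow> continuous_on UNIV f"
| "Ck (Suc n) f \<longleftrightarrow>
     (\<forall>x. f differentiable (at x)) \<and> (\<forall>v. Ck n (\<lambda>x. frechet_derivative f (at x) v))"

definition Cinf :: "('a::real_normed_vector \<Rightarrow> 'b::real_normed_vector) \<Rightarrow> bool" where
  "Cinf f \<longleftrightarrow> (\<forall>n. Ck n f)"

definition compact_support_in ::
  "'a::topological_space set \<Rightarrow> ('a \<Rightarrow> 'b::zero) \<Rightarrow> bool" where
  "compact_support_in U f \<longleftrightarrow> compact (closure {x. f x \<noteq> 0}) \<and> closure {x. f x \<noteq> 0} \<subseteq> U"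

text \<open>Elements of \<open>C\<^sub>c\<^sup>\<infinity>(U)\<close> for open \<open>U\<close>, extended by zero to the whole space.\<close>

definition test_fun :: "'a::real_normed_vector set \<Rightarrow> ('a \<Rightarrow> real) \<Rightarrow> bool" where
  "test_fun U f \<longleftrightarrow> Cinf f \<and> compact_support_in U f"

section \<open>Space-time\<close>

text \<open>
  Points of space-time are pairs \<open>(t, x)\<close>. Functions on \<open>]0,1[ \<times> \<Omega>\<close> are total functions
  of which only the values on \<open>]0,1[ \<times> \<Omega>\<close> are ever used.
\<close>

type_synonym r3 = "real ^ 3"

definition half_space :: "r3 set" where
  "half_space = {x. x $ 1 > 0}"

definition cylinder :: "r3 set \<Rightarrow> (real \<times> r3) set" where
  "cylinder \<Omega> = {0<..<1} \<times> \<Omega>"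

definition dt :: "(real \<times> r3 \<Rightarrow> real) \<Rightarrow> real \<times> r3 \<Rightarrow> real" where
  "dt \<phi> z = frechet_derivative \<phi> (at z) (1, 0)"

definition grad_x :: "(real \<times> r3 \<Rightarrow> real) \<Rightarrow> real \<times> r3 \<Rightarrow> r3" where
  "grad_x \<phi> z = (\<chi> i. frechet_derivative \<phi> (at z) (0, axis i 1))"

text \<open>
  \<open>C\<^sub>c\<^sup>\<infinity>([0,1[ \<times> R\<^sup>3)\<close> consists of the restrictions to \<open>t \<ge> 0\<close> of the elements of
  \<open>C\<^sub>c\<^sup>\<infinity>(]-\<infinity>,1[ \<times> R\<^sup>3)\<close>; in particular its elements need not vanish at \<open>t = 0\<close>.
\<close>

definition test_fun_initial :: "(real \<times> r3 \<Rightarrow> real) \<Rightarrow> bool" where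
  "test_fun_initial \<phi> \<longleftrightarrow> test_fun ({..<1} \<times> UNIV) \<phi>"

section \<open>Hausdorff measure and essentially bounded functions\<close>

text \<open>
  The normalisation is the usual one: \<open>k\<close>-dimensional Hausdorff measure agrees with Lebesgue
  measure on \<open>k\<close>-dimensional affine subspaces. Empty covering sets contribute \<open>0\<close> also
  for \<open>k = 0\<close>; boundedness is required because \<open>diameter\<close> is meaningless for unbounded sets.
\<close>

definition hausdorff_pre :: "nat \<Rightarrow> real \<Rightarrow> 'a::metric_space set \<Rightarrow> ennreal" where
  "hausdorff_pre k d A =
     (INF E \<in> {E :: nat \<Rightarrow> 'a set. A \<subseteq> (\<Union>i. E i) \<and> (\<forall>i. bounded (E i) \<and> diameter (E i) \<le> d)}.
        \<Sum>i. if E i = {} then 0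
             else ennreal (unit_ball_vol (real k) * (diameter (E i) / 2) ^ k))"

definition hausdorff_outer :: "nat \<Rightarrow> 'a::metric_space set \<Rightarrow> ennreal" where
  "hausdorff_outer k A = (SUP d \<in> {0<..}. hausdorff_pre k d A)"

definition hausdorff_measure :: "nat \<Rightarrow> 'a::metric_space measure" where
  "hausdorff_measure k = measure_of UNIV (sets borel) (hausdorff_outer k)"

definition lateral_measure :: "r3 set \<Rightarrow> (real \<times> r3) measure" where
  "lateral_measure \<Omega> =
     restrict_space lborel {0<..<1} \<Otimes>\<^sub>M restrict_space (hausdorff_measure 2) (frontier \<Omega>)"

definition Linf :: "'a measure \<Rightarrow> ('a \<Rightarrow> 'b::real_normed_vector) \<Rightarrow> bool" where
  "Linf M f \<longleftrightarrow> f \<in> borel_measurable M \<and> (\<exists>C. AE z in M. norm (f z) \<le> C)"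

section \<open>Functions of bounded variation\<close>

text \<open>
  Row \<open>i\<close> of the matrix field \<open>\<psi>\<close> is tested against the component \<open>f\<^sub>i\<close>. The norm on
  \<^typ>\<open>real ^ 3 ^ 3\<close> is the Euclidean (Frobenius) norm.
\<close>

definition row_div :: "(r3 \<Rightarrow> real ^ 3 ^ 3) \<Rightarrow> r3 \<Rightarrow> r3" where
  "row_div \<psi> x = (\<chi> i. \<Sum>j\<in>UNIV. frechet_derivative \<psi> (at x) (axis j 1) $ i $ j)"

text \<open>
  \<open>ennreal\<close> truncates negative numbers to \<open>0\<close>; this is harmless since \<open>\<psi> = 0\<close> is admissible.
\<close>

definition total_variation :: "r3 set \<Rightarrow> (r3 \<Rightarrow> r3) \<Rightarrow> ennreal" where
  "total_variation U f =
     (SUP \<psi> \<in> {\<psi>. Ck 1 \<psi> \<and> compact_support_in U \<psi> \<and> (\<forall>x. norm (\<psi> x) \<le> 1)}.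
        ennreal (LINT x | lebesgue_on U. f x \<bullet> row_div \<psi> x))"

definition BV :: "r3 set \<Rightarrow> (r3 \<Rightarrow> r3) \<Rightarrow> bool" where
  "BV U f \<longleftrightarrow> integrable (lebesgue_on U) f \<and> total_variation U f < \<infinity>"

definition BV_norm :: "r3 set \<Rightarrow> (r3 \<Rightarrow> r3) \<Rightarrow> ennreal" where
  "BV_norm U f = (\<integral>\<^sup>+ x. ennreal (norm (f x)) \<partial>lebesgue_on U) + total_variation U f"

definition L1_BV :: "r3 set \<Rightarrow> (real \<times> r3 \<Rightarrow> r3) \<Rightarrow> bool" where
  "L1_BV U b \<longleftrightarrow>
     b \<in> borel_measurable (lebesgue_on (cylinder U)) \<and>
     (AE t in lebesgue_on {0..<1}. BV U (\<lambda>x. b (t, x))) \<and>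
     (\<lambda>t. BV_norm U (\<lambda>x. b (t, x))) \<in> borel_measurable (lebesgue_on {0..<1}) \<and>
     (\<integral>\<^sup>+ t. BV_norm U (\<lambda>x. b (t, x)) \<partial>lebesgue_on {0..<1}) < \<infinity>"

section \<open>Divergence, traces and the initial-boundary value problem\<close>

definition div_free :: "r3 set \<Rightarrow> (real \<times> r3 \<Rightarrow> r3) \<Rightarrow> bool" where
  "div_free \<Omega> b \<longleftrightarrow>
     (\<forall>\<eta>. test_fun (cylinder \<Omega>) \<eta> \<longrightarrow>
        (LINT z | lebesgue_on (cylinder \<Omega>). b z \<bullet> grad_x \<eta> z) = 0)"

text \<open>
  Traces are determined only up to null sets, so ``\<open>g\<close> is (a representative of) the trace''
  is rendered as a relation.
\<close>

definition is_normal_trace ::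
  "r3 set \<Rightarrow> (real \<times> r3 \<Rightarrow> r3) \<Rightarrow> (real \<times> r3 \<Rightarrow> real) \<Rightarrow> bool" where
  "is_normal_trace \<Omega> b Trb \<longleftrightarrow>
     Linf (lateral_measure \<Omega>) Trb \<and>
     (\<forall>\<phi>. test_fun_initial \<phi> \<longrightarrow>
        (LINT z | lateral_measure \<Omega>. Trb z * \<phi> z) - (LINT x | lebesgue_on \<Omega>. \<phi> (0, x))
        = (LINT z | lebesgue_on (cylinder \<Omega>). dt \<phi> z + b z \<bullet> grad_x \<phi> z))"

definition weak_solution ::
  "r3 set \<Rightarrow> (real \<times> r3 \<Rightarrow> r3) \<Rightarrow> (real \<times> r3 \<Rightarrow> real) \<Rightarrow> bool" where
  "weak_solution \<Omega> b u \<longleftrightarrow>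
     Linf (lebesgue_on (cylinder \<Omega>)) u \<and>
     (\<forall>\<eta>. test_fun (cylinder \<Omega>) \<eta> \<longrightarrow>
        (LINT z | lebesgue_on (cylinder \<Omega>). u z * (dt \<eta> z + b z \<bullet> grad_x \<eta> z)) = 0)"

definition are_traces ::
  "r3 set \<Rightarrow> (real \<times> r3 \<Rightarrow> r3) \<Rightarrow> (real \<times> r3 \<Rightarrow> real) \<Rightarrow> (real \<times> r3 \<Rightarrow> real) \<Rightarrow> (r3 \<Rightarrow> real) \<Rightarrow> bool" where
  "are_traces \<Omega> b u Trbu u0 \<longleftrightarrow>
     Linf (lateral_measure \<Omega>) Trbu \<and>
     Linf (lebesgue_on \<Omega>) u0 \<and>
     (\<forall>\<phi>. test_fun_initial \<phi> \<longrightarrow>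
        (LINT z | lateral_measure \<Omega>. Trbu z * \<phi> z) - (LINT x | lebesgue_on \<Omega>. \<phi> (0, x) * u0 x)
        = (LINT z | lebesgue_on (cylinder \<Omega>). u z * (dt \<phi> z + b z \<bullet> grad_x \<phi> z)))"

text \<open>
  Distributional solution of \<open>\<partial>\<^sub>t u + div (b u) = 0\<close> with initial datum \<open>ubar\<close> and boundary
  datum \<open>gbar\<close>, the latter being prescribed only where the normal trace of \<open>b\<close> is negative.
\<close>

definition ibvp_solution ::
  "r3 set \<Rightarrow> (real \<times> r3 \<Rightarrow> r3) \<Rightarrow> (r3 \<Rightarrow> real) \<Rightarrow> (real \<times> r3 \<Rightarrow> real) \<Rightarrow> (real \<times> r3 \<Rightarrow> real) \<Rightarrow> bool" where
  "ibvp_solution \<Omega> b ubar gbar u \<longleftrightarrow>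
     weak_solution \<Omega> b u \<and>
     (\<exists>Trb Trbu u0. is_normal_trace \<Omega> b Trb \<and> are_traces \<Omega> b u Trbu u0 \<and>
        (AE x in lebesgue_on \<Omega>. u0 x = ubar x) \<and>
        (AE z in lateral_measure \<Omega>. Trb z < 0 \<longrightarrow> Trbu z = gbar z * Trb z))"

end

theory Submission
  imports Defs
begin

text \<open>
  The field is stationary, \<open>b(t, x) = (c, B(x\<^sub>1/c, x\<^sub>2, x\<^sub>3))\<close>: the distance to the boundary plays
  the role of time for a planar mixing flow of Depauw type. On the dyadic slab
  \<open>2\<^sup>-\<^sup>n\<^sup>-\<^sup>1 < s \<le> 2\<^sup>-\<^sup>n\<close> the planar field is a discontinuous shear of speed \<open>0\<close> or \<open>1\<close>, alternately
  in the two coordinate directions. Following it as \<open>s\<close> decreases through the slab refines the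
  \<open>n\<close>-th checkerboard into the next one, so the transported checkerboards tend weakly to \<open>0\<close> as
  \<open>s \<rightarrow> 0\<close>: they have zero trace on the boundary although they take only the values \<open>\<plusminus>1\<close>.
  Cutting them off to \<open>s < t\<close> gives a nonzero solution with zero initial datum, and its
  multiples are infinitely many solutions. Away from the boundary only finitely many slabs and
  finitely many jumps of the shears are met, whence the \<open>BV\<close> bound.

  The isodiametric inequality is not needed: translation invariance shows that \<open>\<H>\<^sup>2\<close> on the plane
  is \<open>c\<close> times Lebesgue measure for some \<open>0 < c < \<infinity>\<close>, and this \<open>c\<close> is taken as the first component
  of the field.
\<close>

text \<open>The normal component points into the domain, so along the flow the pattern is unmixed:
  an oscillation that is infinitely fine at the boundary, hence invisible to the weak normal trace,
  emerges as a coarse checkerboard. This is why data on the whole inflow boundary fail to determine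
  the solution. The cut-off \<open>s < t\<close> is compatible with the equation because
  \<open>s\<close> and \<open>t\<close> both advance at unit rate along trajectories; since
  \<open>t < 1\<close>, the solution never reaches \<open>s = 1\<close>. The constant
  \<open>c\<close> is harmless for the trace: inflow \<open>c\<close> per unit of Lebesgue area is
  inflow 1 per unit of Hausdorff measure. No flow of the full field is constructed. The transport
  identity is tested against functions that may be nonzero at \<open>t = 0\<close> and on the
  boundary; if its integral vanishes for all of them, the equation and both zero traces hold at
  once. The integral is computed slab by slab: faces between slabs telescope, and the face
  approaching the boundary is controlled by mixing.\<close>

lemma borel_measurable_fst_snd [measurable]:
  "(fst :: 'a::topological_space \<times> 'b::topological_space \<Rightarrow> 'a) \<in> borel_measurable borel"
  "(snd :: 'a \<times> 'b \<Rightarrow> 'b) \<in> borel_measurable borel"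
  by (auto intro!: borel_measurable_continuous_onI continuous_intros)

lemma borel_measurable_Pair' [measurable]:
  fixes f :: "'c \<Rightarrow> 'a::second_countable_topology" and g :: "'c \<Rightarrow> 'b::second_countable_topology"
  assumes "f \<in> borel_measurable M" "g \<in> borel_measurable M"
  shows "(\<lambda>x. (f x, g x)) \<in> borel_measurable M"
  using measurable_Pair[OF assms] by (simp add: borel_prod)

text \<open>The tangential variables are kept as a pair so that they form a Euclidean space of their
  own, with its own Lebesgue measure.\<close>

definition vec3 :: "real \<Rightarrow> real \<times> real \<Rightarrow> r3" where
  "vec3 s y = s *\<^sub>R axis 1 1 + fst y *\<^sub>R axis 2 1 + snd y *\<^sub>R axis 3 1"

lemma vec3_nth [simp]: "vec3 s y $ 1 = s" "vec3 s y $ 2 = fst y" "vec3 s y $ 3 = snd y"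
  by (simp_all add: vec3_def axis_def)

lemma vec3_eta: "vec3 (x $ 1) (x $ 2, x $ 3) = x"
  by (simp add: vec_eq_iff forall_3)

lemma vec3_add: "vec3 s y + vec3 t z = vec3 (s + t) (y + z)"
  and vec3_scaleR: "r *\<^sub>R vec3 s y = vec3 (r * s) (r *\<^sub>R y)"
  by (simp_all add: vec_eq_iff forall_3)

lemma measurable_vec3 [measurable]:
  assumes [measurable]: "f \<in> borel_measurable M" and g: "g \<in> borel_measurable M"
  shows "(\<lambda>x. vec3 (f x) (g x)) \<in> borel_measurable M"
proof -
  have [measurable]: "g \<in> M \<rightarrow>\<^sub>M borel \<Otimes>\<^sub>M borel" using g by (simp add: borel_prod)
  show ?thesis unfolding vec3_def by measurable
qed

lemma borel_measurable_vec_component [measurable]: "(\<lambda>x :: real^'n. x $ i) \<in> borel_measurable borel"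
  by (intro borel_measurable_continuous_onI continuous_intros)

lemma norm_vec3_diff_le: "norm (vec3 s y - vec3 s z) \<le> \<bar>fst y - fst z\<bar> + \<bar>snd y - snd z\<bar>"
proof -
  have "vec3 s y - vec3 s z = (fst y - fst z) *\<^sub>R axis 2 1 + (snd y - snd z) *\<^sub>R axis 3 1"
    by (simp add: vec3_def algebra_simps)
  moreover have "norm (axis i 1 :: r3) = 1" for i by (rule norm_Basis) simp
  ultimately show ?thesis by (auto intro!: norm_triangle_le)
qed

section \<open>Hausdorff measure is a Borel measure\<close>

definition hausdorff_cost :: "nat \<Rightarrow> 'a::metric_space set \<Rightarrow> ennreal" where
  "hausdorff_cost k E =
     (if E = {} then 0 else ennreal (unit_ball_vol (real k) * (diameter E / 2) ^ k))"

definition hausdorff_covers :: "real \<Rightarrow> 'a::metric_space set \<Rightarrow> (nat \<Rightarrow> 'a set) set" where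
  "hausdorff_covers d A = {E. A \<subseteq> (\<Union>i. E i) \<and> (\<forall>i. bounded (E i) \<and> diameter (E i) \<le> d)}"

lemma hausdorff_pre_eq:
  "hausdorff_pre k d A = (INF E \<in> hausdorff_covers d A. \<Sum>i. hausdorff_cost k (E i))"
  unfolding hausdorff_pre_def hausdorff_cost_def hausdorff_covers_def by simp

lemma hausdorff_pre_le:
  "E \<in> hausdorff_covers d A \<Longrightarrow> hausdorff_pre k d A \<le> (\<Sum>i. hausdorff_cost k (E i))"
  unfolding hausdorff_pre_eq by (rule INF_lower)

lemma hausdorff_pre_mono: "A \<subseteq> B \<Longrightarrow> hausdorff_pre k d A \<le> hausdorff_pre k d B"
  unfolding hausdorff_pre_eq hausdorff_covers_def by (rule INF_superset_mono) auto

lemma hausdorff_pre_antimono: "d \<le> e \<Longrightarrow> hausdorff_pre k e A \<le> hausdorff_pre k d A"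
  unfolding hausdorff_pre_eq hausdorff_covers_def
  by (rule INF_superset_mono) (auto intro: order_trans)

lemma hausdorff_pre_empty: "0 \<le> d \<Longrightarrow> hausdorff_pre k d {} = 0"
  using hausdorff_pre_le[of "\<lambda>_. {}" d "{}" k]
  by (simp add: hausdorff_covers_def hausdorff_cost_def)

lemma hausdorff_pre_UN_le:
  fixes A :: "nat \<Rightarrow> 'a::metric_space set"
  shows "hausdorff_pre k d (\<Union>i. A i) \<le> (\<Sum>i. hausdorff_pre k d (A i))"
proof (rule ennreal_le_epsilon)
  fix e :: real
  assume fin: "(\<Sum>i. hausdorff_pre k d (A i)) < top" and e: "0 < e"
  have "\<exists>E \<in> hausdorff_covers d (A i).
      (\<Sum>j. hausdorff_cost k (E j)) \<le> hausdorff_pre k d (A i) + ennreal (e * (1/2) ^ Suc i)" for i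
  proof -
    have "hausdorff_pre k d (A i) \<noteq> top"
      using fin by (metis ennreal_suminf_lessD less_top)
    then have "hausdorff_pre k d (A i) < hausdorff_pre k d (A i) + ennreal (e * (1/2) ^ Suc i)"
      using e by (simp add: ennreal_add_left_cancel_less[of _ 0, simplified] less_top)
    then show ?thesis
      unfolding hausdorff_pre_eq INF_less_iff by (auto intro: less_imp_le)
  qed
  then obtain E where E: "\<And>i. E i \<in> hausdorff_covers d (A i)"
    "\<And>i. (\<Sum>j. hausdorff_cost k (E i j)) \<le> hausdorff_pre k d (A i) + ennreal (e * (1/2) ^ Suc i)"
    by metis
  define F where "F = (\<lambda>n. case prod_decode n of (i, j) \<Rightarrow> E i j)"
  have "F \<in> hausdorff_covers d (\<Union>i. A i)"
  proof -
    have "\<exists>n. x \<in> F n" if "x \<in> A i" for x i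
    proof -
      have "x \<in> (\<Union>j. E i j)" using E(1)[of i] that unfolding hausdorff_covers_def by blast
      then obtain j where "x \<in> E i j" by blast
      then have "x \<in> F (prod_encode (i, j))" by (simp add: F_def)
      then show ?thesis ..
    qed
    moreover have "bounded (F n) \<and> diameter (F n) \<le> d" for n
      using E(1) unfolding hausdorff_covers_def F_def by (auto split: prod.split)
    ultimately show ?thesis unfolding hausdorff_covers_def by blast
  qed
  then have "hausdorff_pre k d (\<Union>i. A i) \<le> (\<Sum>n. hausdorff_cost k (F n))"
    by (rule hausdorff_pre_le)
  also have "\<dots> = (\<Sum>n. (\<lambda>(i, j). hausdorff_cost k (E i j)) (prod_decode n))"
    by (simp add: F_def case_prod_beta)
  also have "\<dots> = (\<Sum>i. \<Sum>j. hausdorff_cost k (E i j))"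
    by (intro suminf_ennreal_2dimen) simp
  also have "\<dots> \<le> (\<Sum>i. hausdorff_pre k d (A i) + ennreal (e * (1/2) ^ Suc i))"
    by (intro suminf_le E) auto
  also have "\<dots> = (\<Sum>i. hausdorff_pre k d (A i)) + (\<Sum>i. ennreal (e * (1/2) ^ Suc i))"
    by (intro suminf_add[symmetric]) auto
  also have "(\<Sum>i. ennreal (e * (1/2) ^ Suc i)) = ennreal e"
    using e sums_mult[OF power_half_series, of e] by (intro suminf_ennreal_eq) auto
  finally show "hausdorff_pre k d (\<Union>i. A i) \<le> (\<Sum>i. hausdorff_pre k d (A i)) + ennreal e" .
qed

lemma hausdorff_outer_empty: "hausdorff_outer k {} = 0"
  unfolding hausdorff_outer_def by (intro antisym SUP_least) (auto simp: hausdorff_pre_empty)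

lemma hausdorff_pre_le_outer: "0 < d \<Longrightarrow> hausdorff_pre k d A \<le> hausdorff_outer k A"
  unfolding hausdorff_outer_def by (rule SUP_upper) simp

lemma hausdorff_outer_mono: "A \<subseteq> B \<Longrightarrow> hausdorff_outer k A \<le> hausdorff_outer k B"
  unfolding hausdorff_outer_def by (intro SUP_mono) (auto intro: hausdorff_pre_mono)

lemma hausdorff_outer_UN_le: "hausdorff_outer k (\<Union>i. A i) \<le> (\<Sum>i. hausdorff_outer k (A i))"
  unfolding hausdorff_outer_def[of k "\<Union>i. A i"]
proof (rule SUP_least)
  fix d :: real assume "d \<in> {0<..}"
  then have "(\<Sum>i. hausdorff_pre k d (A i)) \<le> (\<Sum>i. hausdorff_outer k (A i))"
    by (intro suminf_le hausdorff_pre_le_outer) auto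
  with hausdorff_pre_UN_le show "hausdorff_pre k d (\<Union>i. A i) \<le> (\<Sum>i. hausdorff_outer k (A i))"
    by (rule order_trans)
qed

lemma outer_measure_space_hausdorff: "outer_measure_space (Pow UNIV) (hausdorff_outer k)"
  unfolding outer_measure_space_def positive_def increasing_def countably_subadditive_def
  by (auto intro: hausdorff_outer_mono hausdorff_outer_UN_le simp: hausdorff_outer_empty)

text \<open>A set of diameter below \<open>\<delta>\<close> cannot meet both \<open>A\<close> and
  \<open>B\<close>. A fine cover of the union therefore splits into a cover of each part, and
  because empty sets cost nothing the two costs add up to at most that of the original
  cover.\<close>

lemma hausdorff_outer_separated:
  assumes "0 < \<delta>" and sep: "\<And>x y. x \<in> A \<Longrightarrow> y \<in> B \<Longrightarrow> \<delta> \<le> dist x y"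
  shows "hausdorff_outer k A + hausdorff_outer k B \<le> hausdorff_outer k (A \<union> B)"
proof -
  have small: "hausdorff_pre k d A + hausdorff_pre k d B \<le> hausdorff_pre k d (A \<union> B)"
    if d: "0 < d" "d < \<delta>" for d
    unfolding hausdorff_pre_eq[of k d "A \<union> B"]
  proof (rule INF_greatest)
    fix E assume E: "E \<in> hausdorff_covers d (A \<union> B)"
    define EA where "EA i = (if E i \<inter> A \<noteq> {} then E i else {})" for i
    define EB where "EB i = (if E i \<inter> B \<noteq> {} then E i else {})" for i
    have disj: "E i \<inter> A = {} \<or> E i \<inter> B = {}" for i
    proof (rule ccontr)
      assume "\<not> ?thesis"
      then obtain x y where "x \<in> E i" "x \<in> A" "y \<in> E i" "y \<in> B" by blast
      then have "\<delta> \<le> dist x y" "dist x y \<le> d"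
        using sep E diameter_bounded_bound[of "E i" x y]
        by (auto simp: hausdorff_covers_def intro: order_trans)
      with d show False by simp
    qed
    have "EA \<in> hausdorff_covers d A" "EB \<in> hausdorff_covers d B"
      using E d unfolding hausdorff_covers_def EA_def EB_def
      by (auto simp: subset_eq) blast+
    then have "hausdorff_pre k d A + hausdorff_pre k d B
        \<le> (\<Sum>i. hausdorff_cost k (EA i)) + (\<Sum>i. hausdorff_cost k (EB i))"
      by (intro add_mono hausdorff_pre_le)
    also have "\<dots> = (\<Sum>i. hausdorff_cost k (EA i) + hausdorff_cost k (EB i))"
      by (intro suminf_add) auto
    also have "\<dots> \<le> (\<Sum>i. hausdorff_cost k (E i))"
      using disj by (intro suminf_le) (auto simp: EA_def EB_def hausdorff_cost_def)
    finally show "hausdorff_pre k d A + hausdorff_pre k d B \<le> (\<Sum>i. hausdorff_cost k (E i))" .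
  qed
  have "hausdorff_outer k A + hausdorff_outer k B
      = (SUP d\<in>{0<..}. hausdorff_pre k d A + hausdorff_pre k d B)"
    unfolding hausdorff_outer_def
  proof (rule SUP_add_directed_ennreal[symmetric])
    fix i j :: real assume "i \<in> {0<..}" "j \<in> {0<..}"
    then show "\<exists>l\<in>{0<..}. hausdorff_pre k i A + hausdorff_pre k j B
        \<le> hausdorff_pre k l A + hausdorff_pre k l B"
      by (intro bexI[of _ "min i j"] add_mono hausdorff_pre_antimono) auto
  qed
  also have "\<dots> \<le> hausdorff_outer k (A \<union> B)"
  proof (rule SUP_least)
    fix d :: real assume d: "d \<in> {0<..}"
    have "hausdorff_pre k d A + hausdorff_pre k d B
        \<le> hausdorff_pre k (min d (\<delta>/2)) A + hausdorff_pre k (min d (\<delta>/2)) B"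
      by (intro add_mono hausdorff_pre_antimono) auto
    also have "\<dots> \<le> hausdorff_pre k (min d (\<delta>/2)) (A \<union> B)"
      using d \<open>0 < \<delta>\<close> by (intro small) auto
    also have "\<dots> \<le> hausdorff_outer k (A \<union> B)"
      using d \<open>0 < \<delta>\<close> by (intro hausdorff_pre_le_outer) auto
    finally show "hausdorff_pre k d A + hausdorff_pre k d B \<le> hausdorff_outer k (A \<union> B)" .
  qed
  finally show ?thesis .
qed

text \<open>Caratheodory's criterion. The layers of \<open>A - F\<close> at distance about \<open>1/k\<close> from \<open>F\<close>
  are pairwise separated once every other layer is dropped, so their measures are summable.\<close>

lemma closed_in_lambda_system:
  fixes \<nu> :: "'a::metric_space set \<Rightarrow> ennreal"
  assumes om: "outer_measure_space (Pow UNIV) \<nu>"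
    and sep: "\<And>A B \<delta>. 0 < \<delta> \<Longrightarrow> (\<And>x y. x \<in> A \<Longrightarrow> y \<in> B \<Longrightarrow> \<delta> \<le> dist x y) \<Longrightarrow> \<nu> A + \<nu> B \<le> \<nu> (A \<union> B)"
    and F: "closed F"
  shows "F \<in> lambda_system UNIV (Pow UNIV) \<nu>"
proof (cases "F = {}")
  case True
  then show ?thesis using om by (auto simp: lambda_system_def outer_measure_space_def positive_def)
next
  case False
  have mono: "\<nu> A \<le> \<nu> B" if "A \<subseteq> B" for A B
    using om that by (auto simp: outer_measure_space_def increasing_def)
  have emp: "\<nu> {} = 0" using om by (auto simp: outer_measure_space_def positive_def)
  interpret sigma_algebra UNIV "Pow UNIV" by (rule sigma_algebra_Pow)
  have sub2: "\<nu> (A \<union> B) \<le> \<nu> A + \<nu> B" for A B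
  proof -
    have "subadditive (Pow UNIV) \<nu>"
      using om countably_subadditive_subadditive[of \<nu>] by (auto simp: outer_measure_space_def)
    from this[unfolded subadditive_def, rule_format, of A "B - A"]
    have "\<nu> (A \<union> (B - A)) \<le> \<nu> A + \<nu> (B - A)" by simp
    also have "\<dots> \<le> \<nu> A + \<nu> B" by (intro add_mono mono) auto
    finally show ?thesis by simp
  qed
  have "\<nu> (F \<inter> A) + \<nu> (A - F) \<le> \<nu> A" for A
  proof (cases "\<nu> A = top")
    case False
    define f where "f x = infdist x F" for x
    have flip: "f x \<le> dist x y + f y" for x y
      unfolding f_def using infdist_triangle[of x F y] by simp
    have fpos: "f x > 0" if "x \<notin> F" for x
      using that F \<open>F \<noteq> {}\<close> in_closed_iff_infdist_zero[of F x] infdist_nonneg[of x F]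
      by (auto simp: f_def less_le)
    define D where "D n = {x\<in>A. 1 / (real n + 1) \<le> f x}" for n
    define R where "R n = D (Suc n) - D n" for n
    have RD: "R n \<subseteq> A" "\<And>x. x \<in> R n \<Longrightarrow> 1 / (real n + 2) \<le> f x \<and> f x < 1 / (real n + 1)" for n
      by (auto simp: R_def D_def add.commute)
    have part: "(\<Sum>i<m. \<nu> (R (2 * i + p))) \<le> \<nu> (\<Union>i<m. R (2 * i + p))" for m p
    proof (induction m)
      case (Suc m)
      show ?case
      proof (cases "m = 0")
        case False
        \<comment> \<open>On layer \<open>2 * m + p\<close> the distance to \<open>F\<close> is
          below \<open>1 / (2 * m + p + 1)\<close>; on every earlier layer of the same parity it is
          at least \<open>1 / (2 * m + p)\<close>, because the layer in between is skipped. For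
          \<open>m = 0\<close> the first denominator could be zero, so that case is set
          aside.\<close>
        let ?\<delta> = "1 / (real (2 * m + p)) - 1 / (real (2 * m + p) + 1)"
        have "(\<Sum>i<Suc m. \<nu> (R (2 * i + p))) \<le> \<nu> (\<Union>i<m. R (2 * i + p)) + \<nu> (R (2 * m + p))"
          using Suc by (simp add: add_right_mono)
        also have "\<dots> \<le> \<nu> ((\<Union>i<m. R (2 * i + p)) \<union> R (2 * m + p))"
        proof (rule sep)
          show "0 < ?\<delta>" using False by (simp add: frac_less2)
          fix x y assume "x \<in> (\<Union>i<m. R (2 * i + p))" and y: "y \<in> R (2 * m + p)"
          then obtain i where i: "i < m" "x \<in> R (2 * i + p)" by auto
          have "1 / (real (2 * m + p)) \<le> 1 / (real (2 * i + p) + 2)"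
            using i by (intro divide_left_mono mult_pos_pos) auto
          also have "\<dots> \<le> f x" using RD(2)[OF i(2)] by simp
          finally show "?\<delta> \<le> dist x y" using RD(2)[OF y] flip[of x y] by linarith
        qed
        also have "\<dots> = \<nu> (\<Union>i<Suc m. R (2 * i + p))"
          by (simp add: lessThan_Suc Un_commute)
        finally show ?thesis .
      qed (simp add: lessThan_Suc)
    qed (simp add: emp)
    have part': "(\<Sum>i<m. \<nu> (R (2 * i + p))) \<le> \<nu> A" for m p
      by (rule order_trans[OF part]) (use RD in \<open>auto intro!: mono\<close>)
    have sum2: "(\<Sum>i<2 * m. \<nu> (R i)) = (\<Sum>i<m. \<nu> (R (2 * i + 0))) + (\<Sum>i<m. \<nu> (R (2 * i + 1)))" for m
      by (induction m) (auto simp: algebra_simps)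
    have partial: "(\<Sum>i<m. \<nu> (R i)) \<le> \<nu> A + \<nu> A" for m
    proof -
      have "(\<Sum>i<m. \<nu> (R i)) \<le> (\<Sum>i<2 * m. \<nu> (R i))" by (intro sum_mono2) auto
      also have "\<dots> \<le> \<nu> A + \<nu> A" unfolding sum2 by (intro add_mono part')
      finally show ?thesis .
    qed
    have Rfin: "\<nu> (R i) < top" for i
      using mono[OF RD(1)[of i]] False by (metis less_top order_le_less_trans)
    define r where "r i = enn2real (\<nu> (R i))" for i
    have r: "\<nu> (R i) = ennreal (r i)" "0 \<le> r i" for i
      using Rfin[of i] by (auto simp: r_def ennreal_enn2real)
    have "summable r"
    proof (rule summableI_nonneg_bounded)
      fix n
      have "ennreal (\<Sum>i<n. r i) \<le> \<nu> A + \<nu> A"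
        using partial[of n] unfolding r(1) by (subst (asm) sum_ennreal) (simp_all add: r(2))
      then show "(\<Sum>i<n. r i) \<le> enn2real (\<nu> A + \<nu> A)"
        using False by (metis enn2real_mono enn2real_ennreal ennreal_add_eq_top less_top r(2) sum_nonneg)
    qed (rule r)
    have tail: "(\<lambda>n. \<Sum>i. r (i + n)) \<longlonglongrightarrow> 0"
    proof -
      have "(\<lambda>n. suminf r - (\<Sum>i<n. r i)) \<longlonglongrightarrow> suminf r - suminf r"
        by (intro tendsto_diff tendsto_const summable_LIMSEQ \<open>summable r\<close>)
      then show ?thesis using suminf_minus_initial_segment[OF \<open>summable r\<close>] by simp
    qed
    show ?thesis
    proof (rule ennreal_le_epsilon)
      fix e :: real assume "0 < e"
      then obtain n where n: "(\<Sum>i. r (i + n)) < e"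
        using order_tendstoD(2)[OF tail, of e] by (auto simp: eventually_sequentially)
      \<comment> \<open>\<open>D n\<close> keeps the distance \<open>1 / (n + 1)\<close> from
        \<open>F\<close>, so additivity is available for it; the rest of \<open>A - F\<close> lies
        in the layers from \<open>n\<close> on, whose total measure is below
        \<open>e\<close>.\<close>
      have "A - F \<subseteq> D n \<union> (\<Union>i. R (i + n))"
      proof
        fix x assume x: "x \<in> A - F"
        then obtain m where m: "1 / (real m + 1) \<le> f x"
          using fpos[of x] reals_Archimedean[of "f x"] by (auto simp: inverse_eq_divide add.commute intro: less_imp_le)
        show "x \<in> D n \<union> (\<Union>i. R (i + n))"
        proof (cases "x \<in> D n")
          case False
          define j where "j = (LEAST m. x \<in> D m)"
          have "x \<in> D m" using m x by (simp add: D_def)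
          then have "x \<in> D j" unfolding j_def by (rule LeastI)
          have "n < j"
          proof (rule ccontr)
            assume "\<not> n < j"
            then have "1 / (real n + 1) \<le> 1 / (real j + 1)"
              by (intro divide_left_mono) auto
            with \<open>x \<in> D j\<close> False show False by (auto simp: D_def)
          qed
          then obtain i where i: "j = Suc (i + n)" by (metis add.commute less_imp_Suc_add)
          have "x \<notin> D (i + n)" using not_less_Least[of "i+n" "\<lambda>m. x \<in> D m"] i by (simp add: j_def)
          with \<open>x \<in> D j\<close> i show ?thesis by (auto simp: R_def)
        qed simp
      qed
      then have "\<nu> (A - F) \<le> \<nu> (D n) + \<nu> (\<Union>i. R (i + n))"
        using mono sub2 order_trans by blast
      also have "\<nu> (\<Union>i. R (i + n)) \<le> (\<Sum>i. \<nu> (R (i + n)))"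
      proof -
        have "D i \<subseteq> D j" if "i \<le> j" for i j
        proof -
          have "1 / (real j + 1) \<le> 1 / (real i + 1)" using that by (intro divide_left_mono) auto
          then show ?thesis by (auto simp: D_def)
        qed
        then have "R i \<subseteq> D j" if "i < j" for i j
          using that Suc_leI[of i j] unfolding R_def by blast
        then have "R i \<inter> R j = {}" if "i < j" for i j
          using that unfolding R_def[of j] by blast
        then have "disjoint_family (\<lambda>i. R (i + n))"
          unfolding disjoint_family_on_def by (metis Int_commute add_less_cancel_right nat_neq_iff)
        then show ?thesis using om
          unfolding outer_measure_space_def countably_subadditive_def by auto
      qed
      also have "(\<Sum>i. \<nu> (R (i + n))) = ennreal (\<Sum>i. r (i + n))"
        unfolding r using r(2) \<open>summable r\<close> by (intro suminf_ennreal2 summable_ignore_initial_segment) auto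
      also have "\<dots> \<le> ennreal e" using n by (intro ennreal_leI) simp
      finally have 1: "\<nu> (A - F) \<le> \<nu> (D n) + ennreal e" by (simp add: add_left_mono)
      have "\<nu> (F \<inter> A) + \<nu> (A - F) \<le> (\<nu> (F \<inter> A) + \<nu> (D n)) + ennreal e"
        using 1 by (simp add: add.assoc add_left_mono)
      also have "\<nu> (F \<inter> A) + \<nu> (D n) \<le> \<nu> (F \<inter> A \<union> D n)"
      proof (rule sep)
        show "0 < 1 / (real n + 1)" by simp
        fix x y assume "x \<in> F \<inter> A" "y \<in> D n"
        moreover from this have "f x = 0" by (simp add: f_def)
        ultimately show "1 / (real n + 1) \<le> dist x y"
          using flip[of y x] by (auto simp: D_def dist_commute)
      qed
      also have "\<dots> \<le> \<nu> A" by (intro mono) (auto simp: D_def)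
      finally show "\<nu> (F \<inter> A) + \<nu> (A - F) \<le> \<nu> A + ennreal e" by (simp add: add_right_mono)
    qed
  qed simp
  moreover have "\<nu> A \<le> \<nu> (F \<inter> A) + \<nu> (A - F)" for A
    using sub2[of "F \<inter> A" "A - F"] by (metis Int_Diff_Un Int_commute)
  ultimately show ?thesis
    by (auto simp: lambda_system_def Diff_eq Int_commute intro: antisym)
qed

text \<open>\<open>measure_of\<close> returns the zero measure when its argument is not countably
  additive, so this is what gives \<open>hausdorff_measure\<close> its intended values. The
  lambda-system is a sigma-algebra on which the outer measure is additive, and it contains the
  closed sets, which generate the Borel sets.\<close>

lemma measure_space_hausdorff:
  "measure_space UNIV (sets borel) (hausdorff_outer k :: 'a::metric_space set \<Rightarrow> ennreal)"
proof -
  interpret P: sigma_algebra UNIV "Pow UNIV :: 'a set set" by (rule sigma_algebra_Pow)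
  let ?L = "lambda_system UNIV (Pow UNIV) (hausdorff_outer k :: 'a set \<Rightarrow> ennreal)"
  have L: "measure_space UNIV ?L (hausdorff_outer k)"
    using P.caratheodory_lemma[OF outer_measure_space_hausdorff] .
  then interpret L: sigma_algebra UNIV ?L by (simp add: measure_space_def)
  have "sets borel \<subseteq> ?L"
    unfolding borel_eq_closed
    by (subst sets_measure_of, simp, intro L.sigma_sets_subset subsetI,
        rule closed_in_lambda_system[OF outer_measure_space_hausdorff hausdorff_outer_separated]) auto
  then show ?thesis
    using L measure_down[OF L] sets.sigma_algebra_axioms[of "borel :: 'a measure"] by simp
qed

lemma sets_hausdorff_measure [simp, measurable_cong]: "sets (hausdorff_measure k) = sets borel"
  and space_hausdorff_measure [simp]: "space (hausdorff_measure k) = UNIV"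
  unfolding hausdorff_measure_def
  using sets.sigma_sets_eq[of borel]
  by (simp_all add: sets_measure_of_conv space_measure_of_conv)

lemma emeasure_hausdorff_measure:
  "A \<in> sets borel \<Longrightarrow> emeasure (hausdorff_measure k) A = hausdorff_outer k A"
  using measure_space_hausdorff[of k] unfolding hausdorff_measure_def
  by (intro emeasure_measure_of_sigma) (auto simp: measure_space_def)

section \<open>Hausdorff measure on the boundary plane\<close>

lemma diameter_translation_le:
  fixes E :: "'a::real_normed_vector set"
  assumes "bounded E"
  shows "diameter ((+) v ` E) \<le> diameter E"
proof (cases "E = {}")
  case False
  then show ?thesis
    by (intro diameter_le) (auto simp: dist_norm[symmetric] diameter_bounded_bound[OF assms])
qed simp

lemma hausdorff_outer_translation_le:
  fixes A :: "'a::real_normed_vector set"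
  shows "hausdorff_outer k ((+) v ` A) \<le> hausdorff_outer k A"
  unfolding hausdorff_outer_def
proof (intro SUP_mono bexI)
  fix d :: real assume d: "d \<in> {0<..}"
  show "hausdorff_pre k d ((+) v ` A) \<le> hausdorff_pre k d A"
    unfolding hausdorff_pre_eq[of k d A]
  proof (rule INF_greatest)
    fix E assume E: "E \<in> hausdorff_covers d A"
    then have b: "bounded (E i)" "diameter (E i) \<le> d" for i
      by (auto simp: hausdorff_covers_def)
    have "(\<lambda>i. (+) v ` E i) \<in> hausdorff_covers d ((+) v ` A)"
      using E b diameter_translation_le[OF b(1), of v]
      by (fastforce simp: hausdorff_covers_def intro: bounded_translation order_trans)
    then have "hausdorff_pre k d ((+) v ` A) \<le> (\<Sum>i. hausdorff_cost k ((+) v ` E i))"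
      by (rule hausdorff_pre_le)
    also have "\<dots> \<le> (\<Sum>i. hausdorff_cost k (E i))"
    proof (intro suminf_le)
      fix i
      have "0 \<le> diameter ((+) v ` E i)"
        by (intro diameter_ge_0 bounded_translation b)
      then show "hausdorff_cost k ((+) v ` E i) \<le> hausdorff_cost k (E i)"
        unfolding hausdorff_cost_def
        by (auto intro!: ennreal_leI mult_left_mono power_mono divide_right_mono
            diameter_translation_le b)
    qed auto
    finally show "hausdorff_pre k d ((+) v ` A) \<le> (\<Sum>i. hausdorff_cost k (E i))" .
  qed
qed

lemma hausdorff_outer_translation:
  fixes A :: "'a::real_normed_vector set"
  shows "hausdorff_outer k ((+) v ` A) = hausdorff_outer k A"
proof (rule antisym)
  have "(+) (- v) ` (+) v ` A = A" by (auto simp: image_image)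
  then show "hausdorff_outer k A \<le> hausdorff_outer k ((+) v ` A)"
    using hausdorff_outer_translation_le[of k "- v" "(+) v ` A"] by simp
qed (rule hausdorff_outer_translation_le)

text \<open>Integrating \<open>1\<^sub>A(x) 1\<^sub>B(x + y)\<close> in both orders yields \<open>\<mu>(A) \<lambda>(B) = \<mu>(B) \<lambda>(A)\<close>.\<close>

lemma translation_invariant_measure_eq:
  fixes \<mu> :: "'a::euclidean_space measure"
  assumes sets[measurable_cong]: "sets \<mu> = sets borel" and "sigma_finite_measure \<mu>"
    and inv: "\<And>v. distr \<mu> borel ((+) v) = \<mu>"
    and A[measurable]: "A \<in> sets borel" and B[measurable]: "B \<in> sets borel"
  shows "emeasure \<mu> A * emeasure lborel B = emeasure \<mu> B * emeasure lborel A"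
proof -
  interpret M: sigma_finite_measure \<mu> by fact
  interpret pair_sigma_finite \<mu> "lborel :: 'a measure" ..
  have trl: "(\<integral>\<^sup>+y. f (x + y) \<partial>lborel) = (\<integral>\<^sup>+y. f y \<partial>lborel)"
    if [measurable]: "f \<in> borel_measurable borel" for f and x :: 'a
    by (subst (2) lborel_distr_plus[symmetric, of x]) (simp add: nn_integral_distr)
  have trm: "(\<integral>\<^sup>+y. f (x + y) \<partial>\<mu>) = (\<integral>\<^sup>+y. f y \<partial>\<mu>)"
    if [measurable]: "f \<in> borel_measurable borel" for f x
    by (subst (2) inv[symmetric, of x]) (simp add: nn_integral_distr)
  have refl: "(\<integral>\<^sup>+y. f (x - y) \<partial>lborel) = (\<integral>\<^sup>+y. f y \<partial>lborel)"
    if [measurable]: "f \<in> borel_measurable borel" for f and x :: 'a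
    by (subst (2) lborel_affine[of "-1" x]) (auto simp: nn_integral_distr nn_integral_density)
  have "emeasure \<mu> A * emeasure lborel B
      = (\<integral>\<^sup>+x. indicator A x * (\<integral>\<^sup>+y. indicator B y \<partial>lborel) \<partial>\<mu>)"
    by (simp add: nn_integral_multc)
  also have "\<dots> = (\<integral>\<^sup>+x. indicator A x * (\<integral>\<^sup>+y. indicator B (x + y) \<partial>lborel) \<partial>\<mu>)"
    by (subst trl) auto
  also have "\<dots> = (\<integral>\<^sup>+x. \<integral>\<^sup>+y. indicator A x * indicator B (x + y) \<partial>lborel \<partial>\<mu>)"
    by (subst nn_integral_cmult) auto
  also have "\<dots> = (\<integral>\<^sup>+y. \<integral>\<^sup>+x. indicator A x * indicator B (x + y) \<partial>\<mu> \<partial>lborel)"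
    by (rule Fubini'[symmetric]) measurable
  also have "\<dots> = (\<integral>\<^sup>+y. \<integral>\<^sup>+x. indicator A (x - y) * indicator B x \<partial>\<mu> \<partial>lborel)"
  proof (rule nn_integral_cong)
    fix y :: 'a
    show "(\<integral>\<^sup>+x. indicator A x * indicator B (x + y) \<partial>\<mu>)
        = (\<integral>\<^sup>+x. indicator A (x - y) * indicator B x \<partial>\<mu>)"
      using trm[of "\<lambda>x. indicator A (x - y) * indicator B x" y] by (simp add: add.commute)
  qed
  also have "\<dots> = (\<integral>\<^sup>+x. \<integral>\<^sup>+y. indicator A (x - y) * indicator B x \<partial>lborel \<partial>\<mu>)"
    by (rule Fubini') measurable
  also have "\<dots> = (\<integral>\<^sup>+x. (\<integral>\<^sup>+y. indicator A (x - y) \<partial>lborel) * indicator B x \<partial>\<mu>)"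
    by (subst nn_integral_multc) auto
  also have "\<dots> = emeasure \<mu> B * emeasure lborel A"
    by (subst refl) (auto simp: nn_integral_multc nn_integral_cmult_indicator mult.commute[of _ "emeasure lborel A"])
  finally show ?thesis .
qed

text \<open>Cutting the square into \<open>n * n\<close> squares of side \<open>h = L / n\<close>
  and bounding each diameter by \<open>2 * h\<close> costs \<open>pi * h\<^sup>2\<close> per piece.
  The constant is crude; the bound serves to show that squares have finite measure.\<close>

lemma hausdorff_outer_square_le:
  assumes L: "0 < L"
  shows "hausdorff_outer 2 (vec3 0 ` ({a..<a+L} \<times> {a..<a+L})) \<le> ennreal (pi * L\<^sup>2)"
  unfolding hausdorff_outer_def
proof (rule SUP_least)
  fix d :: real assume "d \<in> {0<..}"
  then have d: "d > 0" by simp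
  obtain n :: nat where n: "2 * L / d < real n" using reals_Archimedean2 by blast
  with L d have n0: "n > 0" by (auto intro!: gr0I simp: divide_less_0_iff)
  define h where "h = L / n"
  have h: "h > 0" "2 * h \<le> d" using n L d n0 by (auto simp: h_def field_simps)
  define I where "I k = {a + h * real k ..< a + h * real k + h}" for k :: nat
  \<comment> \<open>The grid cells are enumerated by the two digits of \<open>i\<close> in base
    \<open>n\<close>; all further members of the sequence are empty and cost nothing.\<close>
  define E where "E i = (if i < n * n then vec3 0 ` (I (i div n) \<times> I (i mod n)) else {})" for i
  have diam: "bounded (E i) \<and> diameter (E i) \<le> 2 * h" for i
  proof (cases "i < n * n")
    case True
    have le: "norm (x - y) \<le> 2 * h" if xy: "x \<in> E i" "y \<in> E i" for x y
    proof -
      obtain p q p' q' where *: "p \<in> I (i div n)" "p' \<in> I (i div n)" "q \<in> I (i mod n)" "q' \<in> I (i mod n)"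
        "x = vec3 0 (p, q)" "y = vec3 0 (p', q')" using xy True by (auto simp: E_def)
      then have "\<bar>p - p'\<bar> \<le> h" "\<bar>q - q'\<bar> \<le> h" by (auto simp: I_def)
      then show ?thesis using norm_vec3_diff_le[of 0 "(p,q)" "(p',q')"] * by simp
    qed
    then have "bounded (E i)" unfolding bounded_two_points by (auto simp: dist_norm)
    with le h show ?thesis by (auto intro!: diameter_le)
  qed (use h in \<open>auto simp: E_def\<close>)
  have "E \<in> hausdorff_covers d (vec3 0 ` ({a..<a+L} \<times> {a..<a+L}))"
    unfolding hausdorff_covers_def
  proof (intro CollectI conjI allI)
    have ind: "\<exists>k<n. p \<in> I k" if "a \<le> p" "p < a + L" for p
    proof (intro exI conjI)
      let ?k = "nat \<lfloor>(p - a) / h\<rfloor>"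
      have nn: "0 \<le> (p - a) / h" using that h by simp
      then have k: "real ?k \<le> (p - a) / h" "(p - a) / h < real ?k + 1" by linarith+
      have "(p - a) * real n < L * real n" using that n0 by (intro mult_strict_right_mono) auto
      then have "(p - a) / h < real n" using L n0 by (simp add: h_def field_simps)
      with k show "?k < n" by simp
      show "p \<in> I ?k" using k h unfolding I_def by (auto simp: field_simps)
    qed
    show "vec3 0 ` ({a..<a+L} \<times> {a..<a+L}) \<subseteq> (\<Union>i. E i)"
    proof clarsimp
      fix p q assume "a \<le> p" "p < a + L" "a \<le> q" "q < a + L"
      with ind obtain k l where kl: "k < n" "p \<in> I k" "l < n" "q \<in> I l" by metis
      have "k * n + l < n * n"
      proof -
        have "k * n + l < Suc k * n" using kl by simp
        also have "\<dots> \<le> n * n" using kl by (intro mult_right_mono) auto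
        finally show ?thesis .
      qed
      moreover have "(k * n + l) div n = k" "(k * n + l) mod n = l" using kl by auto
      ultimately have "vec3 0 (p, q) \<in> E (k * n + l)" using kl by (auto simp: E_def)
      then show "\<exists>i. vec3 0 (p, q) \<in> E i" ..
    qed
  qed (use diam h in \<open>auto intro: order_trans\<close>)
  then have "hausdorff_pre 2 d (vec3 0 ` ({a..<a+L} \<times> {a..<a+L})) \<le> (\<Sum>i. hausdorff_cost 2 (E i))"
    by (rule hausdorff_pre_le)
  also have "\<dots> = (\<Sum>i<n * n. hausdorff_cost 2 (E i))"
    by (rule suminf_finite) (auto simp: E_def hausdorff_cost_def)
  also have "\<dots> \<le> (\<Sum>i<n * n. ennreal (pi * h\<^sup>2))"
  proof (rule sum_mono)
    fix i
    have "diameter (E i) / 2 \<le> h" "0 \<le> diameter (E i)" using diam[of i] by (auto intro: diameter_ge_0)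
    then have "(diameter (E i) / 2)\<^sup>2 \<le> h\<^sup>2" by (intro power_mono) auto
    then show "hausdorff_cost 2 (E i) \<le> ennreal (pi * h\<^sup>2)"
      by (auto simp: hausdorff_cost_def unit_ball_vol_numeral intro!: ennreal_leI)
  qed
  also have "\<dots> = ennreal (real (n * n) * (pi * h\<^sup>2))"
    by (simp add: ennreal_mult ennreal_of_nat_eq_real_of_nat)
  also have "real (n * n) * (pi * h\<^sup>2) = pi * L\<^sup>2"
    using n0 by (simp add: h_def field_simps power2_eq_square)
  finally show "hausdorff_pre 2 d (vec3 0 ` ({a..<a+L} \<times> {a..<a+L})) \<le> ennreal (pi * L\<^sup>2)" .
qed

lemma emeasure_unit_square: "emeasure lborel ({0..<1} \<times> {0..<1} :: (real \<times> real) set) = 1"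
  unfolding lborel_prod[symmetric] by (subst lborel.emeasure_pair_measure_Times) auto

text \<open>A set of diameter \<open>D\<close> projects into the square of side \<open>2 * D\<close>
  centred at the projection of one of its points. That square has area \<open>4 * D\<^sup>2\<close>,
  while the cost is \<open>pi * D\<^sup>2 / 4\<close>; the ratio is \<open>pi / 16\<close>.
  Countable subadditivity of Lebesgue measure then bounds the cost of every cover from
  below.\<close>

lemma hausdorff_outer_square_ge:
  "ennreal (pi / 16) \<le> hausdorff_outer 2 (vec3 0 ` ({0..<1} \<times> {0..<1}))"
proof -
  let ?S = "{0..<1} \<times> {0..<1} :: (real \<times> real) set"
  have "ennreal (pi / 16) \<le> hausdorff_pre 2 1 (vec3 0 ` ?S)"
    unfolding hausdorff_pre_eq
  proof (rule INF_greatest)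
    fix E assume E: "E \<in> hausdorff_covers 1 (vec3 0 ` ?S)"
    define c where "c i = (let x = (SOME x. x \<in> E i) in (x $ 2, x $ 3))" for i
    define D where "D i = diameter (E i)" for i
    have bE: "bounded (E i)" for i using E by (auto simp: hausdorff_covers_def)
    have D: "0 \<le> D i" for i by (simp add: D_def diameter_ge_0 bE)
    define Q where "Q i = (if E i = {} then {} else cbox (c i - (D i, D i)) (c i + (D i, D i)))" for i
    have "?S \<subseteq> (\<Union>i. Q i)"
    proof
      fix y assume "y \<in> ?S"
      then obtain i where i: "vec3 0 y \<in> E i" using E by (auto simp: hausdorff_covers_def)
      define x where "x = (SOME x. x \<in> E i)"
      have "x \<in> E i" unfolding x_def using i by (rule someI)
      then have "norm (vec3 0 y - x) \<le> D i"
        using diameter_bounded_bound[OF bE i] by (simp add: D_def dist_norm)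
      then have "\<bar>fst y - x $ 2\<bar> \<le> D i" "\<bar>snd y - x $ 3\<bar> \<le> D i"
        using component_le_norm_cart[of "vec3 0 y - x" 2] component_le_norm_cart[of "vec3 0 y - x" 3]
        by auto
      then have "y \<in> Q i"
        using i by (cases y) (auto simp: Q_def c_def x_def[symmetric] cbox_Pair_eq)
      then show "y \<in> (\<Union>i. Q i)" by blast
    qed
    then have "emeasure lborel ?S \<le> emeasure lborel (\<Union>i. Q i)"
      by (intro emeasure_mono) (auto simp: Q_def)
    also have "\<dots> \<le> (\<Sum>i. emeasure lborel (Q i))"
      by (intro emeasure_subadditive_countably) (auto simp: Q_def)
    finally have "1 \<le> (\<Sum>i. emeasure lborel (Q i))" unfolding emeasure_unit_square .
    then have "ennreal (pi / 16) * 1 \<le> ennreal (pi / 16) * (\<Sum>i. emeasure lborel (Q i))"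
      by (intro mult_left_mono) auto
    also have "\<dots> = (\<Sum>i. ennreal (pi / 16) * emeasure lborel (Q i))"
      by (rule ennreal_suminf_cmult[symmetric])
    also have "\<dots> = (\<Sum>i. hausdorff_cost 2 (E i))"
    proof (rule suminf_cong)
      fix i
      show "ennreal (pi / 16) * emeasure lborel (Q i) = hausdorff_cost 2 (E i)"
      proof (cases "E i = {}")
        case False
        have "emeasure lborel (Q i) = ennreal ((2 * D i) * (2 * D i))"
          using D[of i] False unfolding Q_def
          by (cases "c i") (simp add: emeasure_lborel_cbox_eq Basis_prod_def)
        then show ?thesis using False D[of i]
          by (simp add: hausdorff_cost_def D_def unit_ball_vol_numeral ennreal_mult[symmetric] power2_eq_square)
      qed (simp add: Q_def hausdorff_cost_def)
    qed
    finally show "ennreal (pi / 16) \<le> (\<Sum>i. hausdorff_cost 2 (E i))" by simp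
  qed
  also have "\<dots> \<le> hausdorff_outer 2 (vec3 0 ` ?S)" by (rule hausdorff_pre_le_outer) simp
  finally show ?thesis .
qed

lemma frontier_half_space: "frontier half_space = {x. x $ 1 = 0}"
proof -
  have eq: "half_space = {x. axis 1 1 \<bullet> x > 0}"
    by (simp add: half_space_def inner_axis')
  have "(axis 1 1 :: r3) \<noteq> 0" by (simp add: axis_eq_0_iff)
  then show ?thesis unfolding eq by (subst frontier_halfspace_gt) (auto simp: inner_axis')
qed

text \<open>Writing the restriction as the image of a density under a measurable retraction
  \<open>p\<close> onto \<open>S\<close> makes the library rules for products of images and of
  densities applicable to the lateral measure.\<close>

lemma restrict_lborel_eq_distr:
  fixes S :: "'a::euclidean_space set"
  assumes S[measurable]: "S \<in> sets borel" and p: "p \<in> borel \<rightarrow>\<^sub>M restrict_space borel S"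
    and id: "\<And>x. x \<in> S \<Longrightarrow> p x = x"
  shows "restrict_space lborel S = distr (density lborel (indicator S)) (restrict_space lborel S) p"
proof (rule measure_eqI)
  fix A assume A: "A \<in> sets (restrict_space lborel S)"
  then have A': "A \<in> sets borel" "A \<subseteq> S" by (auto simp: sets_restrict_space)
  have "sets (restrict_space lborel S) = sets (restrict_space borel S)"
    by (rule sets_restrict_space_cong) simp
  then have p': "p \<in> density lborel (indicator S) \<rightarrow>\<^sub>M restrict_space lborel S"
    using p by (simp cong: measurable_cong_sets)
  have pA: "p -` A \<in> sets borel" using measurable_sets[OF p' A] by simp
  have "emeasure (distr (density lborel (indicator S)) (restrict_space lborel S) p) A
      = emeasure (density lborel (indicator S)) (p -` A)"
    using p' A by (subst emeasure_distr) auto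
  also have "\<dots> = (\<integral>\<^sup>+x. indicator S x * indicator (p -` A) x \<partial>lborel)"
    using pA by (intro emeasure_density) auto
  also have "\<dots> = (\<integral>\<^sup>+x. indicator A x \<partial>lborel)"
    using A' id by (intro nn_integral_cong) (auto split: split_indicator)
  also have "\<dots> = emeasure (restrict_space lborel S) A"
    using A' by (subst emeasure_restrict_space) auto
  finally show "emeasure (restrict_space lborel S) A
      = emeasure (distr (density lborel (indicator S)) (restrict_space lborel S) p) A" ..
qed simp

text \<open>The tangential projection carries the restricted measure to a translation invariant
  measure on the plane, which is compared with Lebesgue measure through the unit square. The image
  form and the sigma-finiteness are what the product with the time interval asks for.\<close>

lemma plane_hausdorff_measure:
  obtains c :: real where "0 < c"
    "restrict_space (hausdorff_measure 2) (frontier half_space)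
      = distr (density lborel (\<lambda>_. ennreal c)) (restrict_space borel (frontier half_space)) (vec3 0)"
    "sigma_finite_measure (restrict_space (hausdorff_measure 2) (frontier half_space))"
proof -
  let ?F = "frontier half_space" and ?\<nu> = "hausdorff_outer 2 :: r3 set \<Rightarrow> ennreal"
  define N where "N = restrict_space (hausdorff_measure 2 :: r3 measure) ?F"
  define P where "P x = (x $ 2, x $ 3)" for x :: r3
  define \<mu> where "\<mu> = distr N borel P"
  have F[measurable]: "?F \<in> sets borel" by (simp add: frontier_closed)
  have [measurable]: "P \<in> borel \<rightarrow>\<^sub>M borel"
    unfolding P_def by (intro borel_measurable_continuous_onI continuous_intros)
  have setsN: "sets N = sets (restrict_space borel ?F)"
    unfolding N_def by (intro sets_restrict_space_cong) simp
  have spN: "space N = ?F" by (simp add: N_def space_restrict_space)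
  have PN[measurable]: "P \<in> N \<rightarrow>\<^sub>M borel"
    by (subst measurable_cong_sets[OF setsN refl]) (intro measurable_restrict_space1, measurable)
  have vP: "vec3 0 (P x) = x" if "x \<in> ?F" for x
    using that vec3_eta[of x] by (simp add: frontier_half_space P_def)
  have Pv: "P (vec3 s y) = y" for s y by (simp add: P_def)
  have vF: "vec3 0 y \<in> ?F" for y by (simp add: frontier_half_space)
  have img: "vec3 0 ` A = P -` A \<inter> ?F" for A
    using vP Pv vF by (force simp: image_iff)
  have emN: "emeasure N B = ?\<nu> B" if "B \<in> sets borel" "B \<subseteq> ?F" for B
    using that F unfolding N_def by (subst emeasure_restrict_space) (auto simp: emeasure_hausdorff_measure)
  have Pm: "P -` A \<inter> ?F \<in> sets borel" if [measurable]: "A \<in> sets borel" for A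
  proof -
    have "P -` A \<inter> space borel \<in> sets borel" by measurable
    then show ?thesis using F by (simp add: sets.Int)
  qed
  have em: "emeasure \<mu> A = ?\<nu> (vec3 0 ` A)" if [measurable]: "A \<in> sets borel" for A
    unfolding \<mu>_def img using emN[OF Pm[OF that]] by (subst emeasure_distr) (auto simp: spN)
  have sm: "sets \<mu> = sets borel" by (simp add: \<mu>_def)
  have inv: "distr \<mu> borel ((+) v) = \<mu>" for v
  proof (rule measure_eqI)
    fix A assume "A \<in> sets (distr \<mu> borel ((+) v))"
    then have A[measurable]: "A \<in> sets borel" by simp
    have m: "(+) v -` A \<in> sets borel"
    proof -
      have "(+) v -` A \<inter> space borel \<in> sets borel" by (rule measurable_sets[OF _ A]) measurable
      then show ?thesis by simp
    qed
    have "emeasure (distr \<mu> borel ((+) v)) A = emeasure \<mu> ((+) v -` A)"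
      by (subst emeasure_distr) (auto simp: sm measurable_cong_sets[OF sm refl] space_borel sets_eq_imp_space_eq[OF sm])
    also have "\<dots> = ?\<nu> (vec3 0 ` ((+) v -` A))" by (rule em[OF m])
    also have "\<dots> = ?\<nu> ((+) (vec3 0 v) ` vec3 0 ` ((+) v -` A))"
      by (rule hausdorff_outer_translation[symmetric])
    also have "(+) (vec3 0 v) ` vec3 0 ` ((+) v -` A) = vec3 0 ` A"
    proof -
      have "y \<in> (\<lambda>x. v + x) ` ((+) v -` A)" if "y \<in> A" for y
        using that by (intro image_eqI[of _ _ "y - v"]) auto
      then have "(\<lambda>x. v + x) ` ((+) v -` A) = A" by auto
      moreover have "(+) (vec3 0 v) ` vec3 0 ` X = vec3 0 ` ((+) v ` X)" for X
        by (simp add: image_image vec3_add)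
      ultimately show ?thesis by simp
    qed
    also have "?\<nu> (vec3 0 ` A) = emeasure \<mu> A" by (rule em[symmetric, OF A])
    finally show "emeasure (distr \<mu> borel ((+) v)) A = emeasure \<mu> A" .
  qed (simp add: sm)
  have sf: "sigma_finite_measure \<mu>"
  proof
    \<comment> \<open>These are the squares from \<open>- n - 1\<close> to \<open>n + 1\<close>,
      written as \<open>a ..< a + L\<close> to match \<open>hausdorff_outer_square_le\<close>; they
      exhaust the plane.\<close>
    let ?Q = "\<lambda>n::nat. {- real n - 1..< - real n - 1 + 2 * (real n + 1)} \<times> {- real n - 1..< - real n - 1 + 2 * (real n + 1)}"
    have Qm: "?Q n \<in> sets borel" for n by (intro borel_Times) auto
    show "\<exists>A. countable A \<and> A \<subseteq> sets \<mu> \<and> \<Union> A = space \<mu> \<and> (\<forall>a\<in>A. emeasure \<mu> a \<noteq> \<infinity>)"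
    proof (intro exI[of _ "range ?Q"] conjI ballI)
      show "\<Union> (range ?Q) = space \<mu>"
      proof -
        have "\<exists>n. (p, q) \<in> ?Q n" for p q
        proof -
          obtain n where "max \<bar>p\<bar> \<bar>q\<bar> < real n" using reals_Archimedean2 by blast
          then show ?thesis by (intro exI[of _ n]) auto
        qed
        then show ?thesis using sets_eq_imp_space_eq[OF sm] by auto
      qed
      fix a assume "a \<in> range ?Q"
      then obtain n where a: "a = ?Q n" by auto
      show "emeasure \<mu> a \<noteq> \<infinity>"
        unfolding a em[OF Qm]
        using hausdorff_outer_square_le[of "2 * (real n + 1)" "- real n - 1"]
        by (auto simp: top_unique)
    qed (use Qm sm in auto)
  qed
  let ?S = "{0..<1} \<times> {0..<1} :: (real \<times> real) set"
  have S: "?S \<in> sets borel" by (intro borel_Times) auto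
  \<comment> \<open>The unit square has Lebesgue measure 1, so its measure under
    \<open>\<mu>\<close> is the proportionality factor. The upper bound makes it finite, the lower
    bound positive.\<close>
  define c where "c = enn2real (emeasure \<mu> ?S)"
  have up: "emeasure \<mu> ?S \<le> ennreal (pi * 1\<^sup>2)" unfolding em[OF S]
    using hausdorff_outer_square_le[of 1 0] by simp
  have lo: "ennreal (pi / 16) \<le> emeasure \<mu> ?S" unfolding em[OF S]
    by (rule hausdorff_outer_square_ge)
  have c: "emeasure \<mu> ?S = ennreal c"
    unfolding c_def using up by (intro ennreal_enn2real[symmetric]) (auto simp: less_top[symmetric] top_unique)
  have "0 < c"
  proof -
    have "pi / 16 \<le> c" using lo unfolding c by (subst (asm) ennreal_le_iff) (auto simp: c_def)
    then show ?thesis using pi_gt_zero by linarith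
  qed
  have mu: "emeasure \<mu> A = ennreal c * emeasure lborel A" if "A \<in> sets borel" for A
    using translation_invariant_measure_eq[OF sm sf inv that S] by (simp add: emeasure_unit_square c)
  have vm: "vec3 0 \<in> lborel \<rightarrow>\<^sub>M restrict_space borel ?F"
    using vF by (intro measurable_restrict_space2) auto
  have "N = distr (density lborel (\<lambda>_. ennreal c)) (restrict_space borel ?F) (vec3 0)"
  proof (rule measure_eqI)
    fix B assume "B \<in> sets N"
    then have B: "B \<in> sets borel" "B \<subseteq> ?F" "B \<in> sets (restrict_space borel ?F)"
      using F by (auto simp: setsN sets_restrict_space)
    define A where "A = vec3 0 -` B"
    have A: "A \<in> sets borel" using measurable_sets[OF vm B(3)] by (simp add: A_def)
    have "B \<subseteq> vec3 0 ` A"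
    proof
      fix x assume x: "x \<in> B"
      then have "vec3 0 (P x) = x" using vP B by blast
      then show "x \<in> vec3 0 ` A" using x by (intro image_eqI[of _ _ "P x"]) (auto simp: A_def)
    qed
    then have "vec3 0 ` A = B" by (auto simp: A_def)
    then have "emeasure N B = emeasure \<mu> A" using emN B em[OF A] by simp
    also have "\<dots> = emeasure (density lborel (\<lambda>_. ennreal c)) A"
      using A by (simp add: mu emeasure_density_const)
    also have "\<dots> = emeasure (distr (density lborel (\<lambda>_. ennreal c)) (restrict_space borel ?F) (vec3 0)) B"
      using vm B by (subst emeasure_distr) (auto simp: A_def)
    finally show "emeasure N B = emeasure (distr (density lborel (\<lambda>_. ennreal c)) (restrict_space borel ?F) (vec3 0)) B" .
  qed (simp add: setsN)
  moreover have "sigma_finite_measure N"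
    using sf PN unfolding \<mu>_def by (rule sigma_finite_measure_distr)
  ultimately show ?thesis using \<open>0 < c\<close> unfolding N_def by (intro that)
qed

text \<open>All later lateral integrals of nonzero functions are evaluated through this formula, so
  \<open>c\<close> is the only trace that Hausdorff measure leaves in the computations.\<close>

lemma lateral_integral:
  obtains c :: real where "0 < c"
    "\<And>f :: real \<times> r3 \<Rightarrow> real. f \<in> borel_measurable borel \<Longrightarrow>
      (LINT z | lateral_measure half_space. f z)
        = c * (LINT z | lborel. indicator {0<..<1} (fst z) * f (fst z, vec3 0 (snd z)))"
proof -
  let ?F = "frontier half_space" and ?I = "{0<..<1} :: real set"
  obtain c :: real where c: "0 < c"
    and N: "restrict_space (hausdorff_measure 2) ?F
      = distr (density lborel (\<lambda>_. ennreal c)) (restrict_space borel ?F) (vec3 0)"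
    and sf: "sigma_finite_measure (restrict_space (hausdorff_measure 2) ?F)"
    by (rule plane_hausdorff_measure)
  have vm: "vec3 0 \<in> lborel \<rightarrow>\<^sub>M restrict_space borel ?F"
    by (intro measurable_restrict_space2) (auto simp: frontier_half_space)
  \<comment> \<open>The value \<open>1 / 2\<close> is just a point of the interval: the density
    vanishes wherever this default is taken.\<close>
  define p where "p t = (if t \<in> ?I then t else 1 / 2)" for t :: real
  have p: "p \<in> borel \<rightarrow>\<^sub>M restrict_space borel ?I"
    unfolding p_def by (intro measurable_restrict_space2) auto
  have pR: "p \<in> density lborel (indicator ?I) \<rightarrow>\<^sub>M restrict_space lborel ?I"
    using p sets_restrict_space_cong[of lborel borel ?I] by (simp cong: measurable_cong_sets)
  have R: "restrict_space lborel ?I = distr (density lborel (indicator ?I)) (restrict_space lborel ?I) p"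
    by (rule restrict_lborel_eq_distr[OF _ p]) (auto simp: p_def)
  let ?D = "density (lborel :: (real \<times> real) measure) (\<lambda>_. ennreal c)"
  have D: "sigma_finite_measure ?D"
    by (subst sigma_finite_measure.sigma_finite_iff_density_finite[OF lborel.sigma_finite_measure_axioms]) auto
  have vD: "vec3 0 \<in> ?D \<rightarrow>\<^sub>M restrict_space borel ?F" using vm by simp
  let ?M = "restrict_space lborel ?I \<Otimes>\<^sub>M restrict_space borel ?F"
  define Q where "Q = (\<lambda>(t, y). (p t, vec3 0 y))"
  have "lateral_measure half_space = distr (density lborel (indicator ?I) \<Otimes>\<^sub>M ?D) ?M Q"
    unfolding lateral_measure_def N Q_def
    by (subst R) (intro pair_measure_distr pR vD sf[unfolded N])
  also have "density lborel (indicator ?I) \<Otimes>\<^sub>M ?D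
      = density (lborel \<Otimes>\<^sub>M lborel) (\<lambda>(t, y). indicator ?I t * ennreal c)"
    by (intro pair_measure_density lborel.sigma_finite_measure_axioms D) auto
  also have "\<dots> = density lborel (\<lambda>z. ennreal (indicator ?I (fst z) * c))"
    using c by (simp add: lborel_prod split_beta' ennreal_mult ennreal_indicator)
  finally have lat: "lateral_measure half_space
      = distr (density lborel (\<lambda>z. ennreal (indicator ?I (fst z) * c))) ?M Q" .
  have Qm: "Q \<in> lborel \<rightarrow>\<^sub>M ?M"
  proof -
    have "Q \<in> lborel \<Otimes>\<^sub>M lborel \<rightarrow>\<^sub>M ?M"
      unfolding Q_def split_beta' using pR
      by (intro measurable_Pair measurable_compose[OF measurable_fst]
          measurable_compose[OF measurable_snd vm]) simp
    then show ?thesis by (simp add: lborel_prod)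
  qed
  show ?thesis
  proof (rule that[OF c(1)])
    fix f :: "real \<times> r3 \<Rightarrow> real" assume f[measurable]: "f \<in> borel_measurable borel"
    have fM: "f \<in> borel_measurable ?M"
    proof -
      have a: "(\<lambda>t. t) \<in> restrict_space lborel ?I \<rightarrow>\<^sub>M borel"
        and b: "(\<lambda>x. x) \<in> restrict_space borel ?F \<rightarrow>\<^sub>M borel"
        by (auto intro!: measurable_restrict_space1)
      have "(\<lambda>z. z) \<in> ?M \<rightarrow>\<^sub>M borel \<Otimes>\<^sub>M borel"
        using measurable_compose[OF measurable_fst a, of "restrict_space borel ?F"]
          measurable_compose[OF measurable_snd b, of "restrict_space lborel ?I"]
        by (intro measurable_pair) (simp_all add: comp_def)
      then have "(\<lambda>z. z) \<in> ?M \<rightarrow>\<^sub>M borel" by (simp add: borel_prod)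
      then show ?thesis using f by (rule measurable_compose)
    qed
    have "(LINT z | lateral_measure half_space. f z)
        = (LINT z | density lborel (\<lambda>z. ennreal (indicator ?I (fst z) * c)). f (Q z))"
      unfolding lat using Qm fM by (intro integral_distr) auto
    also have "\<dots> = (LINT z | lborel. (indicator ?I (fst z) * c) *\<^sub>R f (Q z))"
      using c measurable_compose[OF Qm fM] by (intro integral_density) auto
    also have "\<dots> = (LINT z | lborel. c * (indicator ?I (fst z) * f (fst z, vec3 0 (snd z))))"
      by (intro Bochner_Integration.integral_cong) (auto simp: Q_def p_def split: split_indicator)
    also have "\<dots> = c * (LINT z | lborel. indicator ?I (fst z) * f (fst z, vec3 0 (snd z)))"
      by simp
    finally show "(LINT z | lateral_measure half_space. f z)
        = c * (LINT z | lborel. indicator ?I (fst z) * f (fst z, vec3 0 (snd z)))" .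
  qed
qed

section \<open>Compactly supported test functions of class \<open>C\<^sup>1\<close>\<close>

text \<open>The smooth test functions, their compositions with injective linear maps, and the
  entries of the matrix fields in the total variation all belong to this class, so one calculus
  serves them all. Continuity of the derivative is asked direction by direction, as in
  \<open>Ck 1\<close>.\<close>

definition C1c :: "('a::euclidean_space \<Rightarrow> real) \<Rightarrow> bool" where
  "C1c f \<longleftrightarrow> (\<forall>x. f differentiable (at x))
     \<and> (\<forall>v. continuous_on UNIV (\<lambda>x. frechet_derivative f (at x) v))
     \<and> (\<exists>r. \<forall>x. r < norm x \<longrightarrow> f x = 0)"

lemma C1c_has_derivative: "C1c f \<Longrightarrow> (f has_derivative frechet_derivative f (at x)) (at x)"
  unfolding C1c_def by (simp add: frechet_derivative_works)

lemma C1c_linear: "C1c f \<Longrightarrow> linear (frechet_derivative f (at x))"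
  unfolding C1c_def by (simp add: linear_frechet_derivative)

lemma C1c_continuous: "C1c f \<Longrightarrow> continuous_on UNIV f"
  by (meson C1c_has_derivative continuous_at_imp_continuous_on has_derivative_continuous)

lemma C1c_continuous_deriv: "C1c f \<Longrightarrow> continuous_on UNIV (\<lambda>x. frechet_derivative f (at x) v)"
  unfolding C1c_def by simp

lemma C1c_deriv_eq_0:
  assumes f: "C1c f" and S: "closed S" "\<And>x. x \<notin> S \<Longrightarrow> f x = 0" and x: "x \<notin> S"
  shows "frechet_derivative f (at x) v = 0"
proof -
  have "(f has_derivative (\<lambda>_. 0)) (at x)"
    by (rule has_derivative_transform_within_open[of "\<lambda>_. 0" _ _ _ "- S"])
       (use S x in \<open>auto intro: derivative_eq_intros\<close>)
  then show ?thesis by (metis frechet_derivative_at)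
qed

lemma C1c_deriv_expand:
  assumes "C1c f"
  shows "frechet_derivative f (at x) v = (\<Sum>b\<in>Basis. (v \<bullet> b) * frechet_derivative f (at x) b)"
proof -
  have "frechet_derivative f (at x) v = frechet_derivative f (at x) (\<Sum>b\<in>Basis. (v \<bullet> b) *\<^sub>R b)"
    by (simp add: euclidean_representation)
  also have "\<dots> = (\<Sum>b\<in>Basis. (v \<bullet> b) *\<^sub>R frechet_derivative f (at x) b)"
    using C1c_linear[OF assms] by (simp add: linear_sum linear_scale)
  finally show ?thesis by simp
qed

lemma C1c_support:
  assumes "C1c f"
  obtains r where "0 < r" "\<And>x. x \<notin> cball 0 r \<Longrightarrow> f x = 0"
    "\<And>x v. x \<notin> cball 0 r \<Longrightarrow> frechet_derivative f (at x) v = 0"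
proof -
  obtain r where r: "\<And>x. r < norm x \<Longrightarrow> f x = 0" using assms by (auto simp: C1c_def)
  have "f x = 0" if "x \<notin> cball 0 (max r 1)" for x using r[of x] that by auto
  from this C1c_deriv_eq_0[OF assms closed_cball this] show ?thesis
    by (intro that[of "max r 1"]) (simp, blast+)
qed

lemma continuous_bounded_of_support:
  fixes f :: "'a::euclidean_space \<Rightarrow> real"
  assumes "continuous_on UNIV f" "\<And>x. x \<notin> cball 0 r \<Longrightarrow> f x = 0"
  obtains B where "0 < B" "\<And>x. \<bar>f x\<bar> \<le> B"
proof -
  have "compact (f ` cball 0 r)"
    by (intro compact_continuous_image continuous_on_subset[OF assms(1)]) auto
  then obtain B where "0 < B" "\<And>x. x \<in> cball 0 r \<Longrightarrow> norm (f x) \<le> B"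
    using bounded_pos compact_imp_bounded by (metis imageI)
  then show ?thesis using assms(2) by (intro that[of B]) (force simp: abs_of_nonneg)+
qed

lemma C1c_bounded:
  assumes "C1c f" obtains B where "0 < B" "\<And>x. \<bar>f x\<bar> \<le> B"
  using C1c_support[OF assms] continuous_bounded_of_support[OF C1c_continuous[OF assms]] by metis

lemma C1c_deriv_bounded:
  assumes f: "C1c f"
  obtains L where "0 < L" "\<And>x v. \<bar>frechet_derivative f (at x) v\<bar> \<le> L * norm v"
proof -
  obtain r where r: "\<And>x v. x \<notin> cball 0 r \<Longrightarrow> frechet_derivative f (at x) v = 0"
    using C1c_support[OF f] by metis
  have "\<exists>B>0. \<forall>x. \<bar>frechet_derivative f (at x) b\<bar> \<le> B" for b
    using continuous_bounded_of_support[OF C1c_continuous_deriv[OF f, of b] r] by metis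
  then obtain B where B: "\<And>b. B b > 0" "\<And>b x. \<bar>frechet_derivative f (at x) b\<bar> \<le> B b" by metis
  show ?thesis
  proof (rule that[of "\<Sum>b\<in>Basis. B b"])
    show "0 < (\<Sum>b\<in>Basis. B b)" by (intro sum_pos B) auto
    fix x v
    have "\<bar>frechet_derivative f (at x) v\<bar> \<le> (\<Sum>b\<in>Basis. \<bar>(v \<bullet> b) * frechet_derivative f (at x) b\<bar>)"
      unfolding C1c_deriv_expand[OF f, of x v] by (rule sum_abs)
    also have "\<dots> \<le> (\<Sum>b\<in>Basis. norm v * B b)"
      by (intro sum_mono) (auto simp: abs_mult intro!: mult_mono B Basis_le_norm)
    also have "\<dots> = (\<Sum>b\<in>Basis. B b) * norm v" by (simp add: sum_distrib_left mult.commute)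
    finally show "\<bar>frechet_derivative f (at x) v\<bar> \<le> (\<Sum>b\<in>Basis. B b) * norm v" .
  qed
qed

lemma C1c_DERIV_line:
  assumes "C1c f"
  shows "((\<lambda>h. f (x + h *\<^sub>R v)) has_real_derivative frechet_derivative f (at (x + h *\<^sub>R v)) v) (at h)"
proof -
  have "((\<lambda>h. x + h *\<^sub>R v) has_derivative (\<lambda>h. h *\<^sub>R v)) (at h)"
    by (auto intro!: derivative_eq_intros)
  then have "((\<lambda>h. f (x + h *\<^sub>R v)) has_derivative
      (\<lambda>t. frechet_derivative f (at (x + h *\<^sub>R v)) (t *\<^sub>R v))) (at h)"
    by (rule has_derivative_compose[OF _ C1c_has_derivative[OF assms]])
  moreover have "(\<lambda>t. frechet_derivative f (at (x + h *\<^sub>R v)) (t *\<^sub>R v))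
      = (*) (frechet_derivative f (at (x + h *\<^sub>R v)) v)"
    using C1c_linear[OF assms] by (auto simp: linear_scale)
  ultimately show ?thesis by (simp add: has_field_derivative_def)
qed

lemma C1c_lipschitz:
  assumes f: "C1c f" and L: "\<And>x v. \<bar>frechet_derivative f (at x) v\<bar> \<le> L * norm v"
  shows "\<bar>f (x + v) - f x\<bar> \<le> L * norm v"
proof -
  have "\<exists>h. 0 < h \<and> h < 1 \<and> f (x + 1 *\<^sub>R v) - f (x + 0 *\<^sub>R v)
      = (1 - 0) * frechet_derivative f (at (x + h *\<^sub>R v)) v"
    by (rule MVT2) (auto intro: C1c_DERIV_line[OF f])
  then show ?thesis using L by auto
qed

lemma C1c_measurable: "C1c f \<Longrightarrow> f \<in> borel_measurable borel"
  by (intro borel_measurable_continuous_onI C1c_continuous)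

text \<open>Continuity is known only for a fixed direction. Expanding in the basis separates the
  direction from the base point, so that a direction which varies merely measurably, such as a
  discontinuous field, is allowed.\<close>

lemma C1c_deriv_measurable:
  assumes f: "C1c f" and [measurable]: "X \<in> M \<rightarrow>\<^sub>M borel" "V \<in> M \<rightarrow>\<^sub>M borel"
  shows "(\<lambda>z. frechet_derivative f (at (X z)) (V z)) \<in> borel_measurable M"
proof -
  have [measurable]: "(\<lambda>x. frechet_derivative f (at x) v) \<in> borel_measurable borel" for v
    by (intro borel_measurable_continuous_onI C1c_continuous_deriv f)
  show ?thesis unfolding C1c_deriv_expand[OF f, of _ "V _"] by measurable
qed

lemma integrable_bounded_support:
  fixes f :: "'a::euclidean_space \<Rightarrow> real"
  assumes f: "f \<in> borel_measurable borel"
    and "\<And>x. \<bar>f x\<bar> \<le> B" and "\<And>x. r < norm x \<Longrightarrow> f x = 0"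
  shows "integrable lborel f"
proof (rule Bochner_Integration.integrable_bound)
  have "emeasure lborel (cball 0 r :: 'a set) < \<infinity>" by (rule emeasure_lborel_cball_finite)
  then show "integrable lborel (\<lambda>x. B * indicator (cball 0 r :: 'a set) x)"
    by (intro integrable_mult_right integrable_real_indicator) auto
  show "AE x in lborel. norm (f x) \<le> norm (B * indicator (cball 0 r) x)"
  proof (rule AE_I2)
    fix x
    show "norm (f x) \<le> norm (B * indicator (cball 0 r) x)"
      using assms(2)[of x] assms(3)[of x] by (auto split: split_indicator)
  qed
qed (use f in simp)

text \<open>The lower bound on \<open>J\<close> keeps the support of the composite bounded;
  differentiability and continuity come from the chain rule.\<close>

lemma C1c_compose_linear:
  assumes f: "C1c f" and J: "bounded_linear J" and inj: "\<And>x. norm x \<le> C * norm (J x)"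
  shows "C1c (\<lambda>x. f (J x))"
    and "frechet_derivative (\<lambda>x. f (J x)) (at x) v = frechet_derivative f (at (J x)) (J v)"
proof -
  have D: "((\<lambda>x. f (J x)) has_derivative (\<lambda>v. frechet_derivative f (at (J x)) (J v))) (at x)" for x
    by (rule has_derivative_compose[OF bounded_linear_imp_has_derivative[OF J] C1c_has_derivative[OF f]])
  then have eq: "frechet_derivative (\<lambda>x. f (J x)) (at x) v = frechet_derivative f (at (J x)) (J v)" for x v
    by (metis frechet_derivative_at)
  then show "frechet_derivative (\<lambda>x. f (J x)) (at x) v = frechet_derivative f (at (J x)) (J v)" .
  obtain r where r: "0 < r" "\<And>x. x \<notin> cball 0 r \<Longrightarrow> f x = 0" using C1c_support[OF f] by metis
  have "f (J x) = 0" if "\<bar>C\<bar> * r < norm x" for x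
  proof -
    have "\<bar>C\<bar> * r < \<bar>C\<bar> * norm (J x)"
      using that inj[of x] by (smt (verit) mult_right_mono norm_ge_zero)
    then have "r < norm (J x)" by (metis abs_ge_zero mult_left_mono not_less)
    then show ?thesis by (intro r) auto
  qed
  moreover have "continuous_on UNIV (\<lambda>x. frechet_derivative f (at (J x)) (J v))" for v
    by (rule continuous_on_compose2[OF C1c_continuous_deriv[OF f] linear_continuous_on[OF J]]) auto
  ultimately show "C1c (\<lambda>x. f (J x))"
    using D unfolding C1c_def eq by (auto simp: differentiable_def)
qed

lemma test_fun_C1c:
  fixes U :: "'a::euclidean_space set"
  assumes "test_fun U f"
  shows "C1c f"
proof -
  have "Ck 1 f" and c: "compact (closure {x. f x \<noteq> 0})"
    using assms by (auto simp: test_fun_def Cinf_def compact_support_in_def)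
  moreover obtain r where "\<forall>x\<in>closure {x. f x \<noteq> 0}. norm x \<le> r"
    using compact_imp_bounded[OF c] by (auto simp: bounded_iff)
  then have "f x = 0" if "r < norm x" for x
    using that closure_subset[of "{x. f x \<noteq> 0}"] by force
  ultimately show ?thesis unfolding C1c_def by auto
qed

lemma test_fun_eq_0: "test_fun U f \<Longrightarrow> x \<notin> U \<Longrightarrow> f x = 0"
  using closure_subset[of "{x. f x \<noteq> 0}"]
  by (auto simp: test_fun_def compact_support_in_def subset_eq)

lemma test_fun_deriv_eq_0:
  fixes U :: "'a::euclidean_space set"
  assumes "test_fun U f" "x \<notin> U"
  shows "frechet_derivative f (at x) v = 0"
proof (rule C1c_deriv_eq_0[OF test_fun_C1c[OF assms(1)]])
  show "f x = 0" if "x \<notin> closure {x. f x \<noteq> 0}" for x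
    using that closure_subset[of "{x. f x \<noteq> 0}"] by auto
qed (use assms in \<open>auto simp: test_fun_def compact_support_in_def\<close>)

section \<open>Weak derivatives of bounded measurable functions by difference quotients\<close>

lemma lborel_integral_translation:
  fixes f :: "'a::euclidean_space \<Rightarrow> real"
  assumes [measurable]: "f \<in> borel_measurable borel"
  shows "(LINT x|lborel. f (x + v)) = (LINT x|lborel. f x)"
  by (subst (2) lborel_distr_plus[symmetric, of v]) (simp add: integral_distr add.commute)

text \<open>Dominated convergence: the quotients are bounded by the Lipschitz constant times
  \<open>norm v\<close>, and as the steps are at most 1 they vanish outside a ball enlarged by
  \<open>norm v\<close>. Only boundedness of \<open>g\<close> enters, which allows discontinuous
  fields.\<close>

lemma difference_quotient_tendsto:
  assumes f: "C1c f" and g[measurable]: "g \<in> borel_measurable borel" and G: "\<And>x. \<bar>g x\<bar> \<le> G"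
  shows "(\<lambda>n. LINT x|lborel. g x * (real (Suc n) * (f (x + (1 / real (Suc n)) *\<^sub>R v) - f x)))
    \<longlonglongrightarrow> (LINT x|lborel. g x * frechet_derivative f (at x) v)"
proof -
  obtain r where r: "0 < r" "\<And>x. x \<notin> cball 0 r \<Longrightarrow> f x = 0" using C1c_support[OF f] by metis
  obtain L where L: "0 < L" "\<And>x v. \<bar>frechet_derivative f (at x) v\<bar> \<le> L * norm v"
    using C1c_deriv_bounded[OF f] by metis
  let ?K = "cball 0 (r + norm v) :: 'a set"
  have G0: "0 \<le> G" using G[of 0] by simp
  have [measurable]: "f \<in> borel_measurable borel" by (rule C1c_measurable[OF f])
  show ?thesis
  proof (rule integral_dominated_convergence[where w = "\<lambda>x. G * (L * norm v) * indicator ?K x"])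
    show "(\<lambda>x. g x * frechet_derivative f (at x) v) \<in> borel_measurable lborel"
      using C1c_deriv_measurable[OF f, of "\<lambda>x. x" lborel "\<lambda>_. v"] by simp
    show "(\<lambda>x. g x * (real (Suc n) * (f (x + (1 / real (Suc n)) *\<^sub>R v) - f x))) \<in> borel_measurable lborel" for n
      by measurable
    have "emeasure lborel ?K < \<infinity>" by (rule emeasure_lborel_cball_finite)
    then show "integrable lborel (\<lambda>x. G * (L * norm v) * indicator ?K x)"
      by (intro integrable_mult_right integrable_real_indicator) auto
    show "AE x in lborel. (\<lambda>n. g x * (real (Suc n) * (f (x + (1 / real (Suc n)) *\<^sub>R v) - f x)))
        \<longlonglongrightarrow> g x * frechet_derivative f (at x) v"
    proof (rule AE_I2, rule tendsto_mult[OF tendsto_const])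
      fix x
      have "(\<lambda>h. (f (x + (0 + h) *\<^sub>R v) - f (x + 0 *\<^sub>R v)) / h) \<midarrow>0\<rightarrow> frechet_derivative f (at (x + 0 *\<^sub>R v)) v"
        using C1c_DERIV_line[OF f, of x v 0] unfolding DERIV_def .
      moreover have "filterlim (\<lambda>n. 1 / real (Suc n)) (at 0) sequentially"
        unfolding filterlim_at using LIMSEQ_inverse_real_of_nat
        by (auto simp: inverse_eq_divide simp del: of_nat_Suc)
      ultimately have "(\<lambda>n. (f (x + (0 + 1 / real (Suc n)) *\<^sub>R v) - f (x + 0 *\<^sub>R v)) / (1 / real (Suc n)))
          \<longlonglongrightarrow> frechet_derivative f (at (x + 0 *\<^sub>R v)) v"
        by (rule filterlim_compose)
      then show "(\<lambda>n. real (Suc n) * (f (x + (1 / real (Suc n)) *\<^sub>R v) - f x)) \<longlonglongrightarrow> frechet_derivative f (at x) v"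
        by (simp add: mult.commute del: of_nat_Suc)
    qed
    show "AE x in lborel. norm (g x * (real (Suc n) * (f (x + (1 / real (Suc n)) *\<^sub>R v) - f x)))
        \<le> G * (L * norm v) * indicator ?K x" for n
    proof (rule AE_I2)
      fix x
      let ?h = "1 / real (Suc n)"
      have h: "0 < ?h" "?h \<le> 1" by auto
      show "norm (g x * (real (Suc n) * (f (x + ?h *\<^sub>R v) - f x))) \<le> G * (L * norm v) * indicator ?K x"
      proof (cases "x \<in> ?K")
        case True
        have "\<bar>f (x + ?h *\<^sub>R v) - f x\<bar> \<le> L * norm (?h *\<^sub>R v)" by (rule C1c_lipschitz[OF f L(2)])
        then have "real (Suc n) * \<bar>f (x + ?h *\<^sub>R v) - f x\<bar> \<le> real (Suc n) * (L * (?h * norm v))"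
          by (intro mult_left_mono) (auto simp del: of_nat_Suc)
        then have "\<bar>real (Suc n) * (f (x + ?h *\<^sub>R v) - f x)\<bar> \<le> L * norm v"
          by (simp add: abs_mult del: of_nat_Suc)
        then show ?thesis using True G[of x] G0
          by (simp add: abs_mult[of "g x"] mult_mono del: of_nat_Suc)
      next
        case False
        have "norm (?h *\<^sub>R v) \<le> norm v" using mult_right_mono[OF h(2), of "norm v"] by (simp del: of_nat_Suc)
        moreover have "norm x - norm (?h *\<^sub>R v) \<le> norm (x + ?h *\<^sub>R v)"
          using norm_triangle_ineq2[of x "- (?h *\<^sub>R v)"] by simp
        moreover have "r + norm v < norm x" using False by simp
        ultimately have "r < norm (x + ?h *\<^sub>R v)" "r < norm x"
          using norm_ge_zero[of v] by linarith+
        then have "f x = 0" "f (x + ?h *\<^sub>R v) = 0" by (auto intro!: r(2))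
        then show ?thesis using False by (simp del: of_nat_Suc)
      qed
    qed
  qed
qed

text \<open>Discrete integration by parts: translation invariance of Lebesgue measure moves the
  increment from \<open>f\<close> to \<open>g\<close>, which need not be differentiable.\<close>

lemma difference_shift:
  assumes f: "C1c f" and g[measurable]: "g \<in> borel_measurable borel" and G: "\<And>x. \<bar>g x\<bar> \<le> G"
  shows "(LINT x|lborel. g x * (f (x + v) - f x)) = (LINT x|lborel. (g (x - v) - g x) * f x)"
proof -
  obtain r where r: "0 < r" "\<And>x. x \<notin> cball 0 r \<Longrightarrow> f x = 0" using C1c_support[OF f] by metis
  obtain B where B: "0 < B" "\<And>x. \<bar>f x\<bar> \<le> B" using C1c_bounded[OF f] by metis
  have [measurable]: "f \<in> borel_measurable borel" by (rule C1c_measurable[OF f])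
  have G0: "0 \<le> G" using G[of 0] by simp
  have int: "integrable lborel (\<lambda>x. g (x + a) * f (x + b))" for a b
  proof (rule integrable_bounded_support[where B = "G * B" and r = "r + norm b"])
    fix x
    show "\<bar>g (x + a) * f (x + b)\<bar> \<le> G * B"
      unfolding abs_mult by (intro mult_mono G B) (use G0 in auto)
    assume "r + norm b < norm x"
    then have "r < norm (x + b)" using norm_triangle_ineq2[of x "- b"] by auto
    then show "g (x + a) * f (x + b) = 0" by (simp add: r(2))
  qed measurable
  have "(LINT x|lborel. g x * (f (x + v) - f x)) = (LINT x|lborel. g x * f (x + v)) - (LINT x|lborel. g x * f x)"
    using int[of 0 v] int[of 0 0] by (simp add: algebra_simps)
  also have "(LINT x|lborel. g x * f (x + v)) = (LINT x|lborel. g (x - v) * f x)"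
    using lborel_integral_translation[of "\<lambda>x. g (x - v) * f x" v] by simp
  also have "\<dots> - (LINT x|lborel. g x * f x) = (LINT x|lborel. (g (x - v) - g x) * f x)"
    using int[of "- v" 0] int[of 0 0] by (simp add: algebra_simps)
  finally show ?thesis .
qed

text \<open>After the shift all increments of \<open>g\<close> are zero, hence so is the limit. This
  is how a component of the field that is constant along its own axis contributes nothing to the
  divergence.\<close>

lemma integral_deriv_invariant_eq_0:
  assumes f: "C1c f" and g: "g \<in> borel_measurable borel" and G: "\<And>x. \<bar>g x\<bar> \<le> G"
    and inv: "\<And>\<tau> x. g (x + \<tau> *\<^sub>R v) = g x"
  shows "(LINT x|lborel. g x * frechet_derivative f (at x) v) = 0"
proof -
  have "(LINT x|lborel. g x * (real (Suc n) * (f (x + (1 / real (Suc n)) *\<^sub>R v) - f x))) = 0" for n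
  proof -
    have "g (x - (1 / real (Suc n)) *\<^sub>R v) = g x" for x
      using inv[of x "- (1 / real (Suc n))"] by (simp del: of_nat_Suc)
    then have "(LINT x|lborel. g x * (f (x + (1 / real (Suc n)) *\<^sub>R v) - f x)) = 0"
      unfolding difference_shift[OF f g G] by (simp del: of_nat_Suc)
    then have "real (Suc n) * (LINT x|lborel. g x * (f (x + (1 / real (Suc n)) *\<^sub>R v) - f x)) = 0" by simp
    then show ?thesis
      by (subst (asm) integral_mult_right_zero[symmetric]) (simp only: mult.left_commute)
  qed
  then show ?thesis using difference_quotient_tendsto[OF f g G, of v] LIMSEQ_unique[OF _ tendsto_const] by fastforce
qed

text \<open>If the increments of \<open>g\<close> tested against \<open>f\<close> are of order
  \<open>h\<close>, so is the shifted difference, and the limit of the quotients inherits the bound.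
  This is the route from counting jumps to total variation.\<close>

lemma integral_deriv_le:
  assumes f: "C1c f" and g: "g \<in> borel_measurable borel" and G: "\<And>x. \<bar>g x\<bar> \<le> G"
    and h0: "0 < h0" and le: "\<And>h. 0 < h \<Longrightarrow> h < h0 \<Longrightarrow> \<bar>LINT x|lborel. (g (x - h *\<^sub>R v) - g x) * f x\<bar> \<le> M * h"
  shows "\<bar>LINT x|lborel. g x * frechet_derivative f (at x) v\<bar> \<le> M"
proof (rule LIMSEQ_le_const2[OF tendsto_rabs[OF difference_quotient_tendsto[OF f g G]]])
  obtain N where N: "inverse (real (Suc N)) < h0" using reals_Archimedean[OF h0] by blast
  have "\<bar>LINT x|lborel. g x * (real (Suc n) * (f (x + (1 / real (Suc n)) *\<^sub>R v) - f x))\<bar> \<le> M" if "N \<le> n" for n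
  proof -
    let ?h = "1 / real (Suc n)"
    have "?h \<le> 1 / real (Suc N)" using that by (intro divide_left_mono) auto
    then have h: "0 < ?h" "?h < h0" using N by (auto simp: inverse_eq_divide simp del: of_nat_Suc)
    have "(LINT x|lborel. g x * (real (Suc n) * (f (x + ?h *\<^sub>R v) - f x)))
        = real (Suc n) * (LINT x|lborel. (g (x - ?h *\<^sub>R v) - g x) * f x)"
      unfolding difference_shift[OF f g G, symmetric]
      by (subst integral_mult_right_zero[symmetric]) (simp only: mult.left_commute)
    then show ?thesis using le[OF h] by (simp add: abs_mult field_simps del: of_nat_Suc)
  qed
  then show "\<exists>N. \<forall>n\<ge>N. \<bar>LINT x|lborel. g x * (real (Suc n) * (f (x + (1 / real (Suc n)) *\<^sub>R v) - f x))\<bar> \<le> M"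
    by blast
qed

section \<open>Shears\<close>

text \<open>Averaging over translations by \<open>\<tau> e\<close>, \<open>0 \<le> \<tau> \<le> 1\<close>, turns the shear into a translation
  of the weight \<open>1\<^bsub>[0,1]\<^esub>\<close> by \<open>\<kappa>(x)\<close>.\<close>

lemma lborel_distr_shear:
  fixes e :: "'a::euclidean_space"
  assumes \<kappa>[measurable]: "\<kappa> \<in> borel_measurable borel" and inv: "\<And>x \<tau>. \<kappa> (x + \<tau> *\<^sub>R e) = \<kappa> x"
  shows "distr lborel borel (\<lambda>x. x + \<kappa> x *\<^sub>R e) = lborel"
proof (rule measure_eqI)
  fix A assume "A \<in> sets (distr lborel borel (\<lambda>x. x + \<kappa> x *\<^sub>R e))"
  then have A[measurable]: "A \<in> sets borel" by simp
  have trl: "(\<integral>\<^sup>+x. f (x + y) \<partial>lborel) = (\<integral>\<^sup>+x. f x \<partial>lborel)"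
    if [measurable]: "f \<in> borel_measurable borel" for f and y :: "'b::euclidean_space"
    by (subst (2) lborel_distr_plus[symmetric, of y]) (simp add: nn_integral_distr add.commute)
  let ?I = "indicator {0..1::real} :: real \<Rightarrow> ennreal" and ?A = "indicator A :: 'a \<Rightarrow> ennreal"
  have I1: "(\<integral>\<^sup>+\<tau>. ?I (\<tau> - t) \<partial>lborel) = 1" for t
    using trl[of ?I "- t"] by simp
  have "emeasure (distr lborel borel (\<lambda>x. x + \<kappa> x *\<^sub>R e)) A
      = (\<integral>\<^sup>+z. ?A z \<partial>distr lborel borel (\<lambda>x. x + \<kappa> x *\<^sub>R e))" by simp
  also have "\<dots> = (\<integral>\<^sup>+x. ?A (x + \<kappa> x *\<^sub>R e) \<partial>lborel)"
    by (rule nn_integral_distr) auto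
  also have "\<dots> = (\<integral>\<^sup>+\<tau>. ?I \<tau> * (\<integral>\<^sup>+x. ?A (x + \<kappa> x *\<^sub>R e) \<partial>lborel) \<partial>lborel)"
    by (simp add: nn_integral_multc)
  also have "\<dots> = (\<integral>\<^sup>+\<tau>. \<integral>\<^sup>+x. ?I \<tau> * ?A (x + (\<tau> + \<kappa> x) *\<^sub>R e) \<partial>lborel \<partial>lborel)"
  proof (rule nn_integral_cong)
    fix \<tau> :: real
    have "(\<integral>\<^sup>+x. ?A (x + \<kappa> x *\<^sub>R e) \<partial>lborel)
        = (\<integral>\<^sup>+x. ?A ((x + \<tau> *\<^sub>R e) + \<kappa> (x + \<tau> *\<^sub>R e) *\<^sub>R e) \<partial>lborel)"
      by (rule trl[symmetric]) measurable
    also have "\<dots> = (\<integral>\<^sup>+x. ?A (x + (\<tau> + \<kappa> x) *\<^sub>R e) \<partial>lborel)"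
      by (simp add: inv algebra_simps)
    finally show "?I \<tau> * (\<integral>\<^sup>+x. ?A (x + \<kappa> x *\<^sub>R e) \<partial>lborel)
        = (\<integral>\<^sup>+x. ?I \<tau> * ?A (x + (\<tau> + \<kappa> x) *\<^sub>R e) \<partial>lborel)"
      by (simp add: nn_integral_cmult)
  qed
  also have "\<dots> = (\<integral>\<^sup>+x. \<integral>\<^sup>+\<tau>. ?I \<tau> * ?A (x + (\<tau> + \<kappa> x) *\<^sub>R e) \<partial>lborel \<partial>lborel)"
    by (rule lborel_pair.Fubini'[symmetric]) measurable
  also have "\<dots> = (\<integral>\<^sup>+x. \<integral>\<^sup>+\<tau>. ?I (\<tau> - \<kappa> x) * ?A (x + \<tau> *\<^sub>R e) \<partial>lborel \<partial>lborel)"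
  proof (rule nn_integral_cong)
    fix x
    show "(\<integral>\<^sup>+\<tau>. ?I \<tau> * ?A (x + (\<tau> + \<kappa> x) *\<^sub>R e) \<partial>lborel)
        = (\<integral>\<^sup>+\<tau>. ?I (\<tau> - \<kappa> x) * ?A (x + \<tau> *\<^sub>R e) \<partial>lborel)"
      using trl[of "\<lambda>\<tau>. ?I (\<tau> - \<kappa> x) * ?A (x + \<tau> *\<^sub>R e)" "\<kappa> x"] by simp
  qed
  also have "\<dots> = (\<integral>\<^sup>+\<tau>. \<integral>\<^sup>+x. ?I (\<tau> - \<kappa> x) * ?A (x + \<tau> *\<^sub>R e) \<partial>lborel \<partial>lborel)"
    by (rule lborel_pair.Fubini') measurable
  also have "\<dots> = (\<integral>\<^sup>+\<tau>. \<integral>\<^sup>+x. ?I (\<tau> - \<kappa> x) * ?A x \<partial>lborel \<partial>lborel)"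
  proof (rule nn_integral_cong)
    fix \<tau> :: real
    show "(\<integral>\<^sup>+x. ?I (\<tau> - \<kappa> x) * ?A (x + \<tau> *\<^sub>R e) \<partial>lborel) = (\<integral>\<^sup>+x. ?I (\<tau> - \<kappa> x) * ?A x \<partial>lborel)"
      using trl[of "\<lambda>x. ?I (\<tau> - \<kappa> x) * ?A x" "\<tau> *\<^sub>R e"] by (simp add: inv)
  qed
  also have "\<dots> = (\<integral>\<^sup>+x. \<integral>\<^sup>+\<tau>. ?I (\<tau> - \<kappa> x) * ?A x \<partial>lborel \<partial>lborel)"
    by (rule lborel_pair.Fubini'[symmetric]) measurable
  also have "\<dots> = (\<integral>\<^sup>+x. ?A x \<partial>lborel)"
  proof (rule nn_integral_cong)
    fix x
    show "(\<integral>\<^sup>+\<tau>. ?I (\<tau> - \<kappa> x) * ?A x \<partial>lborel) = ?A x"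
      by (simp add: nn_integral_multc I1)
  qed
  finally show "emeasure (distr lborel borel (\<lambda>x. x + \<kappa> x *\<^sub>R e)) A = emeasure lborel A" by simp
qed simp

text \<open>Invariance of \<open>V\<close> along itself makes \<open>(\<tau>, y) \<mapsto> y + \<tau> V(y)\<close> the flow of \<open>V\<close>.\<close>

definition shear_field :: "('a::euclidean_space \<Rightarrow> 'a) \<Rightarrow> bool" where
  "shear_field V \<longleftrightarrow> V \<in> borel_measurable borel \<and> bounded (range V)
     \<and> (\<forall>\<tau> y. V (y + \<tau> *\<^sub>R V y) = V y)
     \<and> (\<forall>\<tau>. distr lborel borel (\<lambda>y. y + \<tau> *\<^sub>R V y) = lborel)"

text \<open>Since \<open>\<kappa>\<close> is constant along \<open>e\<close> and \<open>d\<close>,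
  it is constant along trajectories. The flow for time \<open>\<tau>\<close> is the shear by
  \<open>\<tau> * \<kappa>\<close> along \<open>e\<close> followed by the translation by
  \<open>\<tau> d\<close>, and both preserve Lebesgue measure. In the application \<open>d\<close>
  is the drift in physical time.\<close>

lemma shear_fieldI:
  fixes e d :: "'a::euclidean_space"
  assumes \<kappa>[measurable]: "\<kappa> \<in> borel_measurable borel" and B: "\<And>x. \<bar>\<kappa> x\<bar> \<le> B"
    and inv: "\<And>x \<tau>. \<kappa> (x + \<tau> *\<^sub>R e) = \<kappa> x" "\<And>x \<tau>. \<kappa> (x + \<tau> *\<^sub>R d) = \<kappa> x"
  shows "shear_field (\<lambda>y. d + \<kappa> y *\<^sub>R e)"
  unfolding shear_field_def
proof (intro conjI allI)
  show "bounded (range (\<lambda>y. d + \<kappa> y *\<^sub>R e))"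
    unfolding bounded_iff
  proof (intro exI ballI)
    fix z assume "z \<in> range (\<lambda>y. d + \<kappa> y *\<^sub>R e)"
    then obtain y where z: "z = d + \<kappa> y *\<^sub>R e" by auto
    have "norm z \<le> norm d + \<bar>\<kappa> y\<bar> * norm e" unfolding z by (metis norm_scaleR norm_triangle_ineq)
    also have "\<dots> \<le> norm d + B * norm e" by (intro add_left_mono mult_right_mono B) auto
    finally show "norm z \<le> norm d + B * norm e" .
  qed
  show "d + \<kappa> (y + \<tau> *\<^sub>R (d + \<kappa> y *\<^sub>R e)) *\<^sub>R e = d + \<kappa> y *\<^sub>R e" for \<tau> y
    using inv(1)[of "y + \<tau> *\<^sub>R d" "\<tau> * \<kappa> y"] inv(2)[of y \<tau>] by (simp add: algebra_simps)
  show "distr lborel borel (\<lambda>y. y + \<tau> *\<^sub>R (d + \<kappa> y *\<^sub>R e)) = lborel" for \<tau>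
  proof -
    have sh: "distr lborel borel (\<lambda>y. y + (\<tau> * \<kappa> y) *\<^sub>R e) = lborel"
      by (rule lborel_distr_shear) (auto simp: inv)
    have "distr lborel borel (\<lambda>y. y + \<tau> *\<^sub>R (d + \<kappa> y *\<^sub>R e))
        = distr (distr lborel borel (\<lambda>y. y + (\<tau> * \<kappa> y) *\<^sub>R e)) borel ((+) (\<tau> *\<^sub>R d))"
      by (subst distr_distr) (auto simp: comp_def algebra_simps)
    also have "\<dots> = lborel" unfolding sh by (rule lborel_distr_plus)
    finally show ?thesis .
  qed
qed measurable

lemma shear_field_integral:
  fixes f :: "'a::euclidean_space \<Rightarrow> real"
  assumes V: "shear_field V" and [measurable]: "f \<in> borel_measurable borel"
  shows "(LINT y|lborel. f (y + \<tau> *\<^sub>R V y)) = (LINT y|lborel. f y)"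
proof -
  have [measurable]: "V \<in> borel_measurable borel"
    and mp: "distr lborel borel (\<lambda>y. y + \<tau> *\<^sub>R V y) = lborel"
    using V by (auto simp: shear_field_def)
  show ?thesis by (subst (2) mp[symmetric]) (simp add: integral_distr)
qed

text \<open>Both sides become an integral over the foot points \<open>y\<close> of the trajectories
  \<open>s \<mapsto> (s, y + (s - a) V(y))\<close>, along which the integrand is a derivative.\<close>

lemma transport_slab:
  fixes \<psi> :: "real \<times> 'a::euclidean_space \<Rightarrow> real"
  assumes \<psi>: "C1c \<psi>" and V: "shear_field V"
    and w[measurable]: "w \<in> borel_measurable borel" and W: "\<And>y. \<bar>w y\<bar> \<le> W" and "a \<le> b"
  shows "(LINT z|lborel. indicator {a<..b} (fst z) * w (snd z - (fst z - a) *\<^sub>R V (snd z))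
            * frechet_derivative \<psi> (at z) (1, V (snd z)))
       = (LINT y|lborel. w (y - (b - a) *\<^sub>R V y) * \<psi> (b, y)) - (LINT y|lborel. w y * \<psi> (a, y))"
proof -
  let ?D = "\<lambda>z. frechet_derivative \<psi> (at z)"
  have V[measurable]: "V \<in> borel_measurable borel" and "bounded (range V)"
    and Vinv: "\<And>\<tau> y. V (y + \<tau> *\<^sub>R V y) = V y" and Vs: "shear_field V"
    using V by (auto simp: shear_field_def)
  then obtain C where C: "\<And>y. norm (V y) \<le> C" by (auto simp: bounded_iff)
  have Vinv': "V (y - \<tau> *\<^sub>R V y) = V y" for \<tau> y using Vinv[of y "- \<tau>"] by simp
  obtain r where r: "0 < r" "\<And>x. x \<notin> cball 0 r \<Longrightarrow> \<psi> x = 0" "\<And>x v. x \<notin> cball 0 r \<Longrightarrow> ?D x v = 0"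
    using C1c_support[OF \<psi>] by metis
  obtain L where L: "0 < L" "\<And>x v. \<bar>?D x v\<bar> \<le> L * norm v" using C1c_deriv_bounded[OF \<psi>] by metis
  obtain P where P: "0 < P" "\<And>x. \<bar>\<psi> x\<bar> \<le> P" using C1c_bounded[OF \<psi>] by metis
  have [measurable]: "\<psi> \<in> borel_measurable borel" by (rule C1c_measurable[OF \<psi>])
  have W0: "0 \<le> W" using W[of 0] by simp
  have C0: "0 \<le> C" using C[of 0] norm_ge_zero[of "V 0"] by linarith
  have Db: "\<bar>?D z (1, V y)\<bar> \<le> L * (1 + C)" for z y
  proof -
    have "norm (1::real, V y) \<le> 1 + C"
      using norm_Pair_le[of "1::real" "V y"] C[of y] by auto
    then show ?thesis using L(2)[of z "(1, V y)"] mult_left_mono[of "norm (1::real, V y)" "1 + C" L] L(1)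
      by linarith
  qed
  have nz: "norm z \<le> r \<Longrightarrow> norm (fst z) \<le> r \<and> norm (snd z) \<le> r" for z :: "real \<times> 'a"
    using norm_fst_le[of "fst z" "snd z"] norm_snd_le[of "snd z" "fst z"] by (auto simp: norm_fst_le norm_snd_le)
  define F where "F z = indicator {a<..b} (fst z) * w (snd z - (fst z - a) *\<^sub>R V (snd z)) * ?D z (1, V (snd z))" for z
  define H where "H z = indicator {a<..b} (fst z) * w (snd z)
      * ?D (fst z, snd z + (fst z - a) *\<^sub>R V (snd z)) (1, V (snd z))" for z
  have [measurable]: "(\<lambda>z. ?D z (1, V (snd z))) \<in> borel_measurable borel"
    by (rule C1c_deriv_measurable[OF \<psi>]) measurable
  have [measurable]: "(\<lambda>z. ?D (fst z, snd z + (fst z - a) *\<^sub>R V (snd z)) (1, V (snd z))) \<in> borel_measurable borel"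
    by (rule C1c_deriv_measurable[OF \<psi>]) measurable
  have Fm[measurable]: "F \<in> borel_measurable borel" unfolding F_def by measurable
  have Hm[measurable]: "H \<in> borel_measurable borel" unfolding H_def by measurable
  have intF: "integrable lborel F"
  proof (rule integrable_bounded_support[OF Fm, where B = "W * (L * (1 + C))" and r = r])
    show "\<bar>F z\<bar> \<le> W * (L * (1 + C))" for z
      using W[of "snd z - (fst z - a) *\<^sub>R V (snd z)"] Db[of z "snd z"] W0 L(1) C0 unfolding F_def
      by (auto simp: abs_mult intro!: mult_mono split: split_indicator)
    show "F z = 0" if "r < norm z" for z using that r(3)[of z] by (simp add: F_def)
  qed
  \<comment> \<open>In the support radius of the pulled-back integrand, the evolution parameter and
    the transported point account for \<open>r\<close> each, and the displacement along the
    trajectory for \<open>(b - a) * C\<close>.\<close>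
  have intH: "integrable lborel H"
  proof (rule integrable_bounded_support[OF Hm, where B = "W * (L * (1 + C))" and r = "2 * r + (b - a) * C"])
    show "\<bar>H z\<bar> \<le> W * (L * (1 + C))" for z
      using W[of "snd z"] Db[of "(fst z, snd z + (fst z - a) *\<^sub>R V (snd z))" "snd z"] W0 L(1) C0 unfolding H_def
      by (auto simp: abs_mult intro!: mult_mono split: split_indicator)
    show "H z = 0" if z: "2 * r + (b - a) * C < norm z" for z
    proof (cases "fst z \<in> {a<..b}")
      case True
      have "norm ((fst z - a) *\<^sub>R V (snd z)) \<le> (b - a) * C"
        using True C C0 by (auto intro!: mult_mono)
      moreover have "norm z \<le> \<bar>fst z\<bar> + norm (snd z)"
        using norm_Pair_le[of "fst z" "snd z"] by simp
      moreover have "norm (snd z) \<le> norm (snd z + (fst z - a) *\<^sub>R V (snd z)) + norm ((fst z - a) *\<^sub>R V (snd z))"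
        using norm_triangle_ineq4[of "snd z + (fst z - a) *\<^sub>R V (snd z)" "(fst z - a) *\<^sub>R V (snd z)"] by simp
      ultimately have "\<not> norm (fst z, snd z + (fst z - a) *\<^sub>R V (snd z)) \<le> r"
        using z nz[of "(fst z, snd z + (fst z - a) *\<^sub>R V (snd z))"] by auto
      then show ?thesis using r(3) by (simp add: H_def)
    qed (simp add: H_def)
  qed
  have inner: "(LINT y|lborel. F (s, y)) = (LINT y|lborel. H (s, y))" for s
  proof -
    have [measurable]: "(\<lambda>y. F (s, y)) \<in> borel_measurable borel"
      by (rule measurable_compose[OF _ Fm]) measurable
    have "(LINT y|lborel. F (s, y)) = (LINT y|lborel. F (s, y + (s - a) *\<^sub>R V y))"
      by (rule shear_field_integral[OF Vs, symmetric]) measurable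
    then show ?thesis by (simp add: F_def H_def Vinv)
  qed
  have FTC: "(LINT s|lborel. H (s, y)) = w y * (\<psi> (b, y + (b - a) *\<^sub>R V y) - \<psi> (a, y))" for y
  proof -
    let ?q = "\<lambda>s. ?D (s, y + (s - a) *\<^sub>R V y) (1, V y)"
    have "((\<lambda>s. \<psi> ((0, y - a *\<^sub>R V y) + s *\<^sub>R (1, V y))) has_real_derivative
        ?D ((0, y - a *\<^sub>R V y) + s *\<^sub>R (1, V y)) (1, V y)) (at s)" for s
      by (rule C1c_DERIV_line[OF \<psi>])
    then have der: "((\<lambda>s. \<psi> (s, y + (s - a) *\<^sub>R V y)) has_real_derivative ?q s) (at s)" for s
      by (simp add: algebra_simps)
    have cont: "isCont ?q s" for s
    proof -
      have "continuous_on UNIV ?q"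
        by (rule continuous_on_compose2[OF C1c_continuous_deriv[OF \<psi>]]) (auto intro!: continuous_intros)
      then show ?thesis by (simp add: continuous_on_eq_continuous_at)
    qed
    have "has_bochner_integral lborel (\<lambda>s. ?q s * indicator {a..b} s)
        (\<psi> (b, y + (b - a) *\<^sub>R V y) - \<psi> (a, y + (a - a) *\<^sub>R V y))"
      by (rule has_bochner_integral_FTC_Icc_real[OF \<open>a \<le> b\<close>]) (auto intro: der cont)
    then have I: "(LINT s|lborel. ?q s * indicator {a..b} s) = \<psi> (b, y + (b - a) *\<^sub>R V y) - \<psi> (a, y)"
      by (simp add: has_bochner_integral_integral_eq)
    \<comment> \<open>The slab is half-open so that consecutive slabs are disjoint, whereas the
      fundamental theorem is stated for a closed interval; they differ in the null set consisting of
      \<open>a\<close>.\<close>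
    have "(LINT s|lborel. H (s, y)) = (LINT s|lborel. w y * (?q s * indicator {a..b} s))"
    proof (rule integral_cong_AE)
      show "(\<lambda>s. H (s, y)) \<in> borel_measurable lborel"
        by (rule measurable_compose[OF _ Hm]) measurable
      have "?q \<in> borel_measurable borel" by (rule C1c_deriv_measurable[OF \<psi>]) measurable
      then show "(\<lambda>s. w y * (?q s * indicator {a..b} s)) \<in> borel_measurable lborel" by measurable
      show "AE s in lborel. H (s, y) = w y * (?q s * indicator {a..b} s)"
        using AE_lborel_singleton[of a] by eventually_elim (auto simp: H_def split: split_indicator)
    qed
    then show ?thesis using I by simp
  qed
  have intb: "integrable lborel (\<lambda>y. w (y - t *\<^sub>R V y) * \<psi> (s, y))" for s t
  proof (rule integrable_bounded_support[where B = "W * P" and r = r])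
    show "\<bar>w (y - t *\<^sub>R V y) * \<psi> (s, y)\<bar> \<le> W * P" for y
      unfolding abs_mult by (intro mult_mono W P) (use W0 in auto)
    show "w (y - t *\<^sub>R V y) * \<psi> (s, y) = 0" if "r < norm y" for y
      using that r(2)[of "(s, y)"] nz[of "(s, y)"] by auto
  qed measurable
  have end_b: "(LINT y|lborel. w y * \<psi> (b, y + (b - a) *\<^sub>R V y))
      = (LINT y|lborel. w (y - (b - a) *\<^sub>R V y) * \<psi> (b, y))"
    using shear_field_integral[OF Vs, of "\<lambda>y. w (y - (b - a) *\<^sub>R V y) * \<psi> (b, y)" "b - a"]
    by (simp add: Vinv)
  have int_b: "integrable lborel (\<lambda>y. w y * \<psi> (b, y + (b - a) *\<^sub>R V y))"
  proof -
    have "integrable (distr lborel borel (\<lambda>y. y + (b - a) *\<^sub>R V y)) (\<lambda>y. w (y - (b - a) *\<^sub>R V y) * \<psi> (b, y))"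
      using intb[of "b - a" b] Vs by (simp add: shear_field_def)
    then show ?thesis by (subst (asm) integrable_distr_eq) (auto simp: Vinv)
  qed
  have "(LINT z|lborel. F z) = (LINT z|(lborel \<Otimes>\<^sub>M lborel). F z)" by (simp add: lborel_prod)
  also have "\<dots> = (LINT s|lborel. LINT y|lborel. F (s, y))"
    using intF by (intro lborel_pair.integral_fst'[symmetric]) (simp add: lborel_prod)
  also have "\<dots> = (LINT s|lborel. LINT y|lborel. H (s, y))" by (simp add: inner)
  also have "\<dots> = (LINT y|lborel. LINT s|lborel. H (s, y))"
    using intH by (intro lborel_pair.Fubini_integral[symmetric]) (simp add: lborel_prod case_prod_eta)
  also have "\<dots> = (LINT y|lborel. w y * (\<psi> (b, y + (b - a) *\<^sub>R V y) - \<psi> (a, y)))" by (simp add: FTC)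
  also have "\<dots> = (LINT y|lborel. w y * \<psi> (b, y + (b - a) *\<^sub>R V y)) - (LINT y|lborel. w y * \<psi> (a, y))"
    using int_b intb[of 0 a] by (simp add: algebra_simps)
  also have "\<dots> = (LINT y|lborel. w (y - (b - a) *\<^sub>R V y) * \<psi> (b, y)) - (LINT y|lborel. w y * \<psi> (a, y))"
    by (simp only: end_b)
  finally show ?thesis unfolding F_def .
qed

section \<open>Mixing by alternating shears\<close>

text \<open>The Rademacher function with half-period \<open>(1/2) ^ n\<close>, extended periodically
  to the whole line.\<close>

definition square_wave :: "nat \<Rightarrow> real \<Rightarrow> real" where
  "square_wave n x = (if even \<lfloor>2 ^ n * x\<rfloor> then 1 else - 1)"

lemma square_wave_shift: "square_wave n (x + (1/2) ^ n) = - square_wave n x"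
  and square_wave_shift': "square_wave n (x - (1/2) ^ n) = - square_wave n x"
  by (simp_all add: square_wave_def algebra_simps power_one_over)

lemma square_wave_cases: "square_wave n x = 1 \<or> square_wave n x = - 1"
  by (simp add: square_wave_def)

lemma square_wave_measurable [measurable]: "square_wave n \<in> borel_measurable borel"
  unfolding square_wave_def by measurable

text \<open>The cells are rectangles with sides \<open>(1/2) ^ n\<close> and
  \<open>(1/2) ^ Suc n\<close>, and the parity decides which side is the longer one. Passing to the
  next stage changes one factor only: \<open>square_wave n\<close> becomes
  \<open>square_wave (n + 2)\<close> in the same variable. A single shear can achieve this.\<close>

definition checkerboard :: "nat \<Rightarrow> real \<times> real \<Rightarrow> real" where
  "checkerboard n y =
     (if even n then square_wave n (fst y) * square_wave (Suc n) (snd y)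
      else square_wave n (snd y) * square_wave (Suc n) (fst y))"

text \<open>A shift by \<open>2\<^sup>-\<^sup>n\<^sup>-\<^sup>1\<close> flips the sign of \<open>square_wave (n + 1)\<close>; the shear applies it exactly where
  this trades a factor \<open>square_wave (n + 2)\<close> for \<open>square_wave n\<close>.\<close>

definition speed :: "nat \<Rightarrow> real \<Rightarrow> real" where
  "speed n x = (if square_wave n x = square_wave (n + 2) x then 0 else 1)"

definition shear :: "nat \<Rightarrow> real \<times> real \<Rightarrow> real \<times> real" where
  "shear n y = (if even n then (0, speed n (fst y)) else (speed n (snd y), 0))"

lemma speed_measurable [measurable]: "speed n \<in> borel_measurable borel"
  unfolding speed_def by measurable

lemma checkerboard_measurable [measurable]: "checkerboard n \<in> borel_measurable borel"
  unfolding checkerboard_def by measurable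

lemma shear_measurable [measurable]: "shear n \<in> borel_measurable borel"
  unfolding shear_def by measurable

lemma abs_checkerboard: "\<bar>checkerboard n y\<bar> = 1"
  using square_wave_cases[of n "fst y"] square_wave_cases[of n "snd y"]
    square_wave_cases[of "Suc n" "fst y"] square_wave_cases[of "Suc n" "snd y"]
  by (auto simp: checkerboard_def)

text \<open>The duration \<open>(1/2) ^ Suc n\<close> is the thickness of the slab, and it is also
  the half-period of the factor being displaced. Flowing across the slab away from the boundary thus
  turns the finer pattern into the coarser one.\<close>

lemma checkerboard_shear:
  "checkerboard (Suc n) (y - (1/2) ^ Suc n *\<^sub>R shear n y) = checkerboard n y"
proof -
  have "square_wave (Suc n) (x - (1/2) ^ Suc n * speed n z) * square_wave (Suc (Suc n)) z
      = square_wave n z * square_wave (Suc n) x" for x z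
    using square_wave_cases[of n z] square_wave_cases[of "n + 2" z] square_wave_shift'[of "Suc n" x]
    by (auto simp: speed_def simp del: power_Suc)
  then show ?thesis
    by (simp add: checkerboard_def shear_def del: power_Suc)
qed

definition flip_dir :: "nat \<Rightarrow> real \<times> real" where
  "flip_dir n = (if even n then (1, 0) else (0, 1))"

text \<open>Antisymmetry under a translation whose length tends to zero is the source of the weak
  convergence to zero in \<open>started_vanishing\<close>.\<close>

lemma checkerboard_flip: "checkerboard n (y + (1/2) ^ n *\<^sub>R flip_dir n) = - checkerboard n y"
  by (simp add: checkerboard_def flip_dir_def square_wave_shift)

text \<open>From here on points are \<open>(s, (t, y))\<close> with \<open>s = x\<^sub>1/c\<close> the evolution parameter, \<open>t\<close> the physical time and
  \<open>y = (x\<^sub>2, x\<^sub>3)\<close>: as \<open>s\<close> increases, \<open>t\<close> increases at unit speed.\<close>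

definition st_shear :: "nat \<Rightarrow> real \<times> (real \<times> real) \<Rightarrow> real \<times> (real \<times> real)" where
  "st_shear n z = (1, shear n (snd z))"

lemma shear_field_st_shear: "shear_field (st_shear n)"
proof (cases "even n")
  case True
  have "shear_field (\<lambda>z. (1, 0) + speed n (fst (snd z)) *\<^sub>R (0, (0, 1)))"
    by (rule shear_fieldI[of _ 1]) (auto simp: speed_def[of n "fst _"])
  moreover have "st_shear n = (\<lambda>z. (1, 0) + speed n (fst (snd z)) *\<^sub>R (0, (0, 1)))"
    using True by (auto simp: st_shear_def shear_def)
  ultimately show ?thesis by (simp only:)
next
  case False
  have "shear_field (\<lambda>z. (1, 0) + speed n (snd (snd z)) *\<^sub>R (0, (1, 0)))"
    by (rule shear_fieldI[of _ 1]) (auto simp: speed_def[of n "snd _"])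
  moreover have "st_shear n = (\<lambda>z. (1, 0) + speed n (snd (snd z)) *\<^sub>R (0, (1, 0)))"
    using False by (auto simp: st_shear_def shear_def)
  ultimately show ?thesis by (simp only:)
qed

section \<open>Dyadic slabs, the mixing field and the transported checkerboards\<close>

definition level :: "real \<Rightarrow> nat" where
  "level s = (LEAST n. (1/2) ^ Suc n < s)"

lemma level_measurable [measurable]: "level \<in> borel \<rightarrow>\<^sub>M count_space UNIV"
  unfolding level_def by measurable

lemma level_eq:
  assumes "(1/2) ^ Suc n < s" "s \<le> (1/2) ^ n"
  shows "level s = n"
  unfolding level_def
proof (rule Least_equality)
  fix m assume m: "(1/2) ^ Suc m < s"
  show "n \<le> m"
  proof (rule ccontr)
    assume "\<not> n \<le> m"
    then have "(1/2 :: real) ^ n \<le> (1/2) ^ Suc m" by (intro power_decreasing) auto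
    with m assms show False by linarith
  qed
qed (rule assms)

lemma level_bounds:
  assumes "0 < s" "s \<le> 1"
  shows "(1/2) ^ Suc (level s) < s" "s \<le> (1/2) ^ level s"
proof -
  obtain n where "(1/2) ^ n < s" using real_arch_pow_inv[of s "1/2"] assms by auto
  moreover have "(1/2::real) ^ Suc n \<le> (1/2) ^ n" by (intro power_decreasing) auto
  ultimately have ex: "(1/2) ^ Suc n < s" by linarith
  then show "(1/2) ^ Suc (level s) < s" unfolding level_def by (rule LeastI)
  show "s \<le> (1/2) ^ level s"
  proof (cases "level s")
    case (Suc m)
    then have "\<not> (1/2) ^ Suc m < s" using not_less_Least[of m "\<lambda>n. (1/2) ^ Suc n < s"] by (simp add: level_def)
    then show ?thesis using Suc by simp
  qed (use assms in simp)
qed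

text \<open>The guard also excludes \<open>s \<le> 0\<close>, where \<open>level\<close> is an
  unspecified \<open>LEAST\<close>. Beyond \<open>s = 1\<close> the planar field can be zero,
  because the solution is confined to \<open>s < t\<close> and test functions vanish for
  \<open>t \<ge> 1\<close>.\<close>

definition mix_field :: "real \<Rightarrow> real \<times> real \<Rightarrow> real \<times> real" where
  "mix_field s y = (if 0 < s \<and> s \<le> 1 then shear (level s) y else 0)"

text \<open>The solution on the face \<open>s = (1/2) ^ n\<close>, as a function of
  \<open>(t, y)\<close>: the indicator is the cut-off \<open>s < t\<close> for this value of
  \<open>s\<close>.\<close>

definition started :: "nat \<Rightarrow> real \<times> (real \<times> real) \<Rightarrow> real" where
  "started n z = indicator {(1/2) ^ n<..} (fst z) * checkerboard n (snd z)"

text \<open>In each slab the value is carried along \<open>st_shear\<close> from the face nearer to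
  the boundary. The trajectory takes as much physical time as evolution parameter, so the cut-off on
  that face becomes \<open>s < t\<close> throughout the slab.\<close>

definition mix_sol :: "real \<times> (real \<times> (real \<times> real)) \<Rightarrow> real" where
  "mix_sol z = (if 0 < fst z \<and> fst z \<le> 1
     then started (Suc (level (fst z)))
            (snd z - (fst z - (1/2) ^ Suc (level (fst z))) *\<^sub>R st_shear (level (fst z)) (snd z))
     else 0)"

lemma started_measurable [measurable]: "started n \<in> borel_measurable borel"
  unfolding started_def by measurable

lemma st_shear_measurable [measurable]: "st_shear n \<in> borel_measurable borel"
  unfolding st_shear_def by measurable

lemma mix_field_measurable [measurable]: "(\<lambda>z. mix_field (fst z) (snd z)) \<in> borel_measurable borel"
proof -
  have "(\<lambda>z. (\<lambda>n z. shear n (snd z)) (level (fst z)) z) \<in> borel_measurable (borel :: (real \<times> (real \<times> real)) measure)"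
    by (rule measurable_compose_countable) measurable
  then show ?thesis unfolding mix_field_def by measurable
qed

lemma mix_sol_measurable [measurable]: "mix_sol \<in> borel_measurable borel"
proof -
  have "(\<lambda>z. (\<lambda>n z. started (Suc n) (snd z - (fst z - (1/2) ^ Suc n) *\<^sub>R st_shear n (snd z))) (level (fst z)) z)
      \<in> borel_measurable (borel :: (real \<times> (real \<times> (real \<times> real))) measure)"
    by (rule measurable_compose_countable) measurable
  then show ?thesis unfolding mix_sol_def by measurable
qed

lemma abs_mix_sol: "\<bar>mix_sol (s, (t, y))\<bar> = (if 0 < s \<and> s \<le> 1 \<and> s < t then 1 else 0)"
  by (auto simp: mix_sol_def started_def st_shear_def abs_mult abs_checkerboard split: split_indicator)

lemma abs_mix_sol_le: "\<bar>mix_sol z\<bar> \<le> 1"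
  using abs_mix_sol[of "fst z" "fst (snd z)" "snd (snd z)"] by (auto split: if_splits)

lemma norm_mix_field_le: "norm (mix_field s y) \<le> 1"
  by (auto simp: mix_field_def shear_def speed_def norm_Pair)

text \<open>The matching condition between adjacent slabs: what leaves one slab on its far face is
  what the next slab starts from. It lets the face integrals telescope in
  \<open>mix_sol_weak\<close>.\<close>

lemma started_shear:
  "started (Suc n) (z - ((1/2) ^ n - (1/2) ^ Suc n) *\<^sub>R st_shear n z) = started n z"
proof -
  have h: "(1/2) ^ n - (1/2) ^ Suc n = (1/2 :: real) ^ Suc n" by simp
  have "(indicator {(1/2) ^ Suc n<..} (fst z - (1/2) ^ Suc n) :: real) = indicator {(1/2) ^ n<..} (fst z)"
    by (auto split: split_indicator simp: algebra_simps)
  then show ?thesis unfolding h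
    by (simp add: started_def st_shear_def checkerboard_shear del: power_Suc)
qed

text \<open>A translation by \<open>v\<close> of length \<open>(1/2) ^ n\<close> changes the sign of
  \<open>started n\<close>. Twice the integral is therefore an integral of \<open>started n\<close>
  against \<open>\<psi>(z) - \<psi>(z + v)\<close>, which is of order \<open>(1/2) ^ n\<close> by
  the Lipschitz bound. The bound is uniform in the first argument of \<open>\<psi>\<close>, which
  varies with \<open>n\<close> here.\<close>

lemma started_vanishing:
  fixes \<psi> :: "real \<times> (real \<times> (real \<times> real)) \<Rightarrow> real"
  assumes \<psi>: "C1c \<psi>"
  shows "(\<lambda>n. LINT z|lborel. started n z * \<psi> ((1/2) ^ n, z)) \<longlonglongrightarrow> 0"
proof -
  obtain r where r: "0 < r" "\<And>x. x \<notin> cball 0 r \<Longrightarrow> \<psi> x = 0" using C1c_support[OF \<psi>] by metis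
  obtain L where L: "0 < L" "\<And>x v. \<bar>frechet_derivative \<psi> (at x) v\<bar> \<le> L * norm v"
    using C1c_deriv_bounded[OF \<psi>] by metis
  obtain P where P: "0 < P" "\<And>x. \<bar>\<psi> x\<bar> \<le> P" using C1c_bounded[OF \<psi>] by metis
  have \<psi>m[measurable]: "\<psi> \<in> borel_measurable borel" by (rule C1c_measurable[OF \<psi>])
  \<comment> \<open>The radius exceeds \<open>r\<close> by 1 to contain the support of the shifted
    function as well, since \<open>norm v \<le> 1\<close>.\<close>
  let ?K = "cball 0 (r + 1) :: (real \<times> (real \<times> real)) set"
  define vol where "vol = measure lborel ?K"
  have fin: "emeasure lborel ?K < \<infinity>" by (rule emeasure_lborel_cball_finite)
  have st1: "\<bar>started n z\<bar> \<le> 1" for n z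
    by (auto simp: started_def abs_mult abs_checkerboard split: split_indicator)
  have bound: "\<bar>LINT z|lborel. started n z * \<psi> ((1/2) ^ n, z)\<bar> \<le> L * vol * (1/2) ^ n" for n
  proof -
    define v where "v = (0 :: real, (1/2 :: real) ^ n *\<^sub>R flip_dir n)"
    have nv: "norm v = (1/2) ^ n" by (simp add: v_def flip_dir_def norm_Pair)
    have nv1: "norm v \<le> 1" unfolding nv by (simp add: power_le_one)
    have flip: "started n (z + v) = - started n z" for z
      by (simp add: started_def v_def checkerboard_flip)
    let ?f = "\<lambda>z. started n z * \<psi> ((1/2) ^ n, z)" and ?g = "\<lambda>z. started n z * \<psi> ((1/2) ^ n, z + v)"
    have \<psi>0: "\<psi> ((1/2) ^ n, z) = 0" if "r < norm z" for z
      using that norm_snd_le[of z "(1/2 :: real) ^ n"] by (intro r(2)) auto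
    have intf: "integrable lborel ?f"
    proof (rule integrable_bounded_support[where B = P and r = r])
      show "\<bar>?f z\<bar> \<le> P" for z
        using mult_mono[OF st1[of n z] P(2)[of "((1/2) ^ n, z)"]] by (simp add: abs_mult)
      show "?f z = 0" if "r < norm z" for z using \<psi>0[OF that] by simp
    qed measurable
    have intg: "integrable lborel ?g"
    proof (rule integrable_bounded_support[where B = P and r = "r + 1"])
      show "\<bar>?g z\<bar> \<le> P" for z
        using mult_mono[OF st1[of n z] P(2)[of "((1/2) ^ n, z + v)"]] by (simp add: abs_mult)
      show "?g z = 0" if "r + 1 < norm z" for z
        using that \<psi>0[of "z + v"] nv1 norm_triangle_ineq2[of z "- v"] by auto
    qed measurable
    have "(LINT z|lborel. ?f z) = (LINT z|lborel. ?f (z + v))"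
      by (rule lborel_integral_translation[symmetric]) measurable
    also have "\<dots> = - (LINT z|lborel. ?g z)" by (simp add: flip)
    finally have "2 * (LINT z|lborel. ?f z) = (LINT z|lborel. ?f z - ?g z)"
      using intf intg by simp
    moreover have "norm (LINT z|lborel. ?f z - ?g z) \<le> (LINT z|lborel. L * (1/2) ^ n * indicator ?K z)"
    proof (rule Bochner_Integration.integral_norm_bound_integral)
      show "integrable lborel (\<lambda>z. ?f z - ?g z)" using intf intg by simp
      show "integrable lborel (\<lambda>z. L * (1/2) ^ n * indicator ?K z)"
        using fin by (intro integrable_mult_right integrable_real_indicator) auto
      fix z
      have "\<bar>?f z - ?g z\<bar> \<le> L * (1/2) ^ n * indicator ?K z"
      proof (cases "z \<in> ?K")
        case True
        have "\<bar>\<psi> (((1/2) ^ n, z) + (0, v)) - \<psi> ((1/2) ^ n, z)\<bar> \<le> L * norm (0 :: real, v)"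
          by (rule C1c_lipschitz[OF \<psi> L(2)])
        then have le: "\<bar>\<psi> ((1/2) ^ n, z + v) - \<psi> ((1/2) ^ n, z)\<bar> \<le> L * (1/2) ^ n"
          by (simp add: norm_Pair nv)
        have "\<bar>?f z - ?g z\<bar> = \<bar>started n z\<bar> * \<bar>\<psi> ((1/2) ^ n, z + v) - \<psi> ((1/2) ^ n, z)\<bar>"
          by (simp add: abs_mult[symmetric] algebra_simps abs_minus_commute)
        also have "\<dots> \<le> 1 * (L * (1/2) ^ n)" by (intro mult_mono st1 le) auto
        finally show ?thesis using True by simp
      next
        case False
        then have "\<psi> ((1/2) ^ n, z) = 0" "\<psi> ((1/2) ^ n, z + v) = 0"
          using \<psi>0[of z] \<psi>0[of "z + v"] nv1 norm_triangle_ineq2[of z "- v"] by auto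
        then show ?thesis using False by simp
      qed
      then show "norm (?f z - ?g z) \<le> L * (1/2) ^ n * indicator ?K z" by simp
    qed
    moreover have "(LINT z|lborel. L * (1/2) ^ n * indicator ?K z) = L * (1/2) ^ n * vol"
      by (simp add: vol_def)
    ultimately have "\<bar>2 * (LINT z|lborel. ?f z)\<bar> \<le> L * vol * (1/2) ^ n"
      by (simp only: real_norm_def mult_ac)
    then show ?thesis unfolding abs_mult by simp
  qed
  have "(\<lambda>n. L * vol * (1/2 :: real) ^ n) \<longlonglongrightarrow> L * vol * 0"
    by (intro tendsto_intros LIMSEQ_power_zero) auto
  then have "(\<lambda>n. L * vol * (1/2 :: real) ^ n) \<longlonglongrightarrow> 0" by (simp only: mult_zero_right)
  moreover have "\<forall>n. norm (LINT z|lborel. started n z * \<psi> ((1/2) ^ n, z)) \<le> L * vol * (1/2) ^ n"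
    unfolding real_norm_def using bound by blast
  ultimately show ?thesis by (rule Lim_null_comparison[OF always_eventually, rotated])
qed

text \<open>Each slab contributes the difference of its two face integrals, and the sum telescopes.
  \<open>\<psi>\<close> may be nonzero at \<open>s = 0\<close> and at \<open>t = 0\<close>, so
  besides the equation this expresses that the solution has zero boundary trace and zero initial
  datum.\<close>

lemma mix_sol_weak:
  assumes \<psi>: "C1c \<psi>" and late: "\<And>s t y. 1 \<le> t \<Longrightarrow> \<psi> (s, (t, y)) = 0"
  shows "(LINT z|lborel. mix_sol z * frechet_derivative \<psi> (at z) (1, (1, mix_field (fst z) (snd (snd z))))) = 0"
proof -
  define F where "F z = mix_sol z * frechet_derivative \<psi> (at z) (1, (1, mix_field (fst z) (snd (snd z))))" for z
  obtain r where r: "0 < r" "\<And>x v. x \<notin> cball 0 r \<Longrightarrow> frechet_derivative \<psi> (at x) v = 0"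
    using C1c_support[OF \<psi>] by metis
  obtain L where L: "0 < L" "\<And>x v. \<bar>frechet_derivative \<psi> (at x) v\<bar> \<le> L * norm v"
    using C1c_deriv_bounded[OF \<psi>] by metis
  have "(\<lambda>z :: real \<times> (real \<times> (real \<times> real)). (fst z, snd (snd z))) \<in> borel \<rightarrow>\<^sub>M borel" by measurable
  from measurable_compose[OF this mix_field_measurable]
  have mf: "(\<lambda>z :: real \<times> (real \<times> (real \<times> real)). mix_field (fst z) (snd (snd z))) \<in> borel_measurable borel"
    by simp
  have Fm[measurable]: "F \<in> borel_measurable borel"
    unfolding F_def using mf by (intro borel_measurable_times C1c_deriv_measurable[OF \<psi>]) auto
  have Fb: "\<bar>F z\<bar> \<le> 3 * L" for z
  proof -
    let ?v = "(1 :: real, (1 :: real, mix_field (fst z) (snd (snd z))))"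
    have "norm ?v \<le> norm (1::real) + (norm (1::real) + norm (mix_field (fst z) (snd (snd z))))"
      by (intro order_trans[OF norm_Pair_le] add_left_mono) (simp add: norm_Pair_le)
    also have "\<dots> \<le> 3" using norm_mix_field_le[of "fst z" "snd (snd z)"] by simp
    finally have "L * norm ?v \<le> L * 3" using L(1) by (intro mult_left_mono) auto
    with L(2)[of z ?v] have "\<bar>frechet_derivative \<psi> (at z) ?v\<bar> \<le> 3 * L" by linarith
    then show ?thesis unfolding F_def abs_mult using mult_mono[OF abs_mix_sol_le[of z]] by fastforce
  qed
  have F0: "F z = 0" if "r < norm z" for z using that r(2)[of z] by (simp add: F_def)
  have intF: "integrable lborel F" by (rule integrable_bounded_support[OF Fm Fb F0])
  have slab: "(LINT z|lborel. indicator {(1/2) ^ Suc n<..(1/2) ^ n} (fst z) * F z)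
      = (LINT z|lborel. started n z * \<psi> ((1/2) ^ n, z)) - (LINT z|lborel. started (Suc n) z * \<psi> ((1/2) ^ Suc n, z))"
    for n
  proof -
    have st1: "\<bar>started (Suc n) z\<bar> \<le> 1" for z
      by (auto simp: started_def abs_mult abs_checkerboard split: split_indicator)
    have le: "(1/2 :: real) ^ Suc n \<le> (1/2) ^ n" "(1/2 :: real) ^ n \<le> 1" "(0::real) < (1/2) ^ Suc n"
      by (auto intro: power_decreasing power_le_one)
    have "indicator {(1/2) ^ Suc n<..(1/2) ^ n} (fst z) * F z
        = indicator {(1/2) ^ Suc n<..(1/2) ^ n} (fst z)
          * started (Suc n) (snd z - (fst z - (1/2) ^ Suc n) *\<^sub>R st_shear n (snd z))
          * frechet_derivative \<psi> (at z) (1, st_shear n (snd z))" for z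
    proof (cases "fst z \<in> {(1/2) ^ Suc n<..(1/2) ^ n}")
      case True
      then have "level (fst z) = n" "0 < fst z" "fst z \<le> 1" using level_eq[of n "fst z"] le by auto
      then show ?thesis using True by (simp add: F_def mix_sol_def mix_field_def st_shear_def)
    qed simp
    then show ?thesis
      using transport_slab[OF \<psi> shear_field_st_shear started_measurable st1 le(1), of n]
      by (simp only: started_shear)
  qed
  have partial: "(LINT z|lborel. indicator {(1/2) ^ n<..1} (fst z) * F z)
      = (LINT z|lborel. started 0 z * \<psi> (1, z)) - (LINT z|lborel. started n z * \<psi> ((1/2) ^ n, z))" for n
  proof (induction n)
    case (Suc n)
    have int: "integrable lborel (\<lambda>z. indicator {a<..b} (fst z) * F z)" for a b :: real
      using integrable_bounded_support[of "\<lambda>z. indicator {a<..b} (fst z) * F z" "3 * L" r] Fb F0 L(1)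
      by (auto split: split_indicator)
    have le: "(1/2 :: real) ^ Suc n \<le> (1/2) ^ n" "(1/2 :: real) ^ n \<le> 1"
      by (auto intro: power_decreasing power_le_one)
    have ind: "indicator {a<..1} x = (indicator {a<..b} x + indicator {b<..1} x :: real)"
      if "a \<le> b" "b \<le> 1" for a b x :: real
      using that by (auto split: split_indicator)
    have "(LINT z|lborel. indicator {(1/2) ^ Suc n<..1} (fst z) * F z)
        = (LINT z|lborel. indicator {(1/2) ^ Suc n<..(1/2) ^ n} (fst z) * F z + indicator {(1/2) ^ n<..1} (fst z) * F z)"
      by (simp only: ind[OF le] distrib_right)
    also have "\<dots> = (LINT z|lborel. indicator {(1/2) ^ Suc n<..(1/2) ^ n} (fst z) * F z)
        + (LINT z|lborel. indicator {(1/2) ^ n<..1} (fst z) * F z)"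
      by (intro Bochner_Integration.integral_add int)
    finally show ?case unfolding slab Suc by simp
  qed simp
  \<comment> \<open>The far face \<open>s = 1\<close> contributes nothing: there the cut-off demands
    \<open>t > 1\<close>, where \<open>\<psi>\<close> vanishes.\<close>
  have "started 0 z * \<psi> (1, z) = 0" for z
    using late[of "fst z" 1 "snd z"] by (auto simp: started_def split: split_indicator)
  then have "(LINT z|lborel. started 0 z * \<psi> (1, z)) = 0" by (simp only: integral_zero)
  then have 1: "(\<lambda>n. LINT z|lborel. indicator {(1/2) ^ n<..1} (fst z) * F z) \<longlonglongrightarrow> 0 - 0"
    unfolding partial by (intro tendsto_diff started_vanishing[OF \<psi>]) (simp only: tendsto_const)
  \<comment> \<open>The slabs exhaust \<open>0 < s \<le> 1\<close>, outside of which
    \<open>mix_sol\<close> is zero by definition; the integrable function \<open>F\<close> itself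
    dominates.\<close>
  have 2: "(\<lambda>n. LINT z|lborel. indicator {(1/2) ^ n<..1} (fst z) * F z) \<longlonglongrightarrow> (LINT z|lborel. F z)"
  proof (rule integral_dominated_convergence[where w = "\<lambda>z. \<bar>F z\<bar>"])
    show "AE z in lborel. (\<lambda>n. indicator {(1/2) ^ n<..1} (fst z) * F z) \<longlonglongrightarrow> F z"
    proof (rule AE_I2)
      fix z
      show "(\<lambda>n. indicator {(1/2) ^ n<..1} (fst z) * F z) \<longlonglongrightarrow> F z"
      proof (cases "0 < fst z \<and> fst z \<le> 1")
        case True
        then have "eventually (\<lambda>n. (1/2) ^ n < fst z) sequentially"
          by (intro order_tendstoD(2)[OF LIMSEQ_power_zero]) auto
        then have "eventually (\<lambda>n. indicator {(1/2) ^ n<..1} (fst z) * F z = F z) sequentially"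
          by eventually_elim (use True in simp)
        then show ?thesis by (rule tendsto_eventually)
      qed (auto simp: F_def mix_sol_def)
    qed
  qed (use intF in \<open>auto split: split_indicator\<close>)
  show ?thesis using LIMSEQ_unique[OF 2 1] by (simp add: F_def)
qed

section \<open>Bounded variation\<close>

lemma prod_Basis_r3: "(\<Prod>b\<in>Basis. f b) = (\<Prod>i\<in>UNIV. f (axis i 1 :: r3))" for f :: "r3 \<Rightarrow> real"
proof -
  have eq: "(Basis :: r3 set) = (\<lambda>i. axis i 1) ` UNIV" by (auto simp: Basis_vec_def)
  show ?thesis unfolding eq by (subst prod.reindex) (auto simp: inj_on_def axis_eq_axis)
qed

lemma emeasure_slice:
  fixes j :: 3
  assumes "0 \<le> h" "0 \<le> R"
  shows "emeasure lborel (cbox (\<chi> k. if k = j then z else - R) (\<chi> k. if k = j then z + h else R) :: r3 set)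
    = ennreal (h * (2 * R)\<^sup>2)" (is "emeasure lborel (cbox ?l ?u) = _")
proof -
  have "emeasure lborel (cbox ?l ?u) = (\<Prod>b\<in>Basis. (?u - ?l) \<bullet> b)"
    using assms by (subst emeasure_lborel_cbox) (auto simp: Basis_vec_def inner_axis)
  also have "(\<Prod>b\<in>Basis. (?u - ?l) \<bullet> b) = (\<Prod>i\<in>UNIV. if i = j then h else 2 * R)"
    unfolding prod_Basis_r3 by (intro prod.cong) (auto simp: inner_axis)
  also have "\<dots> = h * (\<Prod>i\<in>UNIV - {j}. if i = j then h else 2 * R)"
    by (subst prod.remove[of UNIV j]) auto
  also have "(\<Prod>i\<in>UNIV - {j}. if i = j then h else 2 * R) = (\<Prod>i\<in>UNIV - {j}. 2 * R)"
    by (intro prod.cong) auto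
  also have "\<dots> = (2 * R)\<^sup>2"
    unfolding prod_constant by (simp add: card_Diff_singleton)
  finally show ?thesis .
qed

text \<open>For a step \<open>h\<close>, the function \<open>g\<close> changes only at points within
  \<open>h\<close> above one of the planes \<open>x $ j = z\<close>. Inside the cube of half-side
  \<open>R\<close> each such layer has volume \<open>h * (2 * R)\<^sup>2\<close>, and the change is
  at most \<open>2 * G\<close>. Summing over \<open>Z\<close> gives a bound linear in
  \<open>h\<close>.\<close>

lemma deriv_integral_bound:
  fixes g :: "r3 \<Rightarrow> real"
  assumes f: "C1c f" and f1: "\<And>x. \<bar>f x\<bar> \<le> 1" and f0: "\<And>x. x \<notin> U \<Longrightarrow> f x = 0"
    and g[measurable]: "g \<in> borel_measurable borel" and G: "\<And>x. \<bar>g x\<bar> \<le> G"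
    and U: "\<And>x k. x \<in> U \<Longrightarrow> \<bar>x $ k\<bar> \<le> R" and "0 \<le> R"
    and Z: "finite Z" and h0: "0 < h0"
    and jump: "\<And>x h. x \<in> U \<Longrightarrow> 0 < h \<Longrightarrow> h < h0 \<Longrightarrow> g (x - h *\<^sub>R axis j 1) \<noteq> g x
      \<Longrightarrow> \<exists>z\<in>Z. x $ j - h \<le> z \<and> z \<le> x $ j"
  shows "\<bar>LINT x|lborel. g x * frechet_derivative f (at x) (axis j 1)\<bar> \<le> 2 * G * real (card Z) * (2 * R)\<^sup>2"
proof (rule integral_deriv_le[OF f g G h0])
  fix h :: real assume h: "0 < h" "h < h0"
  define S where "S z = (cbox (\<chi> k. if k = j then z else - R) (\<chi> k. if k = j then z + h else R) :: r3 set)" for z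
  have emS: "emeasure lborel (S z) = ennreal (h * (2 * R)\<^sup>2)" for z
    unfolding S_def using h \<open>0 \<le> R\<close> by (intro emeasure_slice) auto
  then have S: "measure lborel (S z) = h * (2 * R)\<^sup>2" for z
    using h by (simp add: measure_def)
  have G0: "0 \<le> G" using G[of 0] by simp
  have [measurable]: "f \<in> borel_measurable borel" by (rule C1c_measurable[OF f])
  have intS: "integrable lborel (\<lambda>x. 2 * G * (\<Sum>z\<in>Z. indicator (S z) x))"
    by (intro integrable_mult_right Bochner_Integration.integrable_sum integrable_real_indicator)
       (auto simp: emS, auto simp: S_def)
  have le: "\<bar>(g (x - h *\<^sub>R axis j 1) - g x) * f x\<bar> \<le> 2 * G * (\<Sum>z\<in>Z. indicator (S z) x)" for x
  proof (cases "x \<in> U \<and> g (x - h *\<^sub>R axis j 1) \<noteq> g x")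
    case True
    then obtain z where z: "z \<in> Z" "x $ j - h \<le> z" "z \<le> x $ j" using jump h by blast
    have "x \<in> S z"
      using z U True by (auto simp: S_def mem_box_cart abs_le_iff minus_le_iff)
    then have "(1::real) \<le> (\<Sum>z\<in>Z. indicator (S z) x)"
      using member_le_sum[of z Z "\<lambda>z. indicator (S z) x :: real"] z Z by auto
    moreover have "\<bar>g (x - h *\<^sub>R axis j 1) - g x\<bar> \<le> 2 * G"
      using G[of "x - h *\<^sub>R axis j 1"] G[of x] by linarith
    ultimately have "\<bar>g (x - h *\<^sub>R axis j 1) - g x\<bar> * \<bar>f x\<bar> \<le> (2 * G) * 1"
      "(2 * G) * 1 \<le> 2 * G * (\<Sum>z\<in>Z. indicator (S z) x)"
      using f1[of x] G0 by (intro mult_mono; simp)+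
    then show ?thesis unfolding abs_mult by linarith
  next
    case False
    then have "(g (x - h *\<^sub>R axis j 1) - g x) * f x = 0" using f0[of x] by auto
    moreover have "0 \<le> 2 * G * (\<Sum>z\<in>Z. indicator (S z) x)" using G0 by (auto intro!: mult_nonneg_nonneg sum_nonneg)
    ultimately show ?thesis by (simp only: abs_zero)
  qed
  have "\<bar>LINT x|lborel. (g (x - h *\<^sub>R axis j 1) - g x) * f x\<bar>
      \<le> (LINT x|lborel. 2 * G * (\<Sum>z\<in>Z. indicator (S z) x))"
  proof (rule integral_abs_bound_integral[OF _ intS le])
    show "integrable lborel (\<lambda>x. (g (x - h *\<^sub>R axis j 1) - g x) * f x)"
      by (rule Bochner_Integration.integrable_bound[OF intS]) (use le in \<open>auto intro!: AE_I2 order_trans[OF _ abs_ge_self]\<close>)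
  qed
  also have "\<dots> = 2 * G * (\<Sum>z\<in>Z. h * (2 * R)\<^sup>2)"
  proof -
    have "(LINT x|lborel. (\<Sum>z\<in>Z. indicator (S z) x)) = (\<Sum>z\<in>Z. LINT x|lborel. indicator (S z) x :: real)"
      by (intro Bochner_Integration.integral_sum integrable_real_indicator)
         (auto simp: emS, auto simp: S_def)
    also have "\<dots> = (\<Sum>z\<in>Z. h * (2 * R)\<^sup>2)"
      by (intro sum.cong) (auto simp: S)
    finally show ?thesis by simp
  qed
  finally show "\<bar>LINT x|lborel. (g (x - h *\<^sub>R axis j 1) - g x) * f x\<bar> \<le> 2 * G * real (card Z) * (2 * R)\<^sup>2 * h"
    by (simp add: mult_ac)
qed

section \<open>The vector field and the location of its jumps\<close>

definition vfield :: "real \<Rightarrow> r3 \<Rightarrow> r3" where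
  "vfield c x = vec3 c (mix_field (x $ 1 / c) (x $ 2, x $ 3))"

lemma vfield_measurable [measurable]: "vfield c \<in> borel_measurable borel"
proof -
  have "(\<lambda>x :: r3. (x $ 1 / c, (x $ 2, x $ 3))) \<in> borel_measurable borel"
    by (intro borel_measurable_Pair' borel_measurable_divide borel_measurable_const borel_measurable_vec_component)
  from measurable_compose[OF this mix_field_measurable]
  have "(\<lambda>x :: r3. mix_field (x $ 1 / c) (x $ 2, x $ 3)) \<in> borel_measurable borel" by simp
  then show ?thesis unfolding vfield_def by (intro measurable_vec3) auto
qed

lemma norm_vfield_le: "norm (vfield c x) \<le> \<bar>c\<bar> + 2"
proof -
  obtain p q where pq: "mix_field (x $ 1 / c) (x $ 2, x $ 3) = (p, q)" by (rule prod.exhaust)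
  have "\<bar>p\<bar> \<le> 1" "\<bar>q\<bar> \<le> 1"
    using norm_mix_field_le[of "x $ 1 / c" "(x $ 2, x $ 3)"] norm_fst_le[of p q] norm_snd_le[of q p]
    unfolding pq real_norm_def by linarith+
  moreover have "norm (vfield c x) \<le> (\<Sum>i\<in>UNIV. \<bar>vfield c x $ i\<bar>)" by (rule norm_le_l1_cart)
  moreover have "(\<Sum>i\<in>UNIV. \<bar>vfield c x $ i\<bar>) = \<bar>c\<bar> + \<bar>p\<bar> + \<bar>q\<bar>" by (simp only: sum_3 vfield_def pq vec3_nth fst_conv snd_conv)
  ultimately show ?thesis by linarith
qed

text \<open>Within one slab the field does not depend on \<open>s\<close>, so a change means that a
  dyadic face has been crossed. The face \<open>n = 0\<close> accounts for the jump to zero beyond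
  \<open>s = 1\<close>.\<close>

lemma mix_field_jump_time:
  assumes "0 < s'" "s' < s" "mix_field s' y \<noteq> mix_field s y"
  shows "\<exists>n. s' \<le> (1/2) ^ n \<and> (1/2) ^ n \<le> s"
proof (rule ccontr)
  assume "\<not> ?thesis"
  then have no: "(1/2) ^ n < s' \<or> s < (1/2) ^ n" for n by (metis not_le)
  show False
  proof (cases "s' \<le> 1")
    case True
    have "(1/2) ^ Suc (level s') < s'" "s' \<le> (1/2) ^ level s'" using level_bounds[of s'] assms True by auto
    moreover from this have "s < (1/2) ^ level s'" using no[of "level s'"] by linarith
    ultimately have "level s = level s'" using assms by (intro level_eq) auto
    moreover have "s \<le> 1" using no[of 0] True by auto
    ultimately show False using assms True by (auto simp: mix_field_def)
  next
    case False
    with assms show False by (auto simp: mix_field_def)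
  qed
qed

text \<open>Jumps occur at multiples of \<open>(1/2) ^ n\<close>, which lie on every finer dyadic
  grid. Stating the result for a common \<open>K\<close> puts the jumps of all slabs that matter on
  one grid.\<close>

lemma square_wave_jump:
  assumes "square_wave n x' \<noteq> square_wave n x" "x' < x" "n \<le> K"
  shows "\<exists>m :: int. x' \<le> m / 2 ^ K \<and> m / 2 ^ K \<le> x"
proof -
  have "\<lfloor>2 ^ n * x'\<rfloor> \<noteq> \<lfloor>2 ^ n * x\<rfloor>" using assms(1) by (auto simp: square_wave_def)
  moreover have "\<lfloor>2 ^ n * x'\<rfloor> \<le> \<lfloor>2 ^ n * x\<rfloor>" using assms(2) by (intro floor_mono) auto
  ultimately have lt: "\<lfloor>2 ^ n * x'\<rfloor> < \<lfloor>2 ^ n * x\<rfloor>" by simp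
  define m where "m = \<lfloor>2 ^ n * x\<rfloor>"
  have "2 ^ n * x' \<le> m" "m \<le> 2 ^ n * x" using lt by (auto simp: m_def floor_less_iff intro: less_imp_le)
  then have m: "x' \<le> m / 2 ^ n" "m / 2 ^ n \<le> x" by (auto simp: field_simps)
  have "(2 :: real) ^ K = 2 ^ (K - n) * 2 ^ n" using \<open>n \<le> K\<close> by (simp add: power_add[symmetric])
  then have eq: "real_of_int (m * 2 ^ (K - n)) / 2 ^ K = m / 2 ^ n" by simp
  show ?thesis by (intro exI[of _ "m * 2 ^ (K - n)"]) (simp only: eq m simp_thms)
qed

lemma speed_jump:
  assumes "speed n x' \<noteq> speed n x" "x' < x" "n + 2 \<le> K"
  shows "\<exists>m :: int. x' \<le> m / 2 ^ K \<and> m / 2 ^ K \<le> x"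
proof -
  have "square_wave n x' \<noteq> square_wave n x \<or> square_wave (n + 2) x' \<noteq> square_wave (n + 2) x"
    using assms(1) by (auto simp: speed_def split: if_splits)
  then show ?thesis
  proof
    assume "square_wave n x' \<noteq> square_wave n x"
    then show ?thesis using assms by (intro square_wave_jump[of n]) auto
  next
    assume "square_wave (n + 2) x' \<noteq> square_wave (n + 2) x"
    then show ?thesis using assms by (intro square_wave_jump[of "n + 2"]) auto
  qed
qed

lemma vfield_jumps:
  assumes c: "0 < c" and \<delta>: "0 < \<delta>" and R: "0 \<le> R"
  obtains Z h0 where "finite Z" "0 < h0"
    "\<And>x h j. \<delta> \<le> x $ 1 \<Longrightarrow> (\<And>k. \<bar>x $ k\<bar> \<le> R) \<Longrightarrow> 0 < h \<Longrightarrow> h < h0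
      \<Longrightarrow> vfield c (x - h *\<^sub>R axis j 1) \<noteq> vfield c x \<Longrightarrow> \<exists>z\<in>Z. x $ j - h \<le> z \<and> z \<le> x $ j"
proof -
  \<comment> \<open>With \<open>h < \<delta> / 2\<close> both points compared stay at
    \<open>x $ 1 \<ge> \<delta> / 2\<close>. Only faces and levels of index below \<open>K\<close>
    can occur there.\<close>
  obtain K where K: "(1/2 :: real) ^ K < \<delta> / 2 / c"
    using real_arch_pow_inv[of "\<delta> / 2 / c" "1/2"] c \<delta> by auto
  have Kn: "n < K" if "\<delta> / 2 / c \<le> (1/2) ^ n" for n
  proof (rule ccontr)
    assume "\<not> n < K"
    then have "(1/2 :: real) ^ n \<le> (1/2) ^ K" by (intro power_decreasing) auto
    with K that show False by linarith
  qed
  \<comment> \<open>The exponent is \<open>K + 2\<close> because the speed at level \<open>n\<close>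
    involves the square wave of index \<open>n + 2\<close>. The summand 1 in \<open>R + 1\<close>
    absorbs the step \<open>h < 1\<close>, so \<open>N\<close> bounds the numerators of all grid
    points that may be crossed.\<close>
  define N where "N = \<lceil>(R + 1) * 2 ^ (K + 2)\<rceil>"
  define Z where "Z = (\<lambda>n. c * (1/2) ^ n) ` {..<K} \<union> (\<lambda>m. real_of_int m / 2 ^ (K + 2)) ` {- N..N}"
  show ?thesis
  proof (rule that[of Z "min 1 (\<delta> / 2)"])
    show "finite Z" by (simp add: Z_def)
    show "0 < min 1 (\<delta> / 2)" using \<delta> by simp
    fix x :: r3 and h :: real and j :: 3
    assume x: "\<delta> \<le> x $ 1" "\<And>k. \<bar>x $ k\<bar> \<le> R" and h: "0 < h" "h < min 1 (\<delta> / 2)"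
      and ne: "vfield c (x - h *\<^sub>R axis j 1) \<noteq> vfield c x"
    have lev: "level (x $ 1 / c) + 2 \<le> K + 2" if "x $ 1 / c \<le> 1"
    proof -
      have "x $ 1 / c \<le> (1/2) ^ level (x $ 1 / c)" using level_bounds(2) that x \<delta> c by simp
      moreover have "\<delta> / 2 / c \<le> x $ 1 / c" using x \<delta> c by (intro divide_right_mono) auto
      ultimately show ?thesis using Kn[of "level (x $ 1 / c)"] by linarith
    qed
    have space: "\<exists>z\<in>Z. x $ j - h \<le> z \<and> z \<le> x $ j"
      if "\<exists>m :: int. x $ j - h \<le> m / 2 ^ (K + 2) \<and> m / 2 ^ (K + 2) \<le> x $ j"
    proof -
      from that obtain m :: int where m: "x $ j - h \<le> m / 2 ^ (K + 2)" "m / 2 ^ (K + 2) \<le> x $ j" by blast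
      have "\<bar>real_of_int m / 2 ^ (K + 2)\<bar> \<le> R + 1" using m x(2)[of j] h by auto
      then have "\<bar>real_of_int m\<bar> \<le> (R + 1) * 2 ^ (K + 2)" by (simp add: abs_divide field_simps)
      then have "\<bar>m\<bar> \<le> N" unfolding N_def by linarith
      then have "m \<in> {- N..N}" by auto
      with m show ?thesis unfolding Z_def by blast
    qed
    consider "j = 1" | "j = 2" | "j = 3" using exhaust_3[of j] by blast
    then show "\<exists>z\<in>Z. x $ j - h \<le> z \<and> z \<le> x $ j"
    proof cases
      case 1
      have "mix_field ((x $ 1 - h) / c) (x $ 2, x $ 3) \<noteq> mix_field (x $ 1 / c) (x $ 2, x $ 3)"
        using ne 1 by (auto simp: vfield_def axis_def)
      moreover have le: "\<delta> / 2 / c \<le> (x $ 1 - h) / c" using x h c by (intro divide_right_mono) auto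
      then have "0 < (x $ 1 - h) / c" using c \<delta> by (intro less_le_trans[OF _ le]) auto
      moreover have "(x $ 1 - h) / c < x $ 1 / c" using h c by (intro divide_strict_right_mono) auto
      ultimately obtain n where n: "(x $ 1 - h) / c \<le> (1/2) ^ n" "(1/2) ^ n \<le> x $ 1 / c"
        using mix_field_jump_time by blast
      have "n < K" using n le by (intro Kn) linarith
      then have "c * (1/2) ^ n \<in> Z" by (auto simp: Z_def)
      moreover have "x $ 1 - h \<le> c * (1/2) ^ n" "c * (1/2) ^ n \<le> x $ 1"
        using n c by (auto simp: divide_le_eq le_divide_eq mult.commute)
      ultimately show ?thesis using 1 by blast
    next
      case 2
      have "mix_field (x $ 1 / c) (x $ 2 - h, x $ 3) \<noteq> mix_field (x $ 1 / c) (x $ 2, x $ 3)"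
        using ne 2 by (auto simp: vfield_def axis_def)
      then have "x $ 1 / c \<le> 1" "speed (level (x $ 1 / c)) (x $ 2 - h) \<noteq> speed (level (x $ 1 / c)) (x $ 2)"
        by (auto simp: mix_field_def shear_def split: if_splits)
      then have "\<exists>m :: int. x $ 2 - h \<le> m / 2 ^ (K + 2) \<and> m / 2 ^ (K + 2) \<le> x $ 2"
        using h lev by (intro speed_jump) auto
      then show ?thesis using 2 by (intro space) (simp only:)
    next
      case 3
      have "mix_field (x $ 1 / c) (x $ 2, x $ 3 - h) \<noteq> mix_field (x $ 1 / c) (x $ 2, x $ 3)"
        using ne 3 by (auto simp: vfield_def axis_def)
      then have "x $ 1 / c \<le> 1" "speed (level (x $ 1 / c)) (x $ 3 - h) \<noteq> speed (level (x $ 1 / c)) (x $ 3)"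
        by (auto simp: mix_field_def shear_def split: if_splits)
      then have "\<exists>m :: int. x $ 3 - h \<le> m / 2 ^ (K + 2) \<and> m / 2 ^ (K + 2) \<le> x $ 3"
        using h lev by (intro speed_jump) auto
      then show ?thesis using 3 by (intro space) (simp only:)
    qed
  qed
qed

lemma lebesgue_on_integral:
  fixes f :: "'a::euclidean_space \<Rightarrow> real"
  assumes [measurable]: "S \<in> sets borel" "f \<in> borel_measurable borel"
  shows "(LINT x|lebesgue_on S. f x) = (LINT x|lborel. indicator S x * f x)"
proof -
  have "(LINT x|lebesgue_on S. f x) = (LINT x|lebesgue. indicator S x *\<^sub>R f x)"
    by (rule integral_restrict_space) simp
  also have "\<dots> = (LINT x|lborel. indicator S x *\<^sub>R f x)"
    by (rule integral_completion) simp
  finally show ?thesis by simp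
qed

lemma borel_measurable_lebesgue_on_borel:
  "f \<in> borel_measurable borel \<Longrightarrow> f \<in> borel_measurable (lebesgue_on S)"
  by (intro measurable_restrict_space1 measurable_completion) simp

lemma C1_matrix_component:
  fixes \<psi> :: "r3 \<Rightarrow> real ^ 3 ^ 3"
  assumes \<psi>: "Ck 1 \<psi>" and c: "compact_support_in U \<psi>"
  shows "C1c (\<lambda>x. \<psi> x $ i $ j)"
    and "frechet_derivative (\<lambda>x. \<psi> x $ i $ j) (at x) v = frechet_derivative \<psi> (at x) v $ i $ j"
proof -
  have d: "(\<psi> has_derivative frechet_derivative \<psi> (at x)) (at x)" for x
    using \<psi> by (simp add: frechet_derivative_works)
  have "bounded_linear (\<lambda>M :: real ^ 3 ^ 3. M $ i $ j)"
    by (intro bounded_linear_compose[OF bounded_linear_vec_nth bounded_linear_vec_nth])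
  then have D: "((\<lambda>x. \<psi> x $ i $ j) has_derivative (\<lambda>v. frechet_derivative \<psi> (at x) v $ i $ j)) (at x)" for x
    by (rule bounded_linear.has_derivative[OF _ d])
  then have eq: "frechet_derivative (\<lambda>x. \<psi> x $ i $ j) (at x) v = frechet_derivative \<psi> (at x) v $ i $ j" for x v
    by (metis frechet_derivative_at)
  then show "frechet_derivative (\<lambda>x. \<psi> x $ i $ j) (at x) v = frechet_derivative \<psi> (at x) v $ i $ j" .
  have "bounded (closure {x. \<psi> x \<noteq> 0})"
    using c by (simp add: compact_support_in_def compact_imp_bounded)
  then obtain r where r: "\<forall>x\<in>closure {x. \<psi> x \<noteq> 0}. norm x \<le> r"
    unfolding bounded_iff by blast
  have "\<psi> x = 0" if "r < norm x" for x
    using that r closure_subset[of "{x. \<psi> x \<noteq> 0}"] by force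
  then have "\<exists>r. \<forall>x. r < norm x \<longrightarrow> \<psi> x $ i $ j = 0" by (intro exI[of _ r]) simp
  moreover have "continuous_on UNIV (\<lambda>x. frechet_derivative \<psi> (at x) v $ i $ j)" for v
    using \<psi> by (auto intro!: continuous_intros)
  ultimately show "C1c (\<lambda>x. \<psi> x $ i $ j)"
    using D unfolding C1c_def eq by (auto simp: differentiable_def)
qed

text \<open>The pairing with the row divergence splits into nine scalar integrals, each bounded
  through the finite set of jump planes. The bound \<open>M\<close> depends on \<open>U\<close> and
  \<open>c\<close> but not on the test field.\<close>

lemma total_variation_vfield:
  assumes c: "0 < c" and U: "open U" "bounded U" "closure U \<subseteq> half_space"
  shows "total_variation U (vfield c) < \<infinity>"
proof -
  obtain R where R: "0 \<le> R" "\<And>x. x \<in> U \<Longrightarrow> norm x \<le> R"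
    using U(2) by (metis bounded_pos less_imp_le)
  have Rk: "\<bar>x $ k\<bar> \<le> R" if "x \<in> U" for x k
    using R(2)[OF that] component_le_norm_cart[of x k] by linarith
  \<comment> \<open>The first coordinate attains its infimum on the compact closure of
    \<open>U\<close>, and this minimum is positive because the closure lies in the open
    half-space.\<close>
  obtain \<delta> where \<delta>: "0 < \<delta>" "\<And>x. x \<in> U \<Longrightarrow> \<delta> \<le> x $ 1"
  proof (cases "U = {}")
    case False
    have "compact (closure U)" "closure U \<noteq> {}" using U False by auto
    moreover have "continuous_on (closure U) (\<lambda>x. x $ 1)" by (intro continuous_intros)
    ultimately obtain x0 where x0: "x0 \<in> closure U" "\<And>x. x \<in> closure U \<Longrightarrow> x0 $ 1 \<le> x $ 1"
      using continuous_attains_inf[of "closure U" "\<lambda>x. x $ 1"] by blast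
    show ?thesis
      using x0 U(3) closure_subset[of U] by (intro that[of "x0 $ 1"]) (auto simp: half_space_def)
  qed (use that[of 1] in auto)
  obtain Z h0 where Z: "finite Z" "0 < h0"
    and jump: "\<And>x h j. \<delta> \<le> x $ 1 \<Longrightarrow> (\<And>k. \<bar>x $ k\<bar> \<le> R) \<Longrightarrow> 0 < h \<Longrightarrow> h < h0
      \<Longrightarrow> vfield c (x - h *\<^sub>R axis j 1) \<noteq> vfield c x \<Longrightarrow> \<exists>z\<in>Z. x $ j - h \<le> z \<and> z \<le> x $ j"
    using vfield_jumps[OF c \<delta>(1) R(1)] by metis
  have G: "\<bar>vfield c x $ i\<bar> \<le> \<bar>c\<bar> + 2" for x i
    using component_le_norm_cart[of "vfield c x" i] norm_vfield_le[of c x] by linarith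
  have vm[measurable]: "(\<lambda>x. vfield c x $ i) \<in> borel_measurable borel" for i
    by (rule measurable_compose[OF vfield_measurable borel_measurable_vec_component])
  define M where "M = 2 * (\<bar>c\<bar> + 2) * real (card Z) * (2 * R)\<^sup>2"
  have "total_variation U (vfield c) \<le> ennreal (\<Sum>i\<in>(UNIV :: 3 set). \<Sum>j\<in>(UNIV :: 3 set). M)"
    unfolding total_variation_def
  proof (rule SUP_least, clarify, rule ennreal_leI)
    fix \<psi> :: "r3 \<Rightarrow> real ^ 3 ^ 3"
    assume \<psi>: "Ck 1 \<psi>" and cs: "compact_support_in U \<psi>" and \<psi>1: "\<forall>x. norm (\<psi> x) \<le> 1"
    define f where "f i j x = \<psi> x $ i $ j" for i j x
    have f: "C1c (f i j)" and fd: "frechet_derivative (f i j) (at x) v = frechet_derivative \<psi> (at x) v $ i $ j" for i j x v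
      unfolding f_def by (rule C1_matrix_component[OF \<psi> cs])+
    have f1: "\<bar>f i j x\<bar> \<le> 1" for i j x
      unfolding f_def using component_le_norm_cart[of "\<psi> x $ i" j] Finite_Cartesian_Product.norm_nth_le[of "\<psi> x" i] \<psi>1[rule_format, of x]
      by linarith
    have f0: "f i j x = 0" if "x \<notin> closure {x. \<psi> x \<noteq> 0}" for i j x
    proof -
      have "\<psi> x = 0" using that closure_subset[of "{x. \<psi> x \<noteq> 0}"] by blast
      then show ?thesis by (simp add: f_def)
    qed
    have supp: "closure {x. \<psi> x \<noteq> 0} \<subseteq> U" using cs by (simp add: compact_support_in_def)
    have fU: "f i j x = 0" if "x \<notin> U" for i j x
      using that supp by (intro f0) blast
    have fdU: "frechet_derivative (f i j) (at x) v = 0" if "x \<notin> U" for i j x v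
      using that supp by (intro C1c_deriv_eq_0[OF f closed_closure f0]) auto
    have fdm[measurable]: "(\<lambda>x. frechet_derivative (f i j) (at x) v) \<in> borel_measurable borel" for i j v
      by (rule C1c_deriv_measurable[OF f]) auto
    have int: "integrable lborel (\<lambda>x. vfield c x $ i * frechet_derivative (f i j) (at x) (axis j 1))" for i j
    proof -
      obtain L where L: "0 < L" "\<And>x v. \<bar>frechet_derivative (f i j) (at x) v\<bar> \<le> L * norm v"
        using C1c_deriv_bounded[OF f[of i j]] by metis
      show ?thesis
      proof (rule integrable_bounded_support[where r = R and B = "(\<bar>c\<bar> + 2) * (L * 1)"])
        show "\<bar>vfield c x $ i * frechet_derivative (f i j) (at x) (axis j 1)\<bar> \<le> (\<bar>c\<bar> + 2) * (L * 1)" for x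
          unfolding abs_mult using L(2)[of x "axis j 1"] by (intro mult_mono G) (auto simp: norm_axis_1)
        show "vfield c x $ i * frechet_derivative (f i j) (at x) (axis j 1) = 0" if "R < norm x" for x
          using fdU[of x] R(2)[of x] that by auto
      qed measurable
    qed
    have [measurable]: "U \<in> sets borel" using U by simp
    have bd: "vfield c x \<bullet> row_div \<psi> x
        = (\<Sum>i\<in>UNIV. \<Sum>j\<in>UNIV. vfield c x $ i * frechet_derivative (f i j) (at x) (axis j 1))" for x
      by (simp add: inner_vec_def row_div_def fd sum_distrib_left)
    have "(LINT x|lebesgue_on U. vfield c x \<bullet> row_div \<psi> x)
        = (LINT x|lborel. indicator U x * (\<Sum>i\<in>UNIV. \<Sum>j\<in>UNIV. vfield c x $ i * frechet_derivative (f i j) (at x) (axis j 1)))"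
      unfolding bd by (rule lebesgue_on_integral) measurable
    also have "\<dots> = (LINT x|lborel. (\<Sum>i\<in>UNIV. \<Sum>j\<in>UNIV. vfield c x $ i * frechet_derivative (f i j) (at x) (axis j 1)))"
      by (intro Bochner_Integration.integral_cong) (auto simp: fdU split: split_indicator)
    also have "\<dots> = (\<Sum>i\<in>UNIV. \<Sum>j\<in>UNIV. LINT x|lborel. vfield c x $ i * frechet_derivative (f i j) (at x) (axis j 1))"
      by (simp add: int Bochner_Integration.integral_sum Bochner_Integration.integrable_sum)
    also have "\<dots> \<le> (\<Sum>i\<in>(UNIV :: 3 set). \<Sum>j\<in>(UNIV :: 3 set). M)"
    proof (intro sum_mono)
      fix i j :: 3
      have "\<bar>LINT x|lborel. vfield c x $ i * frechet_derivative (f i j) (at x) (axis j 1)\<bar> \<le> M"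
        unfolding M_def
      proof (rule deriv_integral_bound[OF f f1 fU vm G Rk R(1) Z])
        fix x h assume x: "x \<in> U" and h: "0 < h" "h < h0"
          and "vfield c (x - h *\<^sub>R axis j 1) $ i \<noteq> vfield c x $ i"
        then have "vfield c (x - h *\<^sub>R axis j 1) \<noteq> vfield c x" by metis
        then show "\<exists>z\<in>Z. x $ j - h \<le> z \<and> z \<le> x $ j"
          by (rule jump[OF \<delta>(2)[OF x] Rk[OF x] h])
      qed
      then show "(LINT x|lborel. vfield c x $ i * frechet_derivative (f i j) (at x) (axis j 1)) \<le> M" by simp
    qed
    finally show "(LINT x|lebesgue_on U. vfield c x \<bullet> row_div \<psi> x) \<le> (\<Sum>i\<in>(UNIV :: 3 set). \<Sum>j\<in>(UNIV :: 3 set). M)" .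
  qed
  also have "\<dots> < \<infinity>" by simp
  finally show ?thesis .
qed

lemma vfield_snd_measurable: "(\<lambda>z. vfield c (snd z)) \<in> borel_measurable borel"
  by (rule measurable_compose[OF borel_measurable_fst_snd(2) vfield_measurable])

lemma L1_BV_vfield:
  assumes c: "0 < c" and U: "open U" "bounded U" "closure U \<subseteq> half_space"
  shows "L1_BV U (\<lambda>z. vfield c (snd z))"
proof -
  have tv: "total_variation U (vfield c) < \<infinity>" by (rule total_variation_vfield[OF assms])
  have lm: "U \<in> lmeasurable" by (rule lmeasurable_open[OF U(2,1)])
  have "integrable (lebesgue_on U) (\<lambda>x. \<bar>c\<bar> + 2)"
    by (rule finite_measure.integrable_const[OF finite_measure_lebesgue_on[OF lm]])
  then have int: "integrable (lebesgue_on U) (vfield c)"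
    by (rule Bochner_Integration.integrable_bound)
       (simp_all add: borel_measurable_lebesgue_on_borel vfield_measurable norm_vfield_le)
  then have "(\<integral>\<^sup>+x. ennreal (norm (vfield c x)) \<partial>lebesgue_on U) < \<infinity>"
    by (simp add: integrable_iff_bounded)
  then have fin: "BV_norm U (vfield c) < \<infinity>"
    using tv by (simp add: BV_norm_def)
  have "emeasure (lebesgue_on {0..<1::real}) (space (lebesgue_on {0..<1::real})) = 1"
    by (simp add: emeasure_restrict_space space_restrict_space)
  then have "(\<integral>\<^sup>+t. BV_norm U (vfield c) \<partial>lebesgue_on {0..<1::real}) < \<infinity>"
    using fin by simp
  then show ?thesis
    using int tv by (auto simp: L1_BV_def BV_def intro!: borel_measurable_lebesgue_on_borel vfield_snd_measurable)
qed

section \<open>Coordinates adapted to the field\<close>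

lemma prod_Basis_prod:
  fixes f :: "'a::euclidean_space \<times> 'b::euclidean_space \<Rightarrow> real"
  shows "(\<Prod>i\<in>Basis. f i) = (\<Prod>i\<in>Basis. f (i, 0)) * (\<Prod>i\<in>Basis. f (0, i))"
proof -
  have "inj_on (\<lambda>u. (u :: 'a, 0 :: 'b)) Basis" "inj_on (\<lambda>u. (0 :: 'a, u :: 'b)) Basis"
    by (auto intro!: inj_onI)
  then show ?thesis
    unfolding Basis_prod_def by (subst prod.union_disjoint) (auto simp: Basis_prod_def prod.reindex)
qed

lemma prod_3: "(\<Prod>i\<in>UNIV. f i) = f 1 * f 2 * f 3" for f :: "3 \<Rightarrow> real"
  unfolding UNIV_3 by (simp add: ac_simps)

lemma mem_box_Pair: "(x, y) \<in> box (a, b) (c, d) \<longleftrightarrow> x \<in> box a c \<and> y \<in> box b d"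
  by (auto simp: mem_box Basis_prod_def ball_Un)

text \<open>The linear passage from \<open>(s, (t, y))\<close> to physical space-time. It maps the
  direction \<open>(1, (1, v))\<close> to \<open>(1, vec3 c v)\<close>, so derivatives along the
  mixing flow become the transport operator of the field.\<close>

definition flat :: "real \<Rightarrow> real \<times> (real \<times> (real \<times> real)) \<Rightarrow> real \<times> r3" where
  "flat c z = (fst (snd z), vec3 (c * fst z) (snd (snd z)))"

lemma flat_simp [simp]: "flat c (s, (t, y)) = (t, vec3 (c * s) y)"
  by (simp add: flat_def)

lemma flat_measurable [measurable]: "flat c \<in> borel_measurable borel"
  unfolding flat_def
  by (intro borel_measurable_Pair' measurable_vec3 borel_measurable_times borel_measurable_const
      borel_measurable_fst_snd measurable_compose[OF borel_measurable_fst_snd(2) borel_measurable_fst_snd(1)]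
      measurable_compose[OF borel_measurable_fst_snd(2) borel_measurable_fst_snd(2)])

lemma bounded_linear_flat: "bounded_linear (flat c)"
proof -
  have "linear (flat c)"
    by (rule linearI) (simp_all add: flat_def vec3_add vec3_scaleR algebra_simps)
  then show ?thesis by (rule linear_conv_bounded_linear[THEN iffD1])
qed

text \<open>The lower bound required by \<open>C1c_compose_linear\<close>. The coordinate
  \<open>s\<close> accounts for \<open>1 / c\<close>, and \<open>t\<close> and the two tangential
  coordinates for 1 each.\<close>

lemma norm_le_flat:
  assumes c: "0 < c"
  shows "norm z \<le> (1 / c + 3) * norm (flat c z)"
proof -
  obtain s t p q where z: "z = (s, (t, (p, q)))" by (metis prod.exhaust)
  let ?x = "vec3 (c * s) (p, q)"
  have x: "norm ?x \<le> norm (flat c z)" and t: "\<bar>t\<bar> \<le> norm (flat c z)"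
    using norm_snd_le[of ?x t] norm_fst_le[of t ?x] by (simp_all add: z)
  have "\<bar>c * s\<bar> \<le> norm ?x" "\<bar>p\<bar> \<le> norm ?x" "\<bar>q\<bar> \<le> norm ?x"
    using component_le_norm_cart[of ?x 1] component_le_norm_cart[of ?x 2] component_le_norm_cart[of ?x 3] by simp_all
  then have cs: "c * \<bar>s\<bar> \<le> norm (flat c z)" and pq: "\<bar>p\<bar> \<le> norm (flat c z)" "\<bar>q\<bar> \<le> norm (flat c z)"
    using x c by (auto simp: abs_mult)
  have "\<bar>s\<bar> \<le> 1 / c * norm (flat c z)" using cs c by (simp add: field_simps)
  moreover have "norm z \<le> norm s + (norm t + (norm p + norm q))"
    unfolding z by (intro order_trans[OF norm_Pair_le] add_left_mono) simp
  ultimately show ?thesis using t pq by (simp add: algebra_simps)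
qed

text \<open>\<open>flat\<close> only rearranges coordinates and rescales one of them by
  \<open>c\<close>, so preimages of boxes are boxes, and comparing volumes on boxes identifies the
  measures.\<close>

lemma flat_jacobian:
  assumes c: "0 < c"
  shows "lborel = density (distr lborel borel (flat c)) (\<lambda>_. ennreal c)"
proof (rule lborel_eqI)
  fix l u :: "real \<times> r3" assume le: "\<And>b. b \<in> Basis \<Longrightarrow> l \<bullet> b \<le> u \<bullet> b"
  obtain l0 l' u0 u' where lu: "l = (l0, l')" "u = (u0, u')" by (metis prod.exhaust)
  have le0: "l0 \<le> u0" using le[of "(1, 0)"] by (simp add: lu Basis_prod_def)
  have le': "l' $ i \<le> u' $ i" for i
    using le[of "(0, axis i 1)"] by (auto simp: lu Basis_prod_def inner_axis Basis_vec_def)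
  let ?L = "(l' $ 1 / c, (l0, (l' $ 2, l' $ 3)))" and ?U = "(u' $ 1 / c, (u0, (u' $ 2, u' $ 3)))"
  have vim: "flat c -` box l u = box ?L ?U"
  proof (rule set_eqI)
    fix z :: "real \<times> (real \<times> (real \<times> real))"
    obtain s t p q where z: "z = (s, (t, (p, q)))" by (metis prod.exhaust)
    show "z \<in> flat c -` box l u \<longleftrightarrow> z \<in> box ?L ?U"
      using c by (auto simp: z lu mem_box_Pair mem_box_cart forall_3 box_real field_simps)
  qed
  have d: "l' $ 1 / c \<le> u' $ 1 / c" using le' c by (simp add: divide_right_mono)
  have "emeasure lborel (box ?L ?U) = (\<Prod>b\<in>Basis. (?U - ?L) \<bullet> b)"
    using le0 le' d by (intro emeasure_lborel_box) (auto simp: Basis_prod_def)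
  also have "(\<Prod>b\<in>Basis. (?U - ?L) \<bullet> b) = (u' $ 1 / c - l' $ 1 / c) * ((u0 - l0) * ((u' $ 2 - l' $ 2) * (u' $ 3 - l' $ 3)))"
    by (simp add: prod_Basis_prod)
  finally have em: "emeasure lborel (box ?L ?U)
      = ennreal ((u' $ 1 / c - l' $ 1 / c) * ((u0 - l0) * ((u' $ 2 - l' $ 2) * (u' $ 3 - l' $ 3))))" .
  have pr: "(\<Prod>b\<in>Basis. (u - l) \<bullet> b) = (u0 - l0) * ((u' $ 1 - l' $ 1) * (u' $ 2 - l' $ 2) * (u' $ 3 - l' $ 3))"
    by (simp add: prod_Basis_prod lu prod_Basis_r3 inner_axis prod_3)
  have "emeasure (density (distr lborel borel (flat c)) (\<lambda>_. ennreal c)) (box l u)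
      = ennreal c * emeasure (distr lborel borel (flat c)) (box l u)"
    by (rule emeasure_density_const) simp
  also have "emeasure (distr lborel borel (flat c)) (box l u) = emeasure lborel (box ?L ?U)"
    by (subst emeasure_distr) (auto simp: vim)
  also have "ennreal c * emeasure lborel (box ?L ?U)
      = ennreal (c * ((u' $ 1 / c - l' $ 1 / c) * ((u0 - l0) * ((u' $ 2 - l' $ 2) * (u' $ 3 - l' $ 3)))))"
    unfolding em using c le0 le' d by (intro ennreal_mult[symmetric]) auto
  also have "c * ((u' $ 1 / c - l' $ 1 / c) * ((u0 - l0) * ((u' $ 2 - l' $ 2) * (u' $ 3 - l' $ 3))))
      = (\<Prod>b\<in>Basis. (u - l) \<bullet> b)"
    unfolding pr using c by (simp add: field_simps)
  finally show "emeasure (density (distr lborel borel (flat c)) (\<lambda>_. ennreal c)) (box l u) = (\<Prod>b\<in>Basis. (u - l) \<bullet> b)" .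
qed simp

lemma integral_flat:
  fixes f :: "real \<times> r3 \<Rightarrow> real"
  assumes c: "0 < c" and f[measurable]: "f \<in> borel_measurable borel"
  shows "(LINT z|lborel. f z) = c * (LINT z|lborel. f (flat c z))"
proof -
  have "(LINT z|lborel. f z) = (LINT z|distr lborel borel (flat c). c *\<^sub>R f z)"
    using c by (subst flat_jacobian[OF c]) (rule integral_density, auto)
  also have "\<dots> = (LINT z|lborel. c *\<^sub>R f (flat c z))"
    by (rule integral_distr) auto
  finally show ?thesis by simp
qed

lemma transport_eq_deriv:
  assumes "C1c \<phi>"
  shows "dt \<phi> z + v \<bullet> grad_x \<phi> z = frechet_derivative \<phi> (at z) (1, v)"
    and "v \<bullet> grad_x \<phi> z = (\<Sum>i\<in>UNIV. v $ i * frechet_derivative \<phi> (at z) (0, axis i 1))"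
proof -
  let ?D = "frechet_derivative \<phi> (at z)"
  have lin: "linear ?D" by (rule C1c_linear[OF assms])
  show sum: "v \<bullet> grad_x \<phi> z = (\<Sum>i\<in>UNIV. v $ i * ?D (0, axis i 1))"
    by (simp add: inner_vec_def grad_x_def)
  have "linear (\<lambda>x :: r3. (0 :: real, x))" by (rule linearI) auto
  from linear_compose[OF this lin] have lin': "linear (\<lambda>x. ?D (0, x))" by (simp add: comp_def)
  have "?D (0, v) = ?D (0, \<Sum>i\<in>UNIV. v $ i *\<^sub>R axis i 1)"
    by (simp only: basis_expansion[of v, unfolded scalar_mult_eq_scaleR])
  also have "\<dots> = (\<Sum>i\<in>UNIV. v $ i * ?D (0, axis i 1))"
    unfolding linear_sum[OF lin', unfolded comp_def] by (simp add: linear_scale[OF lin'])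
  finally have "?D (0, v) = v \<bullet> grad_x \<phi> z" by (simp add: sum)
  moreover have "?D (1, v) = ?D (1, 0) + ?D (0, v)"
    using linear_add[OF lin, of "(1, 0)" "(0, v)"] by simp
  ultimately show "dt \<phi> z + v \<bullet> grad_x \<phi> z = ?D (1, v)" by (simp add: dt_def)
qed

section \<open>The field and its trace\<close>

abbreviation (input) slab :: "(real \<times> r3) set" where
  "slab \<equiv> cylinder half_space"

lemma slab_iff: "(t, x) \<in> slab \<longleftrightarrow> 0 < t \<and> t < 1 \<and> 0 < x $ 1"
  by (simp add: cylinder_def half_space_def)

lemma open_half_space: "open half_space"
proof -
  have eq: "half_space = {x. axis 1 1 \<bullet> x > 0}" by (simp add: half_space_def inner_axis')
  show ?thesis unfolding eq by (rule open_halfspace_gt)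
qed

lemma open_slab: "open slab"
  unfolding cylinder_def by (intro open_Times open_half_space) simp

lemma slab_measurable [measurable]: "slab \<in> sets borel"
  using open_slab by simp

text \<open>No component depends on its own coordinate: the first is constant, and each shear moves
  one tangential coordinate at a speed determined by the other and by the slab. This makes the
  divergence vanish even across the jumps.\<close>

lemma vfield_invariant: "vfield c (x + \<tau> *\<^sub>R axis j 1) $ j = vfield c x $ j"
proof -
  consider "j = 1" | "j = 2" | "j = 3" using exhaust_3[of j] by blast
  then show ?thesis
    by cases (auto simp: vfield_def axis_def mix_field_def shear_def)
qed

text \<open>The tangential terms vanish because both the component and the indicator of
  \<open>slab\<close> are invariant along the respective axis. Only the normal derivative feels the
  boundary, so \<open>div_free_vfield\<close> and the normal trace reduce to the constant component
  \<open>c\<close>.\<close>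

lemma integral_field_grad:
  assumes \<phi>: "C1c \<phi>"
  shows "(LINT z|lborel. indicator slab z * (vfield c (snd z) \<bullet> grad_x \<phi> z))
       = c * (LINT z|lborel. indicator slab z * frechet_derivative \<phi> (at z) (0, axis 1 1))"
proof -
  let ?D = "\<lambda>z. frechet_derivative \<phi> (at z)"
  let ?g = "\<lambda>i z. indicator slab z * vfield c (snd z) $ i :: real"
  have gm[measurable]: "?g i \<in> borel_measurable borel" for i
    by (intro borel_measurable_times borel_measurable_indicator slab_measurable
        measurable_compose[OF vfield_snd_measurable borel_measurable_vec_component])
  have gb: "\<bar>?g i z\<bar> \<le> \<bar>c\<bar> + 2" for i z
    using component_le_norm_cart[of "vfield c (snd z)" i] norm_vfield_le[of c "snd z"]
    by (auto split: split_indicator)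
  have int: "integrable lborel (\<lambda>z. ?g i z * ?D z (0, axis i 1))" for i
  proof -
    obtain L where L: "0 < L" "\<And>x v. \<bar>?D x v\<bar> \<le> L * norm v" using C1c_deriv_bounded[OF \<phi>] by metis
    obtain r where r: "\<And>x v. x \<notin> cball 0 r \<Longrightarrow> ?D x v = 0" using C1c_support[OF \<phi>] by metis
    show ?thesis
    proof (rule integrable_bounded_support)
      show "(\<lambda>z. ?g i z * ?D z (0, axis i 1)) \<in> borel_measurable borel"
        by (intro borel_measurable_times[OF gm] C1c_deriv_measurable[OF \<phi>]) auto
      show "\<bar>?g i z * ?D z (0, axis i 1)\<bar> \<le> (\<bar>c\<bar> + 2) * (L * norm (0 :: real, axis i 1 :: r3))" for z
        unfolding abs_mult by (intro mult_mono L(2) gb[unfolded abs_mult]) auto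
      show "?g i z * ?D z (0, axis i 1) = 0" if "r < norm z" for z using r[of z] that by simp
    qed
  qed
  have zero: "(LINT z|lborel. ?g i z * ?D z (0, axis i 1)) = 0" if i: "i \<noteq> 1" for i
  proof (rule integral_deriv_invariant_eq_0[OF \<phi> gm gb])
    fix \<tau> :: real and z :: "real \<times> r3"
    obtain t x where z: "z = (t, x)" by (rule prod.exhaust)
    have "(t, x + \<tau> *\<^sub>R axis i 1) \<in> slab \<longleftrightarrow> (t, x) \<in> slab"
      using i by (simp add: slab_iff axis_def)
    then show "?g i (z + \<tau> *\<^sub>R (0, axis i 1)) = ?g i z"
      by (simp add: z vfield_invariant split: split_indicator)
  qed
  have "(LINT z|lborel. indicator slab z * (vfield c (snd z) \<bullet> grad_x \<phi> z))
      = (LINT z|lborel. (\<Sum>i\<in>UNIV. ?g i z * ?D z (0, axis i 1)))"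
    by (simp only: transport_eq_deriv(2)[OF \<phi>] sum_distrib_left mult.assoc)
  also have "\<dots> = (\<Sum>i\<in>UNIV. LINT z|lborel. ?g i z * ?D z (0, axis i 1))"
    by (intro Bochner_Integration.integral_sum int)
  also have "\<dots> = (LINT z|lborel. ?g 1 z * ?D z (0, axis 1 1))"
    using zero[of 2] zero[of 3] by (simp add: sum_3)
  also have "\<dots> = (LINT z|lborel. c * (indicator slab z * ?D z (0, axis 1 1)))"
    by (simp add: vfield_def mult_ac)
  finally show ?thesis by simp
qed

lemma grad_measurable:
  assumes \<phi>: "C1c \<phi>"
  shows "(\<lambda>z. vfield c (snd z) \<bullet> grad_x \<phi> z) \<in> borel_measurable borel"
  unfolding transport_eq_deriv(2)[OF \<phi>]
  by (intro borel_measurable_sum borel_measurable_times C1c_deriv_measurable[OF \<phi>]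
      measurable_compose[OF vfield_snd_measurable borel_measurable_vec_component]) auto

lemma dt_measurable: "C1c \<phi> \<Longrightarrow> dt \<phi> \<in> borel_measurable borel"
  unfolding dt_def[abs_def] by (rule C1c_deriv_measurable) auto

lemma div_free_vfield: "div_free half_space (\<lambda>z. vfield c (snd z))"
  unfolding div_free_def
proof (intro allI impI)
  fix \<eta> assume \<eta>: "test_fun slab \<eta>"
  have C: "C1c \<eta>" by (rule test_fun_C1c[OF \<eta>])
  have "(LINT z|lebesgue_on slab. vfield c (snd z) \<bullet> grad_x \<eta> z)
      = c * (LINT z|lborel. indicator slab z * frechet_derivative \<eta> (at z) (0, axis 1 1))"
    using lebesgue_on_integral[OF slab_measurable grad_measurable[OF C, of c]] integral_field_grad[OF C, of c]
    by simp
  also have "(LINT z|lborel. indicator slab z * frechet_derivative \<eta> (at z) (0, axis 1 1))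
      = (LINT z|lborel. 1 * frechet_derivative \<eta> (at z) (0, axis 1 1))"
    by (intro Bochner_Integration.integral_cong) (auto simp: test_fun_deriv_eq_0[OF \<eta>] split: split_indicator)
  also have "\<dots> = 0"
    by (rule integral_deriv_invariant_eq_0[OF C, where G = 1]) auto
  finally show "(LINT z|lebesgue_on slab. vfield c (snd z) \<bullet> grad_x \<eta> z) = 0" by simp
qed

text \<open>With the zero field, \<open>transport_slab\<close> becomes the fundamental theorem of
  calculus in the first variable, integrated over the others.\<close>

lemma shear_field_0: "shear_field (\<lambda>_. 0)"
  using shear_fieldI[of "\<lambda>_. 0" 0 0 0] by simp

lemma C1c_flat:
  assumes c: "0 < c" and \<phi>: "C1c \<phi>"
  shows "C1c (\<lambda>z. \<phi> (flat c z))"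
    and "frechet_derivative (\<lambda>z. \<phi> (flat c z)) (at z) v = frechet_derivative \<phi> (at (flat c z)) (flat c v)"
  by (rule C1c_compose_linear[OF \<phi> bounded_linear_flat norm_le_flat[OF c]])+

text \<open>The time derivative produces the initial integral. The normal derivative, weighted by
  the component \<open>c\<close>, produces \<open>- c\<close> times a Lebesgue integral over the
  boundary, and this factor is exactly the one in \<open>lat\<close>, which leaves the trace
  -1.\<close>

lemma normal_trace_vfield:
  assumes c: "0 < c"
    and lat: "\<And>f :: real \<times> r3 \<Rightarrow> real. f \<in> borel_measurable borel \<Longrightarrow>
      (LINT z | lateral_measure half_space. f z)
        = c * (LINT z | lborel. indicator {0<..<1} (fst z) * f (fst z, vec3 0 (snd z)))"
  shows "is_normal_trace half_space (\<lambda>z. vfield c (snd z)) (\<lambda>_. - 1)"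
  unfolding is_normal_trace_def test_fun_initial_def
proof (intro conjI allI impI)
  show "Linf (lateral_measure half_space) (\<lambda>_. - 1 :: real)"
    unfolding Linf_def by (auto intro: exI[of _ 1])
  fix \<phi> :: "real \<times> r3 \<Rightarrow> real" assume \<phi>: "test_fun ({..<1} \<times> UNIV) \<phi>"
  have C: "C1c \<phi>" by (rule test_fun_C1c[OF \<phi>])
  let ?D = "\<lambda>z. frechet_derivative \<phi> (at z)"
  have late: "\<phi> (t, x) = 0" "?D (t, x) v = 0" if "1 \<le> t" for t x v
    using that test_fun_eq_0[OF \<phi>, of "(t, x)"] test_fun_deriv_eq_0[OF \<phi>, of "(t, x)"] by auto
  have \<phi>m[measurable]: "\<phi> \<in> borel_measurable borel" by (rule C1c_measurable[OF C])
  have hm[measurable]: "half_space \<in> sets borel" using open_half_space by simp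
  obtain L where L: "0 < L" "\<And>x v. \<bar>?D x v\<bar> \<le> L * norm v" using C1c_deriv_bounded[OF C] by metis
  obtain r where r: "0 < r" "\<And>x. x \<notin> cball 0 r \<Longrightarrow> \<phi> x = 0" "\<And>x v. x \<notin> cball 0 r \<Longrightarrow> ?D x v = 0"
    using C1c_support[OF C] by metis
  have int: "integrable lborel (\<lambda>z. indicator slab z * ?D z v)" for v
  proof (rule integrable_bounded_support)
    show "(\<lambda>z. indicator slab z * ?D z v) \<in> borel_measurable borel"
      by (intro borel_measurable_times borel_measurable_indicator slab_measurable C1c_deriv_measurable[OF C]) auto
    show "\<bar>indicator slab z * ?D z v\<bar> \<le> L * norm v" for z
      using L(1) L(2)[of z v] by (auto split: split_indicator)
    show "indicator slab z * ?D z v = 0" if "r < norm z" for z using r(3)[of z] that by simp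
  qed
  \<comment> \<open>Here physical time plays the role of the first variable in
    \<open>transport_slab\<close>. Including \<open>t = 1\<close> in the interval changes nothing,
    as \<open>\<phi>\<close> and its derivative vanish there.\<close>
  have time: "(LINT z|lborel. indicator slab z * ?D z (1, 0)) = - (LINT x|lebesgue_on half_space. \<phi> (0, x))"
  proof -
    have "(LINT z|lborel. indicator slab z * ?D z (1, 0))
        = (LINT z|lborel. indicator {0<..1} (fst z) * indicator half_space (snd z - (fst z - 0) *\<^sub>R 0) * ?D z (1, 0))"
    proof (intro Bochner_Integration.integral_cong refl)
      fix z
      show "indicator slab z * ?D z (1, 0)
          = indicator {0<..1} (fst z) * indicator half_space (snd z - (fst z - 0) *\<^sub>R 0) * ?D z (1, 0)"
        using late(2)[of "fst z" "snd z"] by (cases z) (auto simp: cylinder_def split: split_indicator)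
    qed
    also have "\<dots> = (LINT y|lborel. indicator half_space (y - (1 - 0) *\<^sub>R 0) * \<phi> (1, y))
        - (LINT y|lborel. indicator half_space y * \<phi> (0, y))"
      by (rule transport_slab[OF C shear_field_0, where W = 1]) auto
    also have "(LINT y|lborel. indicator half_space (y - (1 - 0) *\<^sub>R 0) * \<phi> (1, y)) = 0"
      by (simp add: late)
    also have "(LINT y|lborel. indicator half_space y * \<phi> (0, y)) = (LINT x|lebesgue_on half_space. \<phi> (0, x))"
    proof (rule lebesgue_on_integral[symmetric])
      show "(\<lambda>x. \<phi> (0, x)) \<in> borel_measurable borel"
        by (rule measurable_compose[OF _ \<phi>m]) (intro borel_measurable_Pair'; simp)
    qed simp
    finally show ?thesis by simp
  qed
  let ?\<psi> = "\<lambda>z. \<phi> (flat c z)"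
  have C\<psi>: "C1c ?\<psi>" and D\<psi>: "\<And>z v. frechet_derivative ?\<psi> (at z) v = ?D (flat c z) (flat c v)"
    by (rule C1c_flat[OF c C])+
  obtain q where q: "0 < q" "\<And>x. x \<notin> cball 0 q \<Longrightarrow> ?\<psi> x = 0"
    "\<And>x v. x \<notin> cball 0 q \<Longrightarrow> frechet_derivative ?\<psi> (at x) v = 0"
    using C1c_support[OF C\<psi>] by metis
  define w where "w z = (indicator {0<..<1} (fst z) :: real)" for z :: "real \<times> (real \<times> real)"
  have wm: "w \<in> borel_measurable borel"
    unfolding w_def by (rule measurable_compose[OF borel_measurable_fst_snd(1)]) simp
  \<comment> \<open>Now \<open>s\<close> is the first variable. The upper end \<open>q + 1\<close>
    lies beyond the support of \<open>?\<psi>\<close>, so only the face \<open>s = 0\<close>, the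
    boundary, remains. One factor \<open>c\<close> is the Jacobian; the other turns the normal
    derivative into the derivative in \<open>s\<close>.\<close>
  have space: "c * (LINT z|lborel. indicator slab z * ?D z (0, axis 1 1))
      = (LINT z | lateral_measure half_space. - 1 * \<phi> z)"
  proof -
    have "c * (LINT z|lborel. indicator slab z * ?D z (0, axis 1 1))
        = c * (c * (LINT z|lborel. indicator slab (flat c z) * ?D (flat c z) (0, axis 1 1)))"
      using int[of "(0, axis 1 1)"] by (subst integral_flat[OF c]) auto
    also have "\<dots> = c * (LINT z|lborel. indicator slab (flat c z) * (c * ?D (flat c z) (0, axis 1 1)))"
      by (simp add: mult.left_commute)
    also have "(LINT z|lborel. indicator slab (flat c z) * (c * ?D (flat c z) (0, axis 1 1)))
        = (LINT z|lborel. indicator {0<..q+1} (fst z) * w (snd z - (fst z - 0) *\<^sub>R 0) * frechet_derivative ?\<psi> (at z) (1, 0))"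
    proof (intro Bochner_Integration.integral_cong refl)
      fix z :: "real \<times> (real \<times> (real \<times> real))"
      obtain s t y where z: "z = (s, (t, y))" by (metis prod.exhaust)
      have "flat c (1, 0) = c *\<^sub>R (0, axis 1 1)" by (simp add: flat_def vec3_def)
      then have 1: "frechet_derivative ?\<psi> (at z) (1, 0) = c * ?D (flat c z) (0, axis 1 1)"
        unfolding D\<psi> by (simp only: linear_scale[OF C1c_linear[OF C]] real_scaleR_def)
      have 2: "flat c z \<in> slab \<longleftrightarrow> 0 < s \<and> 0 < t \<and> t < 1"
        using c by (auto simp: z slab_iff zero_less_mult_iff)
      have 3: "frechet_derivative ?\<psi> (at z) (1, 0) = 0" if "q + 1 < s"
      proof (rule q(3))
        have "\<bar>s\<bar> \<le> norm z" using norm_fst_le[of s "(t, y)"] by (simp add: z)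
        then show "z \<notin> cball 0 q" using that by simp
      qed
      show "indicator slab (flat c z) * (c * ?D (flat c z) (0, axis 1 1))
          = indicator {0<..q+1} (fst z) * w (snd z - (fst z - 0) *\<^sub>R 0) * frechet_derivative ?\<psi> (at z) (1, 0)"
        unfolding 1[symmetric] using 2 3 by (auto simp: z w_def not_le split: split_indicator)
    qed
    also have "\<dots> = (LINT y|lborel. w (y - (q + 1 - 0) *\<^sub>R 0) * ?\<psi> (q + 1, y)) - (LINT y|lborel. w y * ?\<psi> (0, y))"
      by (rule transport_slab[OF C\<psi> shear_field_0 wm, where W = 1]) (use q(1) in \<open>auto simp: w_def\<close>)
    also have "(LINT y|lborel. w (y - (q + 1 - 0) *\<^sub>R 0) * ?\<psi> (q + 1, y)) = 0"
    proof -
      have "?\<psi> (q + 1, y) = 0" for y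
        using norm_fst_le[of "q + 1" y] q(1) by (intro q(2)) auto
      then show ?thesis by (simp only: mult_zero_right integral_zero)
    qed
    also have "c * (0 - (LINT y|lborel. w y * ?\<psi> (0, y)))
        = c * (LINT z | lborel. indicator {0<..<1} (fst z) * (- 1 * \<phi> (fst z, vec3 0 (snd z))))"
      by (simp add: w_def flat_def)
    also have "\<dots> = (LINT z | lateral_measure half_space. - 1 * \<phi> z)"
      by (rule lat[symmetric]) simp
    finally show ?thesis .
  qed
  have "(LINT z|lebesgue_on slab. dt \<phi> z + vfield c (snd z) \<bullet> grad_x \<phi> z)
      = (LINT z|lborel. indicator slab z * (dt \<phi> z + vfield c (snd z) \<bullet> grad_x \<phi> z))"
    by (intro lebesgue_on_integral borel_measurable_add dt_measurable grad_measurable C slab_measurable)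
  also have "\<dots> = (LINT z|lborel. indicator slab z * ?D z (1, 0))
      + (LINT z|lborel. indicator slab z * (vfield c (snd z) \<bullet> grad_x \<phi> z))"
  proof -
    have "integrable lborel (\<lambda>z. indicator slab z * (vfield c (snd z) \<bullet> grad_x \<phi> z))"
    proof (rule integrable_bounded_support)
      show "(\<lambda>z. indicator slab z * (vfield c (snd z) \<bullet> grad_x \<phi> z)) \<in> borel_measurable borel"
        by (intro borel_measurable_times borel_measurable_indicator slab_measurable grad_measurable C)
      show "\<bar>indicator slab z * (vfield c (snd z) \<bullet> grad_x \<phi> z)\<bar>
          \<le> (\<Sum>i\<in>(UNIV :: 3 set). (\<bar>c\<bar> + 2) * (L * norm (0 :: real, axis i 1 :: r3)))" for z
      proof -
        have "\<bar>vfield c (snd z) \<bullet> grad_x \<phi> z\<bar> \<le> (\<Sum>i\<in>UNIV. \<bar>vfield c (snd z) $ i * ?D z (0, axis i 1)\<bar>)"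
          unfolding transport_eq_deriv(2)[OF C] by (rule sum_abs)
        also have "\<dots> \<le> (\<Sum>i\<in>(UNIV :: 3 set). (\<bar>c\<bar> + 2) * (L * norm (0 :: real, axis i 1 :: r3)))"
          unfolding abs_mult
          by (intro sum_mono mult_mono L(2) order_trans[OF component_le_norm_cart norm_vfield_le]) auto
        finally show ?thesis using L(1) by (auto split: split_indicator intro!: sum_nonneg mult_nonneg_nonneg)
      qed
      show "indicator slab z * (vfield c (snd z) \<bullet> grad_x \<phi> z) = 0" if "r < norm z" for z
        using r(3)[of z] that by (simp add: transport_eq_deriv(2)[OF C])
    qed
    then show ?thesis
      using int[of "(1, 0)"] by (simp add: dt_def distrib_left)
  qed
  finally show "(LINT z | lateral_measure half_space. - 1 * \<phi> z) - (LINT x | lebesgue_on half_space. \<phi> (0, x))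
      = (LINT z | lebesgue_on slab. dt \<phi> z + vfield c (snd z) \<bullet> grad_x \<phi> z)"
    unfolding integral_field_grad[OF C] space time by simp
qed

section \<open>The solutions\<close>

definition transported :: "real \<Rightarrow> real \<times> r3 \<Rightarrow> real" where
  "transported c z = mix_sol (snd z $ 1 / c, (fst z, (snd z $ 2, snd z $ 3)))"

lemma transported_measurable [measurable]: "transported c \<in> borel_measurable borel"
  unfolding transported_def
  by (intro measurable_compose[OF _ mix_sol_measurable] borel_measurable_Pair' borel_measurable_divide
      borel_measurable_const borel_measurable_fst_snd(1)
      measurable_compose[OF borel_measurable_fst_snd(2) borel_measurable_vec_component])

text \<open>The change of variables \<open>flat\<close> reduces the integral to
  \<open>mix_sol_weak\<close>. Test functions are only required to vanish near \<open>t = 1\<close>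
  and at infinity, so all trace terms are included.\<close>

lemma transported_weak:
  assumes c: "0 < c" and \<phi>: "test_fun ({..<1} \<times> UNIV) \<phi>"
  shows "(LINT z|lebesgue_on slab. transported c z * (dt \<phi> z + vfield c (snd z) \<bullet> grad_x \<phi> z)) = 0"
proof -
  have C: "C1c \<phi>" by (rule test_fun_C1c[OF \<phi>])
  let ?D = "\<lambda>z. frechet_derivative \<phi> (at z)"
  let ?f = "\<lambda>z. transported c z * ?D z (1, vfield c (snd z))"
  have fm: "?f \<in> borel_measurable borel"
    by (intro borel_measurable_times transported_measurable C1c_deriv_measurable[OF C] borel_measurable_Pair'
        vfield_snd_measurable) auto
  have "(LINT z|lebesgue_on slab. transported c z * (dt \<phi> z + vfield c (snd z) \<bullet> grad_x \<phi> z))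
      = (LINT z|lborel. indicator slab z * ?f z)"
    unfolding transport_eq_deriv(1)[OF C] by (rule lebesgue_on_integral[OF slab_measurable fm])
  also have "\<dots> = (LINT z|lborel. ?f z)"
  proof (intro Bochner_Integration.integral_cong refl)
    fix z :: "real \<times> r3"
    obtain t x where z: "z = (t, x)" by (rule prod.exhaust)
    have "?f z = 0" if "z \<notin> slab"
    proof (cases "t < 1")
      case False
      then show ?thesis using test_fun_deriv_eq_0[OF \<phi>, of z] by (simp add: z)
    next
      case True
      have "\<not> (0 < x $ 1 / c \<and> x $ 1 / c \<le> 1 \<and> x $ 1 / c < t)"
      proof (intro notI, elim conjE)
        assume "0 < x $ 1 / c" "x $ 1 / c < t"
        then have "0 < t" "0 < x $ 1" using c by (linarith, simp add: zero_less_divide_iff)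
        then show False using that True by (simp add: z slab_iff)
      qed
      then have "transported c z = 0"
        using abs_mix_sol[of "x $ 1 / c" t "(x $ 2, x $ 3)"] by (auto simp: transported_def z)
      then show ?thesis by simp
    qed
    then show "indicator slab z * ?f z = ?f z" by (auto split: split_indicator)
  qed
  also have "\<dots> = c * (LINT z|lborel. ?f (flat c z))" by (rule integral_flat[OF c fm])
  also have "(LINT z|lborel. ?f (flat c z)) = (LINT z|lborel. mix_sol z *
      frechet_derivative (\<lambda>z. \<phi> (flat c z)) (at z) (1, (1, mix_field (fst z) (snd (snd z)))))"
  proof (intro Bochner_Integration.integral_cong refl)
    fix z :: "real \<times> (real \<times> (real \<times> real))"
    show "?f (flat c z) = mix_sol z *
        frechet_derivative (\<lambda>z. \<phi> (flat c z)) (at z) (1, (1, mix_field (fst z) (snd (snd z))))"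
      unfolding C1c_flat(2)[OF c C] using c by (cases z) (simp add: transported_def vfield_def)
  qed
  also have "\<dots> = 0"
  proof (rule mix_sol_weak[OF C1c_flat(1)[OF c C]])
    show "\<phi> (flat c (s, (t, y))) = 0" if "1 \<le> t" for s t y
      using that by (intro test_fun_eq_0[OF \<phi>]) simp
  qed
  finally show ?thesis by simp
qed

lemma test_fun_mono: "test_fun U f \<Longrightarrow> U \<subseteq> V \<Longrightarrow> test_fun V f"
  by (auto simp: test_fun_def compact_support_in_def)

text \<open>With zero traces the left-hand side of the trace identity is zero, so that identity is
  the weak one with the larger class of test functions, and the interior equation is a special case.
  By linearity every multiple \<open>k\<close> is covered.\<close>

lemma ibvp_solution_transported:
  assumes c: "0 < c" and tr: "is_normal_trace half_space (\<lambda>z. vfield c (snd z)) (\<lambda>_. - 1)"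
  shows "ibvp_solution half_space (\<lambda>z. vfield c (snd z)) (\<lambda>_. 0) (\<lambda>_. 0) (\<lambda>z. k * transported c z)"
proof -
  have weak: "(LINT z|lebesgue_on slab. k * transported c z * (dt \<phi> z + vfield c (snd z) \<bullet> grad_x \<phi> z)) = 0"
    if "test_fun ({..<1} \<times> UNIV) \<phi>" for \<phi>
    using transported_weak[OF c that] by (simp add: mult.assoc)
  have "norm (k * transported c z) \<le> \<bar>k\<bar>" for z
    using abs_mix_sol_le mult_left_mono[of "\<bar>transported c z\<bar>" 1 "\<bar>k\<bar>"]
    by (simp add: abs_mult transported_def)
  moreover have "(\<lambda>z. k * transported c z) \<in> borel_measurable borel" by measurable
  ultimately have "Linf (lebesgue_on slab) (\<lambda>z. k * transported c z)"
    unfolding Linf_def by (auto intro!: borel_measurable_lebesgue_on_borel exI[of _ "\<bar>k\<bar>"])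
  moreover have "slab \<subseteq> {..<1} \<times> UNIV" by (auto simp: cylinder_def)
  ultimately have "weak_solution half_space (\<lambda>z. vfield c (snd z)) (\<lambda>z. k * transported c z)"
    using weak unfolding weak_solution_def by (blast intro: test_fun_mono)
  moreover have "are_traces half_space (\<lambda>z. vfield c (snd z)) (\<lambda>z. k * transported c z) (\<lambda>_. 0) (\<lambda>_. 0)"
    using weak by (auto simp: are_traces_def test_fun_initial_def Linf_def intro: exI[of _ 0])
  ultimately show ?thesis
    unfolding ibvp_solution_def using tr by (intro conjI exI[of _ "\<lambda>_. - 1"] exI[of _ "\<lambda>_. 0"]) auto
qed

text \<open>The transported function has modulus 1 on the part of the cylinder where
  \<open>x $ 1 < c * t\<close>. This is a nonempty open set, hence not negligible, and on it
  different multiples differ at every point.\<close>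

lemma multiples_not_AE_eq:
  assumes c: "0 < c" and "k \<noteq> l"
  shows "\<not> (AE z in lebesgue_on slab. k * transported c z = l * transported c z)"
proof
  assume AE: "AE z in lebesgue_on slab. k * transported c z = l * transported c z"
  have AE': "AE z in lebesgue. z \<in> slab \<longrightarrow> k * transported c z = l * transported c z"
    using AE by (subst (asm) AE_restrict_space_iff) auto
  have nz: "transported c z \<noteq> 0" if "z \<in> slab" "snd z $ 1 < c * fst z" for z
  proof -
    have "0 < snd z $ 1 / c" "fst z < 1" using that c by (cases z; simp add: slab_iff)+
    moreover have "snd z $ 1 / c < fst z" using that c by (simp add: pos_divide_less_eq mult.commute)
    ultimately have "0 < snd z $ 1 / c \<and> snd z $ 1 / c \<le> 1 \<and> snd z $ 1 / c < fst z" by simp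
    then show ?thesis
      using abs_mix_sol[of "snd z $ 1 / c" "fst z" "(snd z $ 2, snd z $ 3)"] by (auto simp: transported_def)
  qed
  have op: "open (slab \<inter> {z. snd z $ 1 < c * fst z})"
    by (intro open_Int open_slab open_Collect_less continuous_intros)
  then have "slab \<inter> {z. snd z $ 1 < c * fst z} \<in> sets lebesgue" by simp
  moreover from AE' have "AE z in lebesgue. z \<notin> slab \<inter> {z. snd z $ 1 < c * fst z}"
    by eventually_elim (use nz \<open>k \<noteq> l\<close> in auto)
  ultimately have "negligible (slab \<inter> {z. snd z $ 1 < c * fst z})"
    by (simp only: negligible_iff_null_sets AE_iff_null_sets)
  \<comment> \<open>At \<open>t = 1/2\<close> the front is at \<open>x $ 1 = c / 2\<close>; the
    point chosen lies halfway between the boundary and the front.\<close>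
  moreover have "(1/2, vec3 (c / 4) 0) \<in> slab \<inter> {z. snd z $ 1 < c * fst z}"
    using c by (simp add: slab_iff)
  ultimately show False using open_not_negligible[OF op] by blast
qed

theorem theorem1p2:
  shows "\<exists>b :: real \<times> (real ^ 3) \<Rightarrow> real ^ 3.
    Linf (lebesgue_on (cylinder half_space)) b \<and>
    div_free half_space b \<and>
    (\<forall>U. open U \<and> bounded U \<and> closure U \<subseteq> half_space \<longrightarrow> L1_BV U b) \<and>
    is_normal_trace half_space b (\<lambda>_. - 1) \<and>
    (\<exists>S :: (real \<times> (real ^ 3) \<Rightarrow> real) set.
       infinite S \<and>
       (\<forall>u\<in>S. ibvp_solution half_space b (\<lambda>_. 0) (\<lambda>_. 0) u) \<and>
       (\<forall>u\<in>S. \<forall>v\<in>S. u \<noteq> v \<longrightarrow>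
          \<not> (AE z in lebesgue_on (cylinder half_space). u z = v z)))"
proof -
  obtain c :: real where c: "0 < c"
    and lat: "\<And>f :: real \<times> r3 \<Rightarrow> real. f \<in> borel_measurable borel \<Longrightarrow>
      (LINT z | lateral_measure half_space. f z)
        = c * (LINT z | lborel. indicator {0<..<1} (fst z) * f (fst z, vec3 0 (snd z)))"
    by (rule lateral_integral) (blast intro: that)
  have tr: "is_normal_trace half_space (\<lambda>z. vfield c (snd z)) (\<lambda>_. - 1)"
    by (rule normal_trace_vfield[OF c lat])
  let ?u = "\<lambda>k :: real. \<lambda>z. k * transported c z"
  have ne: "\<not> (AE z in lebesgue_on slab. ?u k z = ?u l z)" if "?u k \<noteq> ?u l" for k l
    using that by (intro multiples_not_AE_eq[OF c]) auto
  have "inj ?u"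
  proof (rule injI, rule ccontr)
    fix k l assume "?u k = ?u l" "k \<noteq> l"
    then have "AE z in lebesgue_on slab. ?u k z = ?u l z" by (intro AE_I2) (rule fun_cong)
    then show False using multiples_not_AE_eq[OF c \<open>k \<noteq> l\<close>] by blast
  qed
  then have "infinite (range ?u)"
    using infinite_UNIV_char_0 finite_imageD by blast
  moreover have "\<forall>v\<in>range ?u. ibvp_solution half_space (\<lambda>z. vfield c (snd z)) (\<lambda>_. 0) (\<lambda>_. 0) v"
    using ibvp_solution_transported[OF c tr] by blast
  moreover have "\<forall>v\<in>range ?u. \<forall>w\<in>range ?u. v \<noteq> w \<longrightarrow> \<not> (AE z in lebesgue_on slab. v z = w z)"
    using ne by blast
  ultimately have S: "\<exists>S :: (real \<times> r3 \<Rightarrow> real) set. infinite S \<and>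
      (\<forall>u\<in>S. ibvp_solution half_space (\<lambda>z. vfield c (snd z)) (\<lambda>_. 0) (\<lambda>_. 0) u) \<and>
      (\<forall>u\<in>S. \<forall>v\<in>S. u \<noteq> v \<longrightarrow> \<not> (AE z in lebesgue_on slab. u z = v z))"
    by (intro exI[of _ "range ?u"] conjI)
  have "Linf (lebesgue_on slab) (\<lambda>z. vfield c (snd z))"
    unfolding Linf_def using norm_vfield_le[of c]
    by (auto intro!: borel_measurable_lebesgue_on_borel vfield_snd_measurable exI[of _ "\<bar>c\<bar> + 2"])
  moreover have "\<forall>U. open U \<and> bounded U \<and> closure U \<subseteq> half_space \<longrightarrow> L1_BV U (\<lambda>z. vfield c (snd z))"
    using L1_BV_vfield[OF c] by blast
  ultimately show ?thesis
    by (intro exI[of _ "\<lambda>z. vfield c (snd z)"] conjI div_free_vfield tr S)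
qed

end
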